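(* Let $p,q\ge 0$ be integers with $p+q\ge1$, and let $a_1|a_1',\dots,a_q|a_q'$, $b_1|b_1',\dots,b_p|b_p'\in\Lambda_{\mathbb C}$ satisfy $\operatorname{Re}(a_\alpha+a_\alpha')>0$ for all $\alpha$, $\operatorname{Re}(b_\beta+b_\beta')>0$ for all $\beta$, and $\sum_{\alpha=1}^q \operatorname{Re}(a_\alpha+a_\alpha')+\sum_{\beta=1}^p\operatorname{Re}(b_\beta+b_\beta')<p+q$. Then the function $F(z):={}_pG_q^{\mathbb C}\big[{(a|a')\atop (b|b')};z\big]$, considered on $\mathbb C\setminus\{0\}$ if $p\neq q$ and on $\{z\in\mathbb C: z\ne0,\ |z|\neq1\}$ if $p=q$, satisfies the system of differential equations $$\mathcal D F=0,\qquad \overline{\mathcal D}F=0,$$ where $$\mathcal D:=(-1)^q\prod_{\alpha=1}^q\Big(z\frac{\partial}{\partial z}-a_\alpha\Big)-z\prod_{\beta=1}^p\Big(z\frac{\partial}{\partial z}+b_\beta\Big),$$ $$\overline{\mathcal D}:=(-1)^p\prod_{\alpha=1}^q\Big(\bar z\frac{\partial}{\partial\bar z}-a_\alpha'\Big)-\bar z\prod_{\beta=1}^p\Big(\bar z\frac{\partial}{\partial\bar z}+b_\beta'\Big).$$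
   Context: $\frac{\partial}{\partial z},\frac{\partial}{\partial\bar z}$ are the Wirtinger derivatives. $\Lambda_{\mathbb C}$ is the set of pairs $a|a'$ with $a,a'\in\mathbb C$ and $a-a'\in\mathbb Z$. For $z\in\mathbb C\setminus\{0\}$ and $a|a'\in\Lambda_{\mathbb C}$ put $z^{a|a'}:=z^a\bar z^{\,a'}:=(z/|z|)^{a-a'}|z|^{a+a'}$. In particular $z^{\frac{-k-\sigma}2|\frac{k-\sigma}2}=(z/|z|)^{-k}|z|^{-\sigma}$ for $k\in\mathbb Z$, $\sigma\in\mathbb C$. The Gamma function of the complex field is the meromorphic function on $\Lambda_{\mathbb C}$ given by $\Gamma^{\mathbb C}(a|a')=\dfrac{\Gamma(a)}{\Gamma(1-a')}$. For $k\in\mathbb Z$, $\sigma\in\mathbb C$ put $${}_p\mathcal K_q^{\mathbb C}\Big[{(a|a')\atop (b|b')};\tfrac{k+\sigma}2\Big|\tfrac{-k+\sigma}2\Big]:=\prod_{\alpha=1}^q\Gamma^{\mathbb C}\big(a_\alpha+\tfrac{k+\sigma}2\big|a_\alpha'+\tfrac{-k+\sigma}2\big)\prod_{\beta=1}^p\Gamma^{\mathbb C}\big(b_\beta+\tfrac{-k-\sigma}2\big|b_\beta'+\tfrac{k-\sigma}2\big)$$ and $${}_pG_q^{\mathbb C}\Big[{(a|a')\atop (b|b')};z\Big]:=\frac1{2\pi i}\sum_{k\in\mathbb Z}\int_{i\mathbb R}{}_p\mathcal K_q^{\mathbb C}\Big[{(a|a')\atop (b|b')};\tfrac{k+\sigma}2\Big|\tfrac{-k+\sigma}2\Big]\,z^{\frac{-k-\sigma}2|\frac{k-\sigma}2}\,d\sigma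 ,$$ the integrals over the imaginary axis (taken upward) being conditionally convergent improper integrals. *)

theory Defs
  imports "HOL-Complex_Analysis.Complex_Analysis"
begin

definition Lambda_C :: "(complex \<times> complex) set" where
  "Lambda_C = {(a, a'). a - a' \<in> \<int>}"

text \<open>The power \<open>z\<^sup>a\<^sup>|\<^sup>a\<^sup>'\<close> for \<open>z \<noteq> 0\<close> and \<open>(a, a') \<in> Lambda_C\<close>.  The first exponent is an
  integer, so the branch chosen by \<^const>\<open>powr\<close> plays no role there.\<close>

definition cpow :: "complex \<Rightarrow> complex \<Rightarrow> complex \<Rightarrow> complex" where
  "cpow z a a' =
     (z / of_real (cmod z)) powr (a - a') * of_real (cmod z) powr (a + a')"

text \<open>\<open>Gamma a / Gamma (1 - a')\<close> as a meromorphic function on \<^const>\<open>Lambda_C\<close>, whose components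
  are the complex lines \<open>{(a + u, a' + u) | u}\<close>.  On such a line the numerator and the denominator
  may have a common pole (\<open>a \<in> {0, -1, \<dots>}\<close> and \<open>a' \<in> {1, 2, \<dots>}\<close>), where the quotient of the
  totalised \<^const>\<open>Gamma\<close> would be \<open>0 / 0 = 0\<close>; \<^const>\<open>remove_sings\<close> supplies the limit instead.  At
  a genuine pole the value is the dummy \<open>0\<close>.\<close>

definition Gamma_C :: "complex \<Rightarrow> complex \<Rightarrow> complex" where
  "Gamma_C a a' = remove_sings (\<lambda>u. Gamma (a + u) / Gamma (1 - (a' + u))) 0"

text \<open>Parameter families are indexed by \<open>{1..q}\<close> and \<open>{1..p}\<close>; other values of the functions are
  ignored.\<close>

definition K_C ::
  "nat \<Rightarrow> nat \<Rightarrow> (nat \<Rightarrow> complex) \<Rightarrow> (nat \<Rightarrow> complex) \<Rightarrow> (nat \<Rightarrow> complex) \<Rightarrow> (nat \<Rightarrow> complex) \<Rightarrow>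
     int \<Rightarrow> complex \<Rightarrow> complex" where
  "K_C p q a a' b b' k \<sigma> =
     (\<Prod>\<alpha>=1..q. Gamma_C (a \<alpha> + (of_int k + \<sigma>) / 2) (a' \<alpha> + (- of_int k + \<sigma>) / 2)) *
     (\<Prod>\<beta>=1..p. Gamma_C (b \<beta> + (- of_int k - \<sigma>) / 2) (b' \<beta> + (of_int k - \<sigma>) / 2))"

definition G_integrand ::
  "nat \<Rightarrow> nat \<Rightarrow> (nat \<Rightarrow> complex) \<Rightarrow> (nat \<Rightarrow> complex) \<Rightarrow> (nat \<Rightarrow> complex) \<Rightarrow> (nat \<Rightarrow> complex) \<Rightarrow>
     complex \<Rightarrow> int \<Rightarrow> complex \<Rightarrow> complex" where
  "G_integrand p q a a' b b' z k \<sigma> =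
     K_C p q a a' b b' k \<sigma> * cpow z ((- of_int k - \<sigma>) / 2) ((of_int k - \<sigma>) / 2)"

text \<open>Integration over the imaginary axis, upward, with \<open>\<sigma> = \<i> t\<close>.  The Henstock-Kurzweil integral
  over \<^const>\<open>UNIV\<close> is, by its definition, the limit of the integrals over \<open>[-R, S]\<close> as \<open>R\<close> and \<open>S\<close>
  tend to infinity independently; hence it covers conditionally convergent improper integrals.\<close>

definition imag_axis_integrable :: "(complex \<Rightarrow> complex) \<Rightarrow> bool" where
  "imag_axis_integrable f \<longleftrightarrow> (\<lambda>t::real. f (\<i> * of_real t) * \<i>) integrable_on UNIV"

definition imag_axis_integral :: "(complex \<Rightarrow> complex) \<Rightarrow> complex" where
  "imag_axis_integral f = integral UNIV (\<lambda>t::real. f (\<i> * of_real t) * \<i>)"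

definition G_C ::
  "nat \<Rightarrow> nat \<Rightarrow> (nat \<Rightarrow> complex) \<Rightarrow> (nat \<Rightarrow> complex) \<Rightarrow> (nat \<Rightarrow> complex) \<Rightarrow> (nat \<Rightarrow> complex) \<Rightarrow>
     complex \<Rightarrow> complex" where
  "G_C p q a a' b b' z =
     1 / (2 * of_real pi * \<i>) *
     (\<Sum>\<^sub>\<infinity>k\<in>(UNIV :: int set). imag_axis_integral (G_integrand p q a a' b b' z k))"

text \<open>\<^const>\<open>integral\<close> and \<^const>\<open>infsum\<close> are \<open>0\<close> in case of divergence, so that \<^const>\<open>G_C\<close> is
  meaningful only where the following holds.\<close>

definition G_C_converges ::
  "nat \<Rightarrow> nat \<Rightarrow> (nat \<Rightarrow> complex) \<Rightarrow> (nat \<Rightarrow> complex) \<Rightarrow> (nat \<Rightarrow> complex) \<Rightarrow> (nat \<Rightarrow> complex) \<Rightarrow>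
     complex \<Rightarrow> bool" where
  "G_C_converges p q a a' b b' z \<longleftrightarrow>
     (\<forall>k. imag_axis_integrable (G_integrand p q a a' b b' z k)) \<and>
     (\<lambda>k. imag_axis_integral (G_integrand p q a a' b b' z k)) summable_on (UNIV :: int set)"

definition G_domain :: "nat \<Rightarrow> nat \<Rightarrow> complex set" where
  "G_domain p q = (if p = q then {z. z \<noteq> 0 \<and> cmod z \<noteq> 1} else {z. z \<noteq> 0})"

text \<open>Partial derivatives with respect to the real coordinates of \<open>z = x + \<i> y\<close>.\<close>

definition d_x :: "(complex \<Rightarrow> complex) \<Rightarrow> complex \<Rightarrow> complex" where
  "d_x f z = frechet_derivative f (at z) 1"

definition d_y :: "(complex \<Rightarrow> complex) \<Rightarrow> complex \<Rightarrow> complex" where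
  "d_y f z = frechet_derivative f (at z) \<i>"

definition d_z :: "(complex \<Rightarrow> complex) \<Rightarrow> complex \<Rightarrow> complex" where
  "d_z f z = (d_x f z - \<i> * d_y f z) / 2"

definition d_zbar :: "(complex \<Rightarrow> complex) \<Rightarrow> complex \<Rightarrow> complex" where
  "d_zbar f z = (d_x f z + \<i> * d_y f z) / 2"

text \<open>\<open>n\<close> times continuously differentiable in the real sense on an open set \<open>U\<close>.  This guarantees
  that every derivative in a differential expression of order at most \<open>n\<close> exists.\<close>

primrec real_C_diff_on :: "nat \<Rightarrow> (complex \<Rightarrow> complex) \<Rightarrow> complex set \<Rightarrow> bool" where
  "real_C_diff_on 0 f U \<longleftrightarrow> continuous_on U f"
| "real_C_diff_on (Suc n) f U \<longleftrightarrow>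
     (\<forall>z\<in>U. f differentiable (at z)) \<and> real_C_diff_on n (d_x f) U \<and> real_C_diff_on n (d_y f) U"

text \<open>The operator product \<open>T 1 \<circ> T 2 \<circ> \<dots> \<circ> T n\<close>.\<close>

definition op_prod :: "nat \<Rightarrow> (nat \<Rightarrow> 'f \<Rightarrow> 'f) \<Rightarrow> 'f \<Rightarrow> 'f" where
  "op_prod n T = foldr (\<lambda>j S. T j \<circ> S) [1..<Suc n] id"

definition D_op ::
  "nat \<Rightarrow> nat \<Rightarrow> (nat \<Rightarrow> complex) \<Rightarrow> (nat \<Rightarrow> complex) \<Rightarrow> (complex \<Rightarrow> complex) \<Rightarrow> complex \<Rightarrow> complex"
  where
  "D_op p q a b F z =
     (-1) ^ q * op_prod q (\<lambda>\<alpha> f w. w * d_z f w - a \<alpha> * f w) F z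
     - z * op_prod p (\<lambda>\<beta> f w. w * d_z f w + b \<beta> * f w) F z"

definition Dbar_op ::
  "nat \<Rightarrow> nat \<Rightarrow> (nat \<Rightarrow> complex) \<Rightarrow> (nat \<Rightarrow> complex) \<Rightarrow> (complex \<Rightarrow> complex) \<Rightarrow> complex \<Rightarrow> complex"
  where
  "Dbar_op p q a' b' F z =
     (-1) ^ p * op_prod q (\<lambda>\<alpha> f w. cnj w * d_zbar f w - a' \<alpha> * f w) F z
     - cnj z * op_prod p (\<lambda>\<beta> f w. cnj w * d_zbar f w + b' \<beta> * f w) F z"

end

theory Submission
  imports Defs
begin

text \<open>
  The integrand decays only like a small negative power of \<open>|k + \<sigma>|\<close>, so the defining integral cannot
  be differentiated directly.  Let \<open>p \<le> q\<close>, and \<open>|z| < 1\<close> if \<open>p = q\<close>.  The functional equation of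
  the Gamma function gives \<open>K (k, \<sigma> - 2) = \<rho> (k, \<sigma>) K (k, \<sigma>)\<close> with a rational \<open>\<rho>\<close> such that
  \<open>|\<rho>| |z|\<^sup>2 \<le> \<theta>\<^sup>2 < 1\<close> as soon as \<open>k + \<sigma>\<close> and \<open>\<sigma> - k\<close> are both large.  Hence the integrand decays
  exponentially as \<open>Re \<sigma> \<rightarrow> -\<infinity>\<close> away from its poles, whose imaginary parts are bounded and whose
  real parts are at most about \<open>-|k|\<close>.  For every \<open>k\<close> the imaginary axis is therefore replaced by two
  horizontal rays \<open>Im \<sigma> = \<plusminus>T\<close> running to \<open>-\<infinity>\<close>, joined by a vertical segment whose distance from
  the axis grows like \<open>|k| / 2\<close>.  On these contours everything converges exponentially in \<open>k\<close> and along
  the rays, and Wirtinger derivatives become multiplications by the exponents.  The differential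
  equations then amount to \<open>\<Gamma>\<^sup>C (a + 1 | a') = a \<Gamma>\<^sup>C (a | a')\<close> and
  \<open>\<Gamma>\<^sup>C (a | a' + 1) = - a' \<Gamma>\<^sup>C (a | a')\<close> together with the shift \<open>(k, \<sigma>) \<mapsto> (k \<plusminus> 1, \<sigma> + 1)\<close> of the
  contours, during which no pole is crossed.  The remaining cases follow by \<open>z \<mapsto> 1 / z\<close>, which
  exchanges the roles of \<open>a, q\<close> and \<open>b, p\<close>.
\<close>

section \<open>The Gamma function of the complex field\<close>

text \<open>The hypothesis on the sum of the parameters acts through the number \<open>decay\<close>
  > 0: near the axis the kernel is O(|k + i Im \<sigma>|^(-\<open>decay\<close>)), which tends to 0
  but need not be integrable. This suffices to bend the axis onto rays: a cut of the axis at height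
  y is joined to a ray by a horizontal segment on which the integrand is at most C
  y^(-\<open>decay\<close>) times a decaying exponential. Convergence of the line integrals is thus
  an outcome of the deformation, not an input. For large arguments |\<rho>| behaves like |(k +
  \<sigma>)(\<sigma> - k) / 4|^(p - q). For p = q it only tends to 1, so the contraction must come
  from |z|. Hence r is fixed, everything is proved for |z| < r on annuli, and the annuli are glued
  at the end. The bound for Gamma^C must be uniform in k. Up to exchanging its two arguments, its
  modulus is that of a quotient of Gamma values placed symmetrically about a centre with real part
  at least 1/2; Euler's limit compares these factor by factor.\<close>

lemma Gamma_C_eq:
  assumes "S \<notin> \<int>\<^sub>\<le>\<^sub>0"
  shows "Gamma_C S S' = Gamma S * rGamma (1 - S')"
proof -
  \<comment> \<open>\<open>rGamma\<close> is entire, so off the poles of the numerator the quotient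
    is analytic in the line parameter and \<open>remove_sings\<close> keeps its value at 0.\<close>
  have "(\<lambda>u. Gamma (S + u) * rGamma (1 - (S' + u))) analytic_on {0}"
    using assms by (intro analytic_intros) auto
  then show ?thesis
    unfolding Gamma_C_def using remove_sings_at_analytic
    by (fastforce simp: rGamma_inverse_Gamma divide_inverse)
qed

lemma sin_add_of_int_pi:
  fixes x :: complex
  shows "sin (x + of_int n * of_real pi) = (-1) powi n * sin x"
proof -
  have "of_int n * of_real pi = complex_of_real (pi * of_int n)" by simp
  then show ?thesis
    by (simp only: sin_add sin_of_real cos_of_real sin_npi_int cos_npi_int)
      (simp add: power_int_minus_left)
qed

lemma eventually_at_not_Ints: "eventually (\<lambda>w. w \<notin> \<int>) (at (S :: complex))"
proof (cases "S \<in> \<int>")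
  case True
  have "w \<notin> \<int>" if "w \<noteq> S" "dist w S < 1" for w
  proof
    assume "w \<in> \<int>"
    then obtain m where m: "w - S = of_int m" using True Ints_diff Ints_cases by metis
    then have "\<bar>real_of_int m\<bar> < 1" using that by (simp add: dist_norm)
    then have "m = 0" by linarith
    then show False using m that by simp
  qed
  then show ?thesis unfolding eventually_at by (intro exI[of _ 1]) auto
next
  case False
  have "open (- \<int> :: complex set)" using closed_Ints by (simp add: open_Compl)
  then have "eventually (\<lambda>w. w \<in> - \<int>) (nhds S)" using False by (intro eventually_nhds_in_open) auto
  then show ?thesis by (auto simp: eventually_at_filter elim: eventually_mono)
qed

text \<open>The reflection formula at \<open>S\<close> and at \<open>S'\<close>: the two sines
  differ only by the sign (-1)^n, since their arguments differ by n pi. The symmetry gives access to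
  points where \<open>S\<close> is a nonpositive integer and \<open>S'\<close> is not.\<close>

lemma Gamma_ratio_swap:
  fixes S S' :: complex
  assumes "S - S' = of_int n" "S \<notin> \<int>"
  shows "Gamma S / Gamma (1 - S') = (-1) powi n * (Gamma S' / Gamma (1 - S))"
proof -
  have S: "S = S' + of_int n" using assms by (simp add: algebra_simps)
  have nz: "S' \<notin> \<int>" using assms S by auto
  have "Gamma S * Gamma (1 - S) = of_real pi / sin (of_real pi * S)"
    by (rule Gamma_reflection_complex)
  moreover have "Gamma S' * Gamma (1 - S') = of_real pi / sin (of_real pi * S')"
    by (rule Gamma_reflection_complex)
  moreover have "sin (of_real pi * S) = (-1) powi n * sin (of_real pi * S')"
    unfolding S using sin_add_of_int_pi[of "of_real pi * S'" n] by (simp add: algebra_simps)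
  ultimately have "Gamma S * Gamma (1 - S) = (-1) powi n * (Gamma S' * Gamma (1 - S'))"
    by (cases "even n") simp_all
  moreover have "Gamma (1 - S) \<noteq> 0" "Gamma (1 - S') \<noteq> 0"
    using assms nz by (auto simp: Gamma_eq_zero_iff dest: nonpos_Ints_Int)
  ultimately show ?thesis by (simp add: field_simps)
qed

text \<open>Integers are isolated, so the swapped quotient agrees with the defining one on a
  punctured neighbourhood; it is analytic at the centre. Its value there is the one that
  \<open>remove_sings\<close> supplies, also at common poles of numerator and denominator.\<close>

lemma Gamma_C_eq':
  assumes "S - S' = of_int n" "S' \<notin> \<int>\<^sub>\<le>\<^sub>0"
  shows "Gamma_C S S' = (-1) powi n * Gamma S' * rGamma (1 - S)"
proof -
  let ?g = "\<lambda>u. (-1) powi n * Gamma (S' + u) * rGamma (1 - (S + u))"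
  have an: "?g analytic_on {0}"
    using assms by (intro analytic_intros) auto
  have "eventually (\<lambda>u. S + u \<notin> \<int>) (at 0)"
  proof -
    have "\<forall>\<^sub>F w in at S. w \<notin> \<int>"
      by (rule eventually_at_not_Ints)
    then show ?thesis by (subst (asm) at_to_0) (simp add: eventually_filtermap add.commute)
  qed
  then have "eventually (\<lambda>u. Gamma (S + u) / Gamma (1 - (S' + u)) = ?g u) (at 0)"
    by eventually_elim
      (subst Gamma_ratio_swap[of _ _ n], use assms in \<open>auto simp: rGamma_inverse_Gamma divide_inverse\<close>)
  then have "Gamma_C S S' = remove_sings ?g 0"
    unfolding Gamma_C_def by (rule remove_sings_cong) simp
  also have "\<dots> = ?g 0" using an by simp
  finally show ?thesis by simp
qed

text \<open>By \<open>Gamma_C_eq\<close> and \<open>Gamma_C_eq'\<close> the function is analytic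
  along its line wherever one of the two components avoids the nonpositive integers; only these
  points are left as poles.\<close>

definition Gamma_C_pole :: "complex \<Rightarrow> complex \<Rightarrow> bool" where
  "Gamma_C_pole S S' \<longleftrightarrow> S \<in> \<int>\<^sub>\<le>\<^sub>0 \<and> S' \<in> \<int>\<^sub>\<le>\<^sub>0"

text \<open>Nonpositive reals x and y satisfy x + y <= -|x - y|. The criterion is phrased by sum and
  difference because in the kernel \<sigma> enters only the sum of the two arguments and k only
  their difference.\<close>

lemma not_Gamma_C_poleI:
  assumes "Im S \<noteq> 0 \<or> Re (S + S') > - \<bar>Re (S - S')\<bar>"
  shows "\<not> Gamma_C_pole S S'"
  using assms by (auto simp: Gamma_C_pole_def elim!: nonpos_Ints_cases)

text \<open>Off the poles one of the two product formulas applies, and it applies on a neighbourhood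
  because the nonpositive integers form a closed set. The slope \<open>c\<close> will be 1/2 for the
  a-factors and -1/2 for the b-factors.\<close>

lemma Gamma_C_field_differentiable:
  assumes "x - x' \<in> \<int>" "\<not> Gamma_C_pole (x + c * z) (x' + c * z)"
  shows "(\<lambda>z. Gamma_C (x + c * z) (x' + c * z)) field_differentiable (at z)"
proof -
  obtain n where n: "x - x' = of_int n" using assms Ints_cases by metis
  have "(\<lambda>z. Gamma_C (x + c * z) (x' + c * z)) analytic_on {z}"
  proof (cases "x + c * z \<in> \<int>\<^sub>\<le>\<^sub>0")
    case False
    have "open ((\<lambda>w. x + c * w) -` (- \<int>\<^sub>\<le>\<^sub>0))"
      by (intro open_vimage continuous_intros) (simp add: open_Compl)
    then have "eventually (\<lambda>w. x + c * w \<notin> \<int>\<^sub>\<le>\<^sub>0) (nhds z)"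
      using eventually_nhds_in_open[of _ z] False by fastforce
    then have "eventually (\<lambda>w. Gamma_C (x + c * w) (x' + c * w) =
        Gamma (x + c * w) * rGamma (1 - (x' + c * w))) (nhds z)"
      by eventually_elim (rule Gamma_C_eq)
    moreover have "(\<lambda>w. Gamma (x + c * w) * rGamma (1 - (x' + c * w))) analytic_on {z}"
      using False by (intro analytic_intros) auto
    ultimately show ?thesis by (subst analytic_at_cong[OF _ refl])
  next
    case True
    then have F: "x' + c * z \<notin> \<int>\<^sub>\<le>\<^sub>0" using assms by (auto simp: Gamma_C_pole_def)
    have "open ((\<lambda>w. x' + c * w) -` (- \<int>\<^sub>\<le>\<^sub>0))"
      by (intro open_vimage continuous_intros) (simp add: open_Compl)
    then have "eventually (\<lambda>w. x' + c * w \<notin> \<int>\<^sub>\<le>\<^sub>0) (nhds z)"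
      using eventually_nhds_in_open[of _ z] F by fastforce
    then have "eventually (\<lambda>w. Gamma_C (x + c * w) (x' + c * w) =
        (-1) powi n * Gamma (x' + c * w) * rGamma (1 - (x + c * w))) (nhds z)"
      by eventually_elim (rule Gamma_C_eq', use n in auto)
    moreover have "(\<lambda>w. (-1) powi n * Gamma (x' + c * w) * rGamma (1 - (x + c * w))) analytic_on {z}"
      using F by (intro analytic_intros) auto
    ultimately show ?thesis by (subst analytic_at_cong[OF _ refl])
  qed
  then show ?thesis by (rule analytic_on_imp_differentiable_at) simp
qed

text \<open>The functional equation of \<open>Gamma\<close>, or that of \<open>rGamma\<close> in the
  swapped formula. Poles have to be excluded: for S = S' = 0 the right side is 0 while the left side
  is 1.\<close>

lemma Gamma_C_plus1_left:
  assumes "S - S' \<in> \<int>" "\<not> Gamma_C_pole S S'"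
  shows "Gamma_C (S + 1) S' = S * Gamma_C S S'"
proof (cases "S \<in> \<int>\<^sub>\<le>\<^sub>0")
  case False
  then have "S + 1 \<notin> \<int>\<^sub>\<le>\<^sub>0" using plus_one_in_nonpos_Ints_imp by blast
  then show ?thesis using False by (simp add: Gamma_C_eq Gamma_plus1)
next
  case True
  then have F: "S' \<notin> \<int>\<^sub>\<le>\<^sub>0" using assms by (auto simp: Gamma_C_pole_def)
  obtain n where n: "S - S' = of_int n" using assms Ints_cases by metis
  have n1: "S + 1 - S' = of_int (n + 1)" using n by (simp add: algebra_simps)
  have "rGamma (- S) = - S * rGamma (1 - S)"
    using rGamma_plus1[of "-S"] by (simp add: algebra_simps)
  then show ?thesis
    by (simp add: Gamma_C_eq'[OF n F] Gamma_C_eq'[OF n1 F] power_int_add)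
qed

lemma Gamma_C_plus1_right:
  assumes "S - S' \<in> \<int>" "\<not> Gamma_C_pole S S'"
  shows "Gamma_C S (S' + 1) = - S' * Gamma_C S S'"
proof (cases "S \<in> \<int>\<^sub>\<le>\<^sub>0")
  case False
  have "rGamma (- S') = - S' * rGamma (1 - S')"
    using rGamma_plus1[of "-S'"] by (simp add: algebra_simps)
  then show ?thesis using False by (simp add: Gamma_C_eq)
next
  case True
  then have F: "S' \<notin> \<int>\<^sub>\<le>\<^sub>0" using assms by (auto simp: Gamma_C_pole_def)
  then have F1: "S' + 1 \<notin> \<int>\<^sub>\<le>\<^sub>0" using plus_one_in_nonpos_Ints_imp by blast
  obtain n where n: "S - S' = of_int n" using assms Ints_cases by metis
  have n1: "S - (S' + 1) = of_int (n - 1)" using n by (simp add: algebra_simps)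
  show ?thesis using F
    by (simp add: Gamma_C_eq'[OF n F] Gamma_C_eq'[OF n1 F1] power_int_diff Gamma_plus1)
qed

lemma Gamma_C_plus1_both:
  assumes "S - S' \<in> \<int>" "\<not> Gamma_C_pole S S'"
  shows "Gamma_C (S + 1) (S' + 1) = - S * S' * Gamma_C S S'"
proof -
  have "\<not> Gamma_C_pole (S + 1) S'"
    using assms plus_one_in_nonpos_Ints_imp by (auto simp: Gamma_C_pole_def)
  moreover have "S + 1 - S' \<in> \<int>"
    using assms(1) by (metis Ints_1 Ints_add add_diff_eq diff_add_eq)
  ultimately show ?thesis
    using Gamma_C_plus1_left[OF assms] Gamma_C_plus1_right[of "S+1" S'] by simp
qed

section \<open>Uniform power bounds for quotients of Gamma values\<close>

lemma ln_ratio_bounds: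
  fixes \<xi> N :: real
  assumes "\<xi> > 0" "\<xi>\<^sup>2 \<le> N"
  shows "ln ((N + 2 * \<xi> + 1) / N) / 2 \<le> \<xi> / N + 1 / (2 * N)" "\<xi> / N - 2 / N \<le> ln ((N + 2 * \<xi> + 1) / N) / 2"
proof -
  have N: "N > 0" using assms by (metis less_le_trans zero_less_power)
  \<comment> \<open>For N = |c|^2 and \<xi> = Re c the quotient is |c + 1|^2 / |c|^2, so the claim
    reads ln(|c + 1| / |c|) = Re(1/c) + O(|c|^-2). Both bounds use ln x <= x - 1, for the quotient
    and then for its reciprocal.\<close>
  have "ln ((N + 2 * \<xi> + 1) / N) \<le> (N + 2 * \<xi> + 1) / N - 1"
    using N assms by (intro ln_le_minus_one) auto
  also have "\<dots> = (2 * \<xi> + 1) / N" using N by (simp add: field_simps)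
  finally show "ln ((N + 2 * \<xi> + 1) / N) / 2 \<le> \<xi> / N + 1 / (2 * N)"
    using N by (simp add: field_simps)
  have "ln (N / (N + 2 * \<xi> + 1)) \<le> N / (N + 2 * \<xi> + 1) - 1"
    using N assms by (intro ln_le_minus_one) auto
  moreover have "ln (N / (N + 2 * \<xi> + 1)) = - ln ((N + 2 * \<xi> + 1) / N)"
    using N assms by (simp add: ln_div)
  ultimately have "1 - N / (N + 2 * \<xi> + 1) \<le> ln ((N + 2 * \<xi> + 1) / N)" by simp
  moreover have "1 - N / (N + 2 * \<xi> + 1) \<ge> 2 * (\<xi> / N - 2 / N)"
  proof -
    have D: "N + 2 * \<xi> + 1 > 0" using N assms by simp
    have "2 * (\<xi> / N - 2 / N) * (N * (N + 2 * \<xi> + 1)) = (2 * \<xi> - 4) * (N + 2 * \<xi> + 1)"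
      using N by (simp add: field_simps)
    \<comment> \<open>The positive term 4 \<xi>^2 is absorbed by -4 N, which stems from the constant
      2 in \<open>2 / N\<close>.\<close>
    also have "\<dots> \<le> (2 * \<xi> + 1) * N"
      using assms N by (simp add: algebra_simps power2_eq_square)
    also have "\<dots> = (1 - N / (N + 2 * \<xi> + 1)) * (N * (N + 2 * \<xi> + 1))"
      using D by (simp add: field_simps)
    finally show ?thesis using N D by (simp add: mult_le_cancel_right)
  qed
  ultimately have "2 * (\<xi> / N - 2 / N) \<le> ln ((N + 2 * \<xi> + 1) / N)" by linarith
  then show "\<xi> / N - 2 / N \<le> ln ((N + 2 * \<xi> + 1) / N) / 2"
    by (subst pos_le_divide_eq) (simp_all only: zero_less_numeral mult.commute)
qed

text \<open>The logarithms of |c + h| / |c - h| and of (|c + 1| / |c|)^(2h) are both 2h Re(1/c) up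
  to O(|c|^-2). This power is the right comparison because it telescopes along c, c + 1, c + 2, ...,
  while the errors remain summable.\<close>

lemma norm_ratio_bound:
  fixes c :: complex and h H :: real
  assumes c: "Re c > 0" and h: "\<bar>h\<bar> \<le> H" and R: "norm c \<ge> 4 * H + 1"
  shows "norm (c + of_real h) \<le> norm (c - of_real h) * (norm (c + 1) / norm c) powr (2 * h) *
     exp ((8 * H\<^sup>2 + 4 * H ^ 3 + 4 * H) / (norm c)\<^sup>2)"
proof -
  define N \<xi> where "N = (norm c)\<^sup>2" and "\<xi> = Re c"
  have H: "H \<ge> 0" using h by linarith
  have N1: "N \<ge> 1" unfolding N_def using R H
    by (metis add_increasing2 le_add_same_cancel2 mult_nonneg_nonneg one_le_power order_trans zero_le_numeral add.commute)
  have N: "N > 0" using N1 by simp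
  have x: "\<xi> > 0" "\<xi>\<^sup>2 \<le> N" using c by (auto simp: \<xi>_def N_def cmod_power2)
  have sq: "sqrt N = norm c" "\<xi> \<le> sqrt N" using x by (auto simp: N_def \<xi>_def complex_Re_le_cmod)
  have np: "(norm (c + of_real h))\<^sup>2 = N + h\<^sup>2 + 2 * h * \<xi>"
    "(norm (c - of_real h))\<^sup>2 = N + h\<^sup>2 - 2 * h * \<xi>"
    "(norm (c + 1))\<^sup>2 = N + 2 * \<xi> + 1"
    by (simp_all add: N_def \<xi>_def cmod_power2) (simp_all add: power2_eq_square algebra_simps)
  have hx: "\<bar>2 * h * \<xi>\<bar> \<le> 2 * H * \<xi>" using h x H by (simp add: abs_mult mult_mono)
  have "2 * H * \<xi> \<le> 2 * H * sqrt N" using sq H by (simp add: mult_left_mono)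
  also have "\<dots> \<le> sqrt N * sqrt N / 2"
  proof -
    have "4 * H \<le> sqrt N" using R sq by simp
    then have "4 * H * sqrt N \<le> sqrt N * sqrt N" by (intro mult_right_mono) (use N in auto)
    then show ?thesis by simp
  qed
  also have "\<dots> = N / 2" using N by simp
  finally have hx2: "2 * H * \<xi> \<le> N / 2" .
  \<comment> \<open>D is |c - h|^2. The lower bound on |c| makes it at least N/2, so that D may be
    traded for N in denominators.\<close>
  define D where "D = N + h\<^sup>2 - 2 * h * \<xi>"
  have hN: "\<bar>2 * h * \<xi>\<bar> \<le> N / 2" "h\<^sup>2 \<ge> 0" using hx hx2 by auto
  have D: "D \<ge> N / 2" "D > 0" using hN N unfolding D_def abs_le_iff by linarith+
  have Dp: "N + h\<^sup>2 + 2 * h * \<xi> > 0" using hN N unfolding abs_le_iff by linarith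
  have "ln ((N + h\<^sup>2 + 2 * h * \<xi>) / D) \<le> (N + h\<^sup>2 + 2 * h * \<xi>) / D - 1"
    using D Dp by (intro ln_le_minus_one) auto
  also have "\<dots> = 4 * h * \<xi> / D" using D by (simp add: field_simps D_def)
  \<comment> \<open>An exact exchange of D for N. Its remainder, after the final halving, gives 8
    H^2 + 4 H^3 in the exponent; the summand 4 H comes from \<open>ln_ratio_bounds\<close>.\<close>
  also have "\<dots> = 4 * h * \<xi> / N + 4 * h * \<xi> * (2 * h * \<xi> - h\<^sup>2) / (N * D)"
  proof -
    have e: "2 * h * \<xi> - h\<^sup>2 = N - D" by (simp add: D_def)
    show ?thesis unfolding e using \<open>D > 0\<close> N by (simp add: divide_simps) (simp add: algebra_simps)
  qed
  also have "4 * h * \<xi> * (2 * h * \<xi> - h\<^sup>2) / (N * D) \<le> (16 * H\<^sup>2 + 8 * H ^ 3) / N"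
  proof -
    have "4 * h * \<xi> * (2 * h * \<xi> - h\<^sup>2) = 8 * h\<^sup>2 * \<xi>\<^sup>2 - 4 * h ^ 3 * \<xi>"
      by (simp add: power2_eq_square power3_eq_cube algebra_simps)
    moreover have "8 * h\<^sup>2 * \<xi>\<^sup>2 \<le> 8 * H\<^sup>2 * N"
    proof -
      have "h\<^sup>2 \<le> H\<^sup>2" using h H by (simp add: abs_le_square_iff[symmetric])
      then have "h\<^sup>2 * \<xi>\<^sup>2 \<le> H\<^sup>2 * N" using x by (intro mult_mono) auto
      then show ?thesis by simp
    qed
    moreover have "- (4 * h ^ 3 * \<xi>) \<le> 4 * H ^ 3 * N"
    proof -
      have "- (4 * h ^ 3 * \<xi>) \<le> \<bar>4 * h ^ 3 * \<xi>\<bar>" by linarith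
      also have "\<dots> = 4 * \<bar>h\<bar> ^ 3 * \<xi>" using x by (simp add: abs_mult power_abs)
      also have "\<dots> \<le> 4 * H ^ 3 * N"
      proof (intro mult_mono power_mono)
        have "sqrt N \<ge> 1" using N1 by simp
        then have "sqrt N * 1 \<le> sqrt N * sqrt N" by (intro mult_left_mono) auto
        moreover have "sqrt N * sqrt N = N" using N by simp
        ultimately show "\<xi> \<le> N" using sq by linarith
      qed (use h x H in auto)
      finally show ?thesis .
    qed
    ultimately have "4 * h * \<xi> * (2 * h * \<xi> - h\<^sup>2) \<le> (8 * H\<^sup>2 + 4 * H ^ 3) * N"
      unfolding distrib_right by linarith
    also have "\<dots> \<le> (8 * H\<^sup>2 + 4 * H ^ 3) * (2 * D)" using D H by (intro mult_left_mono) auto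
    finally show ?thesis using N D by (simp add: divide_simps) (simp add: algebra_simps)
  qed
  finally have A: "ln ((N + h\<^sup>2 + 2 * h * \<xi>) / D) \<le> 4 * h * \<xi> / N + (16 * H\<^sup>2 + 8 * H ^ 3) / N" by simp
  have B: "h * \<xi> / N \<le> h * (ln ((N + 2 * \<xi> + 1) / N) / 2) + 2 * H / N"
  proof -
    define e where "e = \<xi> / N - ln ((N + 2 * \<xi> + 1) / N) / 2"
    have "1 / (2 * N) \<le> 2 / N" using N by (simp add: field_simps)
    then have e: "\<bar>e\<bar> \<le> 2 / N" using ln_ratio_bounds[OF x] unfolding e_def abs_le_iff by linarith
    have "h * e \<le> \<bar>h\<bar> * \<bar>e\<bar>" by (simp flip: abs_mult)
    also have "\<dots> \<le> H * (2 / N)" using h e H by (intro mult_mono) auto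
    finally have "h * e \<le> H * (2 / N)" .
    then show ?thesis by (simp add: e_def algebra_simps)
  qed
  have "2 * ln (norm (c + of_real h) / norm (c - of_real h)) = ln ((N + h\<^sup>2 + 2 * h * \<xi>) / D)"
  proof -
    have "norm (c + of_real h) > 0" "norm (c - of_real h) > 0" using np Dp D D_def by (auto simp flip: zero_less_power2)
    then show ?thesis using Dp D by (simp add: ln_div D_def flip: np) (simp add: ln_realpow)
  qed
  moreover have "ln ((N + 2 * \<xi> + 1) / N) / 2 = ln (norm (c + 1) / norm c)"
  proof -
    have "norm (c + 1) > 0" "norm c > 0" using np x N sq by (auto simp flip: zero_less_power2)
    moreover have "(N + 2 * \<xi> + 1) / N = (norm (c + 1) / norm c) ^ 2"
      by (simp add: power_divide np N_def)
    ultimately show ?thesis by (simp add: ln_realpow)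
  qed
  ultimately have E: "ln (norm (c + of_real h) / norm (c - of_real h)) \<le>
      2 * h * ln (norm (c + 1) / norm c) + (8 * H\<^sup>2 + 4 * H ^ 3 + 4 * H) / N"
  proof -
    define L e g where "L = ln (norm (c + 1) / norm c)" and "e = (8 * H\<^sup>2 + 4 * H ^ 3) / N"
      and "g = h * \<xi> / N"
    assume *: "2 * ln (norm (c + of_real h) / norm (c - of_real h)) = ln ((N + h\<^sup>2 + 2 * h * \<xi>) / D)"
      "ln ((N + 2 * \<xi> + 1) / N) / 2 = ln (norm (c + 1) / norm c)"
    have "g \<le> h * L + 2 * H / N" using B unfolding *(2) by (simp add: g_def L_def)
    moreover have "(16 * H\<^sup>2 + 8 * H ^ 3) / N = 2 * e" by (simp add: e_def add_divide_distrib)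
    moreover have "4 * h * \<xi> / N = 4 * g" by (simp add: g_def)
    ultimately have "2 * ln (norm (c + of_real h) / norm (c - of_real h)) \<le> 4 * (h * L) + 4 * (2 * H / N) + 2 * e"
      using A unfolding *(1) by linarith
    moreover have "(8 * H\<^sup>2 + 4 * H ^ 3 + 4 * H) / N = e + 2 * (2 * H / N)" by (simp add: e_def add_divide_distrib)
    ultimately show ?thesis by (simp add: L_def)
  qed
  have pos: "norm (c + of_real h) > 0" "norm (c - of_real h) > 0" "norm (c + 1) > 0" "norm c > 0"
    using np Dp D D_def x N sq by (auto simp flip: zero_less_power2)
  have "norm (c + of_real h) / norm (c - of_real h) \<le> exp (2 * h * ln (norm (c + 1) / norm c) + (8 * H\<^sup>2 + 4 * H ^ 3 + 4 * H) / N)"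
    using E pos by (metis divide_pos_pos exp_le_cancel_iff exp_ln)
  also have "\<dots> = (norm (c + 1) / norm c) powr (2 * h) * exp ((8 * H\<^sup>2 + 4 * H ^ 3 + 4 * H) / N)"
    using pos by (simp add: powr_def exp_add)
  finally show ?thesis using pos by (simp add: divide_le_eq N_def mult_ac)
qed

text \<open>\<open>norm_ratio_bound\<close> multiplied over the factors of the Pochhammer symbols:
  the powers telescope and the exponents of the errors add up.\<close>

lemma pochhammer_ratio_bound:
  fixes c :: complex and h H :: real
  assumes c: "Re c > 0" and h: "\<bar>h\<bar> \<le> H" and R: "norm c \<ge> 4 * H + 1"
  shows "norm (pochhammer (c + of_real h) n) \<le> norm (pochhammer (c - of_real h) n) *
     (norm (c + of_nat n) / norm c) powr (2 * h) *
     exp ((8 * H\<^sup>2 + 4 * H ^ 3 + 4 * H) * (\<Sum>j<n. 1 / (norm (c + of_nat j))\<^sup>2))"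
proof (induction n)
  case 0
  have "norm c > 0" using c by auto
  then show ?case by simp
next
  case (Suc n)
  define E where "E = 8 * H\<^sup>2 + 4 * H ^ 3 + 4 * H"
  define S where "S = (\<Sum>j<n. 1 / (norm (c + of_nat j))\<^sup>2)"
  have "Re (c + of_nat n) > 0" using c by simp
  have ge: "norm c \<le> norm (c + of_nat n)"
    using c by (simp add: cmod_def real_sqrt_le_mono)
  have pos: "norm c > 0" "norm (c + of_nat n) > 0" "norm (c + of_nat (Suc n)) > 0"
    using c by (auto simp: complex_eq_iff)
  have step: "norm (c + of_nat n + of_real h) \<le> norm (c + of_nat n - of_real h) *
     (norm (c + of_nat n + 1) / norm (c + of_nat n)) powr (2 * h) * exp (E / (norm (c + of_nat n))\<^sup>2)"
    unfolding E_def by (rule norm_ratio_bound) (use c h R ge in auto)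
  have "norm (pochhammer (c + of_real h) (Suc n)) =
      norm (pochhammer (c + of_real h) n) * norm (c + of_nat n + of_real h)"
    by (simp add: pochhammer_Suc norm_mult add_ac)
  also have "\<dots> \<le> (norm (pochhammer (c - of_real h) n) *
     (norm (c + of_nat n) / norm c) powr (2 * h) * exp (E * S)) *
     (norm (c + of_nat n - of_real h) *
     (norm (c + of_nat n + 1) / norm (c + of_nat n)) powr (2 * h) * exp (E / (norm (c + of_nat n))\<^sup>2))"
    using Suc step by (intro mult_mono) (auto simp: E_def S_def)
  also have "\<dots> = norm (pochhammer (c - of_real h) (Suc n)) *
     ((norm (c + of_nat n) / norm c) powr (2 * h) * (norm (c + of_nat (Suc n)) / norm (c + of_nat n)) powr (2 * h)) *
     exp (E * (S + 1 / (norm (c + of_nat n))\<^sup>2))"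
    by (simp only: pochhammer_Suc norm_mult exp_add ring_distribs of_nat_Suc)
      (simp add: algebra_simps flip: norm_mult)
  also have "(norm (c + of_nat n) / norm c) powr (2 * h) * (norm (c + of_nat (Suc n)) / norm (c + of_nat n)) powr (2 * h)
     = (norm (c + of_nat (Suc n)) / norm c) powr (2 * h)"
    using pos by (subst powr_mult[symmetric]) (auto simp: field_simps)
  finally show ?case by (simp add: E_def S_def)
qed

lemma norm_Gamma_series:
  "n > 0 \<Longrightarrow> norm (Gamma_series (z :: complex) n) = fact n * real n powr Re z / norm (pochhammer z (n + 1))"
  by (simp add: Gamma_series_def norm_divide norm_mult powr_def)

text \<open>A uniform form of |Gamma(c - h) / Gamma(c + h)| ~ |c|^(-2h). In Euler's limit
  \<open>pochhammer_ratio_bound\<close> compares the denominators; the factor n^(-2h) from the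
  numerators cancels the growth of |c + n + 1|^(2h), and |c|^(-2h) remains.\<close>

lemma Gamma_ratio_bound:
  fixes H :: real
  assumes "H \<ge> 0"
  obtains C where "C > 0" "\<And>c h. Re c \<ge> 1 / 2 \<Longrightarrow> \<bar>h\<bar> \<le> H \<Longrightarrow> norm c \<ge> 4 * H + 1 \<Longrightarrow>
     norm (Gamma (c - of_real h)) \<le> C * norm c powr (- 2 * h) * norm (Gamma (c + of_real h))"
proof
  define E where "E = 8 * H\<^sup>2 + 4 * H ^ 3 + 4 * H"
  have E: "E \<ge> 0" using assms by (simp add: E_def)
  \<comment> \<open>Re c >= 1/2 gives |c + j| >= (j + 1)/2, so the squared reciprocals of |c + j|
    sum to at most 4 times pi^2 / 6, whatever c is.\<close>
  define C where "C = exp (E * (4 * (pi\<^sup>2 / 6)))"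
  show "C > 0" by (simp add: C_def)
  fix c :: complex and h :: real
  assume c: "Re c \<ge> 1 / 2" and h: "\<bar>h\<bar> \<le> H" and R: "norm c \<ge> 4 * H + 1"
  have c0: "norm c > 0" using R assms by linarith
  have nz: "c + of_nat j + of_real x \<noteq> 0" if "\<bar>x\<bar> \<le> H" for x j
  proof
    assume *: "c + of_nat j + of_real x = 0"
    have "norm c \<le> norm (c + of_nat j)" using c by (simp add: cmod_def real_sqrt_le_mono)
    moreover have "norm (c + of_nat j) = \<bar>x\<bar>"
      using * by (metis add_eq_0_iff2 norm_minus_cancel norm_of_real)
    ultimately show False using R that assms by simp
  qed
  have poch: "norm (pochhammer (c + of_real x) n) > 0" if "\<bar>x\<bar> \<le> H" for x n
  proof -
    have "c + of_real x \<noteq> - of_nat j" for j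
      using nz[OF that, of j] by (metis add.commute add.left_commute add.left_inverse)
    then show ?thesis by (simp add: pochhammer_eq_0_iff)
  qed
  have S: "(\<Sum>j<n. 1 / (norm (c + of_nat j))\<^sup>2) \<le> 4 * (pi\<^sup>2 / 6)" for n
  proof -
    have "(\<Sum>j<n. 1 / (norm (c + of_nat j))\<^sup>2) \<le> (\<Sum>j<n. 4 * (1 / (real j + 1)\<^sup>2))"
    proof (intro sum_mono)
      fix j
      have "(real j + 1) / 2 \<le> Re (c + of_nat j)" using c by simp
      also have "\<dots> \<le> norm (c + of_nat j)" by (rule complex_Re_le_cmod)
      finally have "((real j + 1) / 2)\<^sup>2 \<le> (norm (c + of_nat j))\<^sup>2" by (intro power_mono) auto
      then have "1 / (norm (c + of_nat j))\<^sup>2 \<le> 1 / ((real j + 1) / 2)\<^sup>2"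
        by (intro le_imp_inverse_le[unfolded inverse_eq_divide]) simp_all
      then show "1 / (norm (c + of_nat j))\<^sup>2 \<le> 4 * (1 / (real j + 1)\<^sup>2)" by (simp add: power_divide)
    qed
    also have "\<dots> = 4 * (\<Sum>j<n. 1 / (real j + 1)\<^sup>2)" by (simp add: sum_distrib_left)
    also have "(\<Sum>j<n. 1 / (real j + 1)\<^sup>2) \<le> pi\<^sup>2 / 6"
      using inverse_squares_sums sum_le_suminf[of "\<lambda>n. 1 / (real n + 1)\<^sup>2" "{..<n}"]
      by (simp add: sums_iff add.commute)
    finally show ?thesis by simp
  qed
  have key: "norm (Gamma_series (c - of_real h) n) \<le>
     (norm (c + of_nat (n + 1)) / real n) powr (2 * h) * (C * norm c powr (- 2 * h) * norm (Gamma_series (c + of_real h) n))"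
    if n: "n > 0" for n
  proof -
    define P Q A where "P = norm (pochhammer (c + of_real h) (n + 1))" and "Q = norm (pochhammer (c - of_real h) (n + 1))"
      and "A = norm (c + of_nat (n + 1))"
    have pq: "P > 0" "Q > 0" unfolding P_def Q_def using poch[of h] poch[of "-h"] h by auto
    have "A > 0" unfolding A_def using c by (auto simp: complex_eq_iff)
    have "P \<le> Q * (A / norm c) powr (2 * h) * exp (E * (\<Sum>j<n+1. 1 / (norm (c + of_nat j))\<^sup>2))"
      unfolding P_def Q_def E_def A_def by (rule pochhammer_ratio_bound) (use c h R in auto)
    also have "\<dots> \<le> Q * (A / norm c) powr (2 * h) * C"
    proof -
      have "exp (E * (\<Sum>j<n+1. 1 / (norm (c + of_nat j))\<^sup>2)) \<le> C"
        unfolding C_def by (rule iffD2[OF exp_le_cancel_iff]) (rule mult_left_mono[OF S E])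
      then show ?thesis by (rule mult_left_mono) (use pq in simp)
    qed
    finally have le: "P \<le> Q * (A / norm c) powr (2 * h) * C" .
    then have "1 / Q \<le> (A / norm c) powr (2 * h) * C / P" using pq by (simp add: field_simps)
    then have "fact n * real n powr (Re c - h) * (1 / Q) \<le> fact n * real n powr (Re c - h) * ((A / norm c) powr (2 * h) * C / P)"
      by (intro mult_left_mono) auto
    moreover have "real n powr (Re c - h) * (A / norm c) powr (2 * h) =
       (A / real n) powr (2 * h) * norm c powr (- 2 * h) * real n powr (Re c + h)"
      using n \<open>A > 0\<close> c0 by (simp add: powr_def ln_div ring_distribs flip: exp_add)
    ultimately show ?thesis
      using n by (simp add: norm_Gamma_series P_def Q_def A_def mult_ac)
  qed
  have "(\<lambda>n. norm (c + of_nat (n + 1)) / real n) \<longlonglongrightarrow> 1"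
  proof -
    have "(\<lambda>n. norm ((c + 1) / of_nat n + 1)) \<longlonglongrightarrow> norm (0 + 1 :: complex)"
      by (intro tendsto_intros lim_const_over_n)
    moreover have "eventually (\<lambda>n. norm ((c + 1) / of_nat n + 1) = norm (c + of_nat (n + 1)) / real n) sequentially"
      using eventually_gt_at_top[of 0]
    proof eventually_elim
      case (elim n)
      have "(c + 1) / of_nat n + 1 = (c + of_nat (n + 1)) / of_nat n" using elim by (simp add: field_simps)
      then show ?case by (simp add: norm_divide)
    qed
    ultimately show ?thesis by (simp add: tendsto_cong)
  qed
  then have "(\<lambda>n. (norm (c + of_nat (n + 1)) / real n) powr (2 * h)) \<longlonglongrightarrow> 1 powr (2 * h)"
    by (intro tendsto_powr tendsto_const) auto
  then have "(\<lambda>n. (norm (c + of_nat (n + 1)) / real n) powr (2 * h) * (C * norm c powr (- 2 * h) * norm (Gamma_series (c + of_real h) n)))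
      \<longlonglongrightarrow> 1 powr (2 * h) * (C * norm c powr (- 2 * h) * norm (Gamma (c + of_real h)))"
    by (intro tendsto_mult tendsto_const tendsto_norm Gamma_series_LIMSEQ)
  moreover have "(\<lambda>n. norm (Gamma_series (c - of_real h) n)) \<longlonglongrightarrow> norm (Gamma (c - of_real h))"
    by (intro tendsto_intros)
  ultimately show "norm (Gamma (c - of_real h)) \<le> C * norm c powr (- 2 * h) * norm (Gamma (c + of_real h))"
    using key by (intro LIMSEQ_le[where X = "\<lambda>n. norm (Gamma_series (c - of_real h) n)"]) (auto intro!: exI[of _ 1])
qed

text \<open>By \<open>Gamma_C_eq'\<close>, the case \<open>Re S \<ge> Re S'\<close> suffices to bound \<^const>\<open>Gamma_C\<close>.\<close>

lemma Gamma_rGamma_bound: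
  fixes X :: real
  assumes "X \<ge> 0"
  obtains C where "C > 0" "\<And>S S'. Im S = Im S' \<Longrightarrow> Re S \<ge> Re S' \<Longrightarrow> \<bar>Re (S + S')\<bar> \<le> X \<Longrightarrow>
      norm (S + 1 - cnj S') \<ge> 4 * X + 6 \<Longrightarrow> S \<notin> \<int>\<^sub>\<le>\<^sub>0 \<and>
      norm (Gamma S * rGamma (1 - S')) \<le> C * norm ((S + 1 - cnj S') / 2) powr (Re (S + S') - 1)"
proof -
  obtain C where C: "C > 0" "\<And>c h. Re c \<ge> 1 / 2 \<Longrightarrow> \<bar>h\<bar> \<le> (X + 1) / 2 \<Longrightarrow> norm c \<ge> 4 * ((X + 1) / 2) + 1 \<Longrightarrow>
     norm (Gamma (c - of_real h)) \<le> C * norm c powr (- 2 * h) * norm (Gamma (c + of_real h))"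
    using Gamma_ratio_bound[of "(X + 1) / 2"] assms by auto
  show ?thesis
  proof
    show "C > 0" by fact
    fix S S' assume im: "Im S = Im S'" and re: "Re S \<ge> Re S'" and X: "\<bar>Re (S + S')\<bar> \<le> X"
      and big: "norm (S + 1 - cnj S') \<ge> 4 * X + 6"
    \<comment> \<open>Conjugation does not change moduli, so 1 - S' may be replaced by 1 - conj S'.
      As Im S = Im S', the points S and 1 - conj S' lie on one horizontal line, with midpoint
      \<open>c\<close> and half distance \<open>h\<close>; Re S >= Re S' gives Re c >= 1/2.\<close>
    define c where "c = (S + 1 - cnj S') / 2"
    define h where "h = (1 - Re (S + S')) / 2"
    have "norm c = norm (S + 1 - cnj S') / 2" by (simp add: c_def norm_divide)
    then have c: "Re c \<ge> 1 / 2" "norm c \<ge> 4 * ((X + 1) / 2) + 1"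
      using re big by (auto simp: c_def add_divide_distrib distrib_left)
    have h: "\<bar>h\<bar> \<le> (X + 1) / 2" using X by (auto simp: h_def)
    have S: "S = c - of_real h" and S': "1 - cnj S' = c + of_real h"
      using im by (auto simp: c_def h_def complex_eq_iff field_simps)
    have "S \<notin> \<int>\<^sub>\<le>\<^sub>0"
    proof
      assume "S \<in> \<int>\<^sub>\<le>\<^sub>0"
      then obtain m where "S = of_int m" "m \<le> 0" by (rule nonpos_Ints_cases)
      then have "Im c = 0" "Re c \<le> h" using S by (auto simp: complex_eq_iff)
      then have "norm c \<le> \<bar>h\<bar>" using c by (simp add: cmod_eq_Re)
      then show False using h c(2) assms by (simp add: add_divide_distrib)
    qed
    moreover have "norm (rGamma (1 - S')) = inverse (norm (Gamma (c + of_real h)))"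
      by (metis S' rGamma_inverse_Gamma norm_inverse cnj_Gamma complex_cnj_diff complex_cnj_one complex_cnj_cnj complex_mod_cnj)
    moreover have "norm (Gamma S) \<le> C * norm c powr (- 2 * h) * norm (Gamma (c + of_real h))"
      unfolding S by (rule C) (use c h in auto)
    moreover have e: "Re (S + S') - 1 = - 2 * h" by (simp add: h_def)
    moreover have "x * inverse g \<le> y" if "x \<le> y * g" "g \<ge> 0" "y \<ge> 0" for x y g :: real
      using that by (cases "g = 0") (auto simp: field_simps)
    ultimately show "S \<notin> \<int>\<^sub>\<le>\<^sub>0 \<and>
        norm (Gamma S * rGamma (1 - S')) \<le> C * norm ((S + 1 - cnj S') / 2) powr (Re (S + S') - 1)"
      using \<open>C > 0\<close> unfolding c_def[symmetric] norm_mult e by simp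
  qed
qed

lemma powr_comparable:
  fixes x y e X :: real
  assumes "y > 0" "y / 4 \<le> x" "x \<le> y" "\<bar>e\<bar> \<le> X"
  shows "x powr e \<le> 4 powr X * y powr e"
proof (cases "e \<ge> 0")
  case True
  have "x powr e \<le> y powr e" using assms True by (intro powr_mono2) auto
  moreover have "1 \<le> (4 :: real) powr X" using assms by (intro ge_one_powr_ge_zero) auto
  ultimately show ?thesis by (metis mult_le_cancel_right1 order_trans powr_ge_zero linorder_not_le)
next
  case False
  have "x powr e \<le> (y / 4) powr e" using assms False by (intro powr_mono2') auto
  also have "\<dots> = 4 powr (- e) * y powr e" using assms by (simp add: powr_divide powr_minus_divide)
  also have "\<dots> \<le> 4 powr X * y powr e" using assms by (intro mult_right_mono powr_mono) auto
  finally show ?thesis .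
qed

text \<open>The centre supplied by \<open>Gamma_rGamma_bound\<close> is w / 2 with w = 1 + |k + m| +
  2 i Im S and m = a - a', for either order of Re S and Re S'. On the strip w differs from |k| + i
  Im \<sigma> by a bounded amount, so |w| may be replaced by |k + i Im \<sigma>| at the cost of a
  constant.\<close>

lemma Gamma_C_strip_bound:
  fixes X :: real
  assumes L: "(a, a') \<in> Lambda_C" and X: "X \<ge> 0"
  obtains C M where "C > 0" "M > 0" "\<And>k \<sigma>. \<bar>Re \<sigma>\<bar> \<le> X \<Longrightarrow> norm (Complex (of_int k) (Im \<sigma>)) \<ge> M \<Longrightarrow>
     norm (Gamma_C (a + (of_int k + \<sigma>) / 2) (a' + (- of_int k + \<sigma>) / 2)) \<le>
       C * norm (Complex (of_int k) (Im \<sigma>)) powr (Re (a + a') + Re \<sigma> - 1)"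
proof -
  obtain m where m: "a - a' = of_int m" using L by (auto simp: Lambda_C_def elim: Ints_cases)
  then have a: "a' = a - of_int m" by (simp add: algebra_simps)
  define Y where "Y = X + \<bar>Re (a + a')\<bar>"
  obtain C where C: "C > 0" "\<And>S S'. Im S = Im S' \<Longrightarrow> Re S \<ge> Re S' \<Longrightarrow> \<bar>Re (S + S')\<bar> \<le> Y \<Longrightarrow>
      norm (S + 1 - cnj S') \<ge> 4 * Y + 6 \<Longrightarrow> S \<notin> \<int>\<^sub>\<le>\<^sub>0 \<and>
      norm (Gamma S * rGamma (1 - S')) \<le> C * norm ((S + 1 - cnj S') / 2) powr (Re (S + S') - 1)"
    using Gamma_rGamma_bound[of Y] X by (auto simp: Y_def)
  \<comment> \<open>\<open>d\<close> bounds the distance from w to |k| + i Im \<sigma>. The part 2 d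
    of \<open>M\<close> makes the two moduli agree up to a factor 2; the rest of \<open>M\<close>
    meets the size condition of \<open>Gamma_rGamma_bound\<close>.\<close>
  define d where "d = 1 + \<bar>real_of_int m\<bar> + 2 * \<bar>Im a\<bar>"
  define M where "M = 2 * d + 8 * Y + 12"
  show ?thesis
  proof
    show "C * 4 powr (Y + 1) > 0" using C by simp
    show "M > 0" using X unfolding M_def d_def Y_def ring_distribs by linarith
    fix k :: int and \<sigma> :: complex
    assume s: "\<bar>Re \<sigma>\<bar> \<le> X" and kM: "norm (Complex (of_int k) (Im \<sigma>)) \<ge> M"
    define Q where "Q = norm (Complex (of_int k) (Im \<sigma>))"
    define S S' where "S = a + (of_int k + \<sigma>) / 2" and "S' = a' + (- of_int k + \<sigma>) / 2"
    have SS: "S - S' = of_int (k + m)" by (simp add: S_def S'_def a field_simps)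
    have im: "Im S = Im S'" using arg_cong[OF SS, of Im] by simp
    have SR: "Re S - Re S' = of_int (k + m)" using arg_cong[OF SS, of Re] by simp
    have sumS: "S + S' = a + a' + \<sigma>" by (simp add: S_def S'_def field_simps)
    then have Re: "Re (S + S') = Re (a + a') + Re \<sigma>" by simp
    have Yge: "Y \<ge> 0" using X by (simp add: Y_def)
    have Y: "\<bar>Re (S + S')\<bar> \<le> Y" "\<bar>Re (S + S') - 1\<bar> \<le> Y + 1" using s unfolding Re Y_def by linarith+
    have Q: "Q \<ge> M" "Q > 0" using kM \<open>M > 0\<close> unfolding Q_def by linarith+
    have fin: "C * norm (w / 2) powr (Re (S + S') - 1) \<le> C * 4 powr (Y + 1) * Q powr (Re (S + S') - 1)"
      and big: "norm w \<ge> 4 * Y + 6"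
      if w: "w = of_real (1 + \<bar>real_of_int (k + m)\<bar>) + 2 * \<i> * of_real (Im S)" for w
    proof -
      define v where "v = Complex \<bar>real_of_int k\<bar> (Im \<sigma>)"
      have v: "norm v = Q" by (simp add: v_def Q_def cmod_def)
      have "Im S = Im a + Im \<sigma> / 2" by (simp add: S_def)
      then have e: "w - v = Complex (1 + \<bar>real_of_int (k + m)\<bar> - \<bar>real_of_int k\<bar>) (2 * Im a)"
        using w by (simp add: v_def complex_eq_iff)
      have "norm (w - v) \<le> \<bar>1 + \<bar>real_of_int (k + m)\<bar> - \<bar>real_of_int k\<bar>\<bar> + \<bar>2 * Im a\<bar>"
        unfolding e by (rule order_trans[OF cmod_le]) simp
      also have "\<dots> \<le> d" unfolding d_def of_int_add by linarith
      finally have wv: "norm (w - v) \<le> d" .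
      have "\<bar>norm w - Q\<bar> \<le> d" using wv norm_triangle_ineq3[of w v] v by linarith
      then have w2: "norm w \<ge> Q / 2" "norm w \<le> 2 * Q" using Q Yge unfolding M_def abs_le_iff by linarith+
      show "norm w \<ge> 4 * Y + 6" using w2 Q by (auto simp: M_def d_def)
      show "C * norm (w / 2) powr (Re (S + S') - 1) \<le> C * 4 powr (Y + 1) * Q powr (Re (S + S') - 1)"
        using powr_comparable[of Q "norm (w / 2)" "Re (S + S') - 1" "Y + 1"] w2 Q Y C
        by (simp add: norm_divide mult.assoc)
    qed
    have "norm (Gamma_C S S') \<le> C * 4 powr (Y + 1) * Q powr (Re (S + S') - 1)"
    proof (cases "k + m \<ge> 0")
      case True
      have w: "S + 1 - cnj S' = of_real (1 + \<bar>real_of_int (k + m)\<bar>) + 2 * \<i> * of_real (Im S)"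
        using True SR im by (auto simp: complex_eq_iff)
      have "Re S' \<le> Re S" using SR True by (metis diff_ge_0_iff_ge of_int_0_le_iff)
      with C(2)[OF im _ Y(1) big[OF w]] have "S \<notin> \<int>\<^sub>\<le>\<^sub>0"
        "norm (Gamma S * rGamma (1 - S')) \<le> C * norm ((S + 1 - cnj S') / 2) powr (Re (S + S') - 1)" by auto
      then show ?thesis using fin[OF w] by (simp add: Gamma_C_eq)
    next
      case False
      have w: "S' + 1 - cnj S = of_real (1 + \<bar>real_of_int (k + m)\<bar>) + 2 * \<i> * of_real (Im S)"
        using False SR im by (auto simp: complex_eq_iff)
      have "Re S \<le> Re S'" using SR False by (smt (verit) of_int_le_0_iff)
      with C(2)[OF im[symmetric] _ _ big[OF w]] Y(1) have "S' \<notin> \<int>\<^sub>\<le>\<^sub>0"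
        "norm (Gamma S' * rGamma (1 - S)) \<le> C * norm ((S' + 1 - cnj S) / 2) powr (Re (S' + S) - 1)"
        by (auto simp: add.commute)
      then show ?thesis using fin[OF w] Gamma_C_eq'[OF SS] by (simp add: norm_mult norm_power_int add.commute)
    qed
    then show "norm (Gamma_C (a + (of_int k + \<sigma>) / 2) (a' + (- of_int k + \<sigma>) / 2)) \<le>
       C * 4 powr (Y + 1) * norm (Complex (of_int k) (Im \<sigma>)) powr (Re (a + a') + Re \<sigma> - 1)"
      unfolding S_def[symmetric] S'_def[symmetric] Q_def[symmetric] Re .
  qed
qed

section \<open>Mellin-type integrals and Wirtinger derivatives\<close>

text \<open>Holds for every logarithm \<open>l\<close> of the base: another choice changes the
  exponent by 2 pi i times an integer multiple of s - s', itself an integer. With it the rules for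
  powers become rules for exponentials.\<close>

lemma cpow_exp:
  assumes "s - s' \<in> \<int>"
  shows "cpow (exp l) s s' = exp (s * l + s' * cnj l)"
proof -
  obtain n where n: "s - s' = of_int n" using assms Ints_cases by metis
  have nm: "complex_of_real (cmod (exp l)) = exp (of_real (Re l))"
    by (simp add: norm_exp_eq_Re flip: exp_of_real)
  have q: "exp l / of_real (cmod (exp l)) = exp (\<i> * of_real (Im l))"
    unfolding nm by (simp flip: exp_diff) (metis complex_eq add_diff_cancel_left')
  have "exp (\<i> * of_real (Im l)) powr of_int n = exp (of_int n * (\<i> * of_real (Im l)))"
    by (simp add: powr_def flip: exp_power_int)
  moreover have "exp (of_real (Re l)) powr (s + s') = exp ((s + s') * of_real (Re l))"
    by (simp add: powr_def)
  ultimately have "cpow (exp l) s s' = exp (of_int n * (\<i> * of_real (Im l)) + (s + s') * of_real (Re l))"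
    unfolding cpow_def q by (simp only: nm n exp_add)
  also have "of_int n * (\<i> * of_real (Im l)) + (s + s') * of_real (Re l) = s * l + s' * cnj l"
    unfolding n[symmetric] by (subst (3 6) complex_eq) (simp add: algebra_simps)
  finally show ?thesis .
qed

lemma cpow_Ln:
  assumes "s - s' \<in> \<int>" "z \<noteq> 0"
  shows "cpow z s s' = exp (s * Ln z + s' * cnj (Ln z))"
  using cpow_exp[OF assms(1), of "Ln z"] assms(2) by simp

lemma cpow_minus1_left:
  assumes "s - s' \<in> \<int>" "z \<noteq> 0"
  shows "cpow z (s - 1) s' = cpow z s s' / z"
proof -
  have "s - 1 - s' = (s - s') - 1" by simp
  also have "\<dots> \<in> \<int>" using assms(1) by (rule Ints_diff[OF _ Ints_1])
  finally have "s - 1 - s' \<in> \<int>" .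
  then show ?thesis using assms by (simp add: cpow_Ln ring_distribs exp_add exp_diff)
qed

lemma cpow_minus1_right:
  assumes "s - s' \<in> \<int>" "z \<noteq> 0"
  shows "cpow z s (s' - 1) = cpow z s s' / cnj z"
proof -
  have "s - (s' - 1) = (s - s') + 1" by simp
  also have "\<dots> \<in> \<int>" using assms(1) by (rule Ints_add[OF _ Ints_1])
  finally have "s - (s' - 1) \<in> \<int>" .
  moreover have "exp (cnj (Ln z)) = cnj z" using assms by (simp flip: exp_cnj)
  ultimately show ?thesis using assms by (simp add: cpow_Ln ring_distribs exp_add exp_diff)
qed

lemma cpow_inverse:
  assumes "s - s' \<in> \<int>" "z \<noteq> 0"
  shows "cpow (1 / z) s s' = cpow z (- s) (- s')"
proof -
  have "- s - (- s') = - (s - s')" by simp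
  also have "\<dots> \<in> \<int>" using assms(1) by (rule Ints_minus)
  finally have "- s - (- s') \<in> \<int>" .
  moreover have "1 / z = exp (- Ln z)" using assms by (simp add: exp_minus divide_inverse)
  ultimately show ?thesis using assms cpow_exp[of s s' "- Ln z"] by (simp add: cpow_Ln)
qed

lemma norm_cpow:
  assumes "s - s' \<in> \<int>" "z \<noteq> 0"
  shows "norm (cpow z s s') = norm z powr Re (s + s')"
proof -
  obtain n where n: "s - s' = of_int n" using assms Ints_cases by metis
  then have "Im s = Im s'" by (simp add: complex_eq_iff)
  then show ?thesis using assms by (simp add: cpow_Ln powr_def ring_distribs)
qed

lemma has_derivative_cpow:
  assumes "s - s' \<in> \<int>" "z \<noteq> 0"
  shows "((\<lambda>w. cpow w s s') has_derivative
     (\<lambda>h. s * cpow z (s - 1) s' * h + s' * cpow z s (s' - 1) * cnj h)) (at z)"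
proof -
  \<comment> \<open>The logarithm is taken relative to \<open>z\<close>:
    \<open>Ln z + Ln (w / z)\<close> is a logarithm of w that is smooth near \<open>z\<close> even
    if \<open>z\<close> lies on the branch cut.\<close>
  have L: "((\<lambda>w. Ln (w / z)) has_derivative (\<lambda>h. h / z)) (at z)"
  proof -
    have "((\<lambda>w. Ln (w / z)) has_field_derivative 1 / z) (at z)"
      using assms by (auto intro!: derivative_eq_intros)
    moreover have "times (1 / z) = (\<lambda>h. h / z)" by auto
    ultimately show ?thesis by (simp add: has_field_derivative_def)
  qed
  let ?g = "\<lambda>w. exp (s * (Ln z + Ln (w / z)) + s' * cnj (Ln z + Ln (w / z)))"
  have "(?g has_derivative
     (\<lambda>h. ?g z * (s * (h / z) + s' * cnj (h / z)))) (at z)"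
  proof (rule has_derivative_compose[OF _ DERIV_exp[unfolded has_field_derivative_def]])
    show "((\<lambda>w. s * (Ln z + Ln (w / z)) + s' * cnj (Ln z + Ln (w / z))) has_derivative
        (\<lambda>h. s * (h / z) + s' * cnj (h / z))) (at z)"
      by (rule derivative_eq_intros L has_derivative_cnj refl | simp)+
  qed
  moreover have "?g z = cpow z s s'" using assms by (simp add: cpow_Ln)
  ultimately have D: "(?g has_derivative (\<lambda>h. s * cpow z (s - 1) s' * h + s' * cpow z s (s' - 1) * cnj h)) (at z)"
    using assms by (simp add: cpow_minus1_left cpow_minus1_right algebra_simps)
  have eq: "?g w = cpow w s s'" if "w \<noteq> 0" for w
  proof -
    have "exp (Ln z + Ln (w / z)) = w" using that assms by (simp add: exp_add)
    then show ?thesis using cpow_exp[OF assms(1), of "Ln z + Ln (w / z)"] by simp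
  qed
  show ?thesis
    by (rule has_derivative_transform_within_open[OF D, where s = "- {0}"]) (use assms eq in auto)
qed

text \<open>Differentiation under the integral for functions that are only real differentiable;
  \<open>p\<close> and \<open>q\<close> are the two Wirtinger derivatives of the integrand. The
  remainder quotients are dominated by a multiple of \<open>B\<close>, and dominated convergence is
  applied along sequences tending to \<open>z\<close>.\<close>

lemma has_derivative_integral:
  fixes f p q :: "'a \<Rightarrow> complex \<Rightarrow> complex"
  assumes V: "convex V" "open V" "z \<in> V"
    and f: "\<And>z. z \<in> V \<Longrightarrow> integrable M (\<lambda>x. f x z)"
    and p [measurable]: "\<And>z. z \<in> V \<Longrightarrow> (\<lambda>x. p x z) \<in> borel_measurable M"
    and q [measurable]: "\<And>z. z \<in> V \<Longrightarrow> (\<lambda>x. q x z) \<in> borel_measurable M"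
    and der: "\<And>x z. x \<in> space M \<Longrightarrow> z \<in> V \<Longrightarrow>
       (f x has_derivative (\<lambda>h. p x z * h + q x z * cnj h)) (at z)"
    and B: "integrable M B"
    and le: "\<And>x z. x \<in> space M \<Longrightarrow> z \<in> V \<Longrightarrow> norm (p x z) \<le> B x"
      "\<And>x z. x \<in> space M \<Longrightarrow> z \<in> V \<Longrightarrow> norm (q x z) \<le> B x"
  shows "((\<lambda>z. \<integral>x. f x z \<partial>M) has_derivative
     (\<lambda>h. (\<integral>x. p x z \<partial>M) * h + (\<integral>x. q x z \<partial>M) * cnj h)) (at z)"
proof -
  note [measurable] = borel_measurable_integrable[OF f]
  have pi: "integrable M (\<lambda>x. p x z)" and qi: "integrable M (\<lambda>x. q x z)"
    using V by (auto intro!: Bochner_Integration.integrable_bound[OF B] AE_I2 order_trans[OF le(1)] order_trans[OF le(2)])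
  define D where "D = (\<lambda>x h. p x z * h + q x z * cnj h)"
  have nD: "norm (p x w * h + q x w * cnj h) \<le> 2 * B x * norm h" if "x \<in> space M" "w \<in> V" for x w h
  proof -
    have "norm (p x w * h + q x w * cnj h) \<le> norm (p x w) * norm h + norm (q x w) * norm h"
      by (rule norm_triangle_le) (simp add: norm_mult)
    also have "\<dots> \<le> B x * norm h + B x * norm h"
      using le[OF that] by (intro add_mono mult_right_mono) auto
    finally show ?thesis by simp
  qed
  \<comment> \<open>Mean value inequality on the convex set \<open>V\<close>; it bounds the
    difference quotients independently of w.\<close>
  have lip: "norm (f x w - f x z) \<le> 2 * B x * norm (w - z)" if x: "x \<in> space M" and w: "w \<in> V" for x w
  proof (rule differentiable_bound[OF V(1)])
    fix y assume y: "y \<in> V"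
    show "(f x has_derivative (\<lambda>h. p x y * h + q x y * cnj h)) (at y within V)"
      using der[OF x y] by (rule has_derivative_at_withinI)
    show "onorm (\<lambda>h. p x y * h + q x y * cnj h) \<le> 2 * B x"
      by (rule onorm_le) (use nD[OF x y] in auto)
  qed (use w V in auto)
  have "((\<lambda>w. ((\<integral>x. f x w \<partial>M) - (\<integral>x. f x z \<partial>M)
      - ((\<integral>x. p x z \<partial>M) * (w - z) + (\<integral>x. q x z \<partial>M) * cnj (w - z))) /\<^sub>R norm (w - z)) \<longlongrightarrow> 0) (at z within V)"
    unfolding tendsto_at_iff_sequentially comp_def
  proof safe
    fix X assume X: "\<forall>i. X i \<in> V - {z}" "X \<longlonglongrightarrow> z"
    define g where "g = (\<lambda>n x. (f x (X n) - f x z - D x (X n - z)) /\<^sub>R norm (X n - z))"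
    have XV: "X n \<in> V" "X n \<noteq> z" for n using X by auto
    have "(\<lambda>n. \<integral>x. g n x \<partial>M) \<longlonglongrightarrow> (\<integral>x. 0 \<partial>M)"
    proof (rule integral_dominated_convergence)
      show "integrable M (\<lambda>x. 4 * B x)" using B by simp
      show "AE x in M. (\<lambda>n. g n x) \<longlonglongrightarrow> 0"
      proof (rule AE_I2)
        fix x assume x: "x \<in> space M"
        have "((\<lambda>w. (f x w - f x z - D x (w - z)) /\<^sub>R norm (w - z)) \<longlongrightarrow> 0) (at z)"
          using der[OF x V(3)] unfolding has_derivative_at_within D_def by blast
        moreover have "filterlim X (at z) sequentially"
          using X unfolding filterlim_at by auto
        ultimately show "(\<lambda>n. g n x) \<longlonglongrightarrow> 0"
          unfolding g_def by (rule filterlim_compose)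
      qed
      show "AE x in M. norm (g n x) \<le> 4 * B x" for n
      proof (rule AE_I2)
        fix x assume x: "x \<in> space M"
        have "norm (f x (X n) - f x z - D x (X n - z)) \<le> 2 * B x * norm (X n - z) + 2 * B x * norm (X n - z)"
          using lip[OF x XV(1)[of n]] nD[OF x V(3), of "X n - z"] unfolding D_def
          by (rule order_trans[OF norm_triangle_ineq4 add_mono])
        then show "norm (g n x) \<le> 4 * B x" using XV(2)[of n]
          unfolding g_def norm_scaleR by (simp add: divide_simps)
      qed
      show "g n \<in> borel_measurable M" for n
        unfolding g_def D_def using XV(1)[of n] V(3) by measurable
    qed simp
    moreover have "(\<integral>x. g n x \<partial>M) = ((\<integral>x. f x (X n) \<partial>M) - (\<integral>x. f x z \<partial>M)
      - ((\<integral>x. p x z \<partial>M) * (X n - z) + (\<integral>x. q x z \<partial>M) * cnj (X n - z))) /\<^sub>R norm (X n - z)" for n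
      unfolding g_def D_def using pi qi f[OF XV(1)[of n]] f[OF V(3)] by simp
    ultimately show "(\<lambda>n. ((\<integral>x. f x (X n) \<partial>M) - (\<integral>x. f x z \<partial>M)
      - ((\<integral>x. p x z \<partial>M) * (X n - z) + (\<integral>x. q x z \<partial>M) * cnj (X n - z))) /\<^sub>R norm (X n - z)) \<longlonglongrightarrow> 0" by simp
  qed
  moreover have "bounded_linear (\<lambda>h. (\<integral>x. p x z \<partial>M) * h + (\<integral>x. q x z \<partial>M) * cnj h)"
    by (rule bounded_linear_add[OF bounded_linear_mult_right
        bounded_linear_compose[OF bounded_linear_mult_right bounded_linear_cnj]])
  ultimately have "((\<lambda>z. \<integral>x. f x z \<partial>M) has_derivative
     (\<lambda>h. (\<integral>x. p x z \<partial>M) * h + (\<integral>x. q x z \<partial>M) * cnj h)) (at z within V)"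
    unfolding has_derivative_at_within by (intro conjI)
  then show ?thesis unfolding at_within_open[OF V(3,2)] .
qed

section \<open>Wirtinger derivatives and differentiability classes on open sets\<close>

lemma has_derivative_imp_wirtinger:
  assumes "(f has_derivative (\<lambda>h. P * h + Q * cnj h)) (at z)"
  shows "d_x f z = P + Q" "d_y f z = \<i> * P - \<i> * Q" "d_z f z = P" "d_zbar f z = Q"
proof -
  have "frechet_derivative f (at z) = (\<lambda>h. P * h + Q * cnj h)"
    using frechet_derivative_at[OF assms] by simp
  then show *: "d_x f z = P + Q" "d_y f z = \<i> * P - \<i> * Q" by (simp_all add: d_x_def d_y_def)
  show "d_z f z = P" "d_zbar f z = Q" unfolding d_z_def d_zbar_def *
    by (simp_all add: algebra_simps)
qed

lemma d_cong_open:
  assumes "open V" "z \<in> V" "\<And>w. w \<in> V \<Longrightarrow> f w = g w"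
  shows "d_x f z = d_x g z" "d_y f z = d_y g z" "d_z f z = d_z g z" "d_zbar f z = d_zbar g z"
proof -
  have "frechet_derivative f (at z) = frechet_derivative g (at z)"
  proof -
    have "(f has_derivative D) (at z) \<longleftrightarrow> (g has_derivative D) (at z)" for D
      using has_derivative_transform_within_open[OF _ assms(1,2)] assms(3) by (metis (no_types))
    then show ?thesis by (simp add: frechet_derivative_def)
  qed
  then show "d_x f z = d_x g z" "d_y f z = d_y g z" "d_z f z = d_z g z" "d_zbar f z = d_zbar g z"
    by (simp_all add: d_x_def d_y_def d_z_def d_zbar_def)
qed

lemma real_C_diff_on_cong:
  assumes "open V" "\<And>w. w \<in> V \<Longrightarrow> f w = g w" "real_C_diff_on n g V"
  shows "real_C_diff_on n f V"
  using assms(2,3)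
proof (induction n arbitrary: f g)
  case 0
  then show ?case using continuous_on_cong[of V V f g] by simp
next
  case (Suc n)
  have "f differentiable (at z)" if "z \<in> V" for z
  proof -
    have "g differentiable (at z)" using Suc.prems that by simp
    then show ?thesis unfolding differentiable_def
      using has_derivative_transform_within_open[OF _ assms(1) that] Suc.prems(1) by (metis (no_types))
  qed
  then show ?case
    using Suc.IH[of "d_x f" "d_x g"] Suc.IH[of "d_y f" "d_y g"] Suc.prems
      d_cong_open[OF assms(1), of _ f g] by simp
qed

lemma real_C_diff_on_Union:
  assumes "\<And>V. V \<in> \<V> \<Longrightarrow> open V" "\<And>V. V \<in> \<V> \<Longrightarrow> real_C_diff_on n f V"
  shows "real_C_diff_on n f (\<Union>\<V>)"
  using assms(2)
proof (induction n arbitrary: f)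
  case 0
  then show ?case using assms(1) by (auto simp: continuous_on_open_Union)
next
  case (Suc n)
  then show ?case by auto
qed

lemma real_C_diff_on_add:
  assumes "open V" "real_C_diff_on n f V" "real_C_diff_on n g V"
  shows "real_C_diff_on n (\<lambda>z. f z + g z) V"
  using assms(2,3)
proof (induction n arbitrary: f g)
  case 0
  then show ?case by (auto intro: continuous_intros)
next
  case (Suc n)
  have "d_x (\<lambda>z. f z + g z) z = d_x f z + d_x g z" "d_y (\<lambda>z. f z + g z) z = d_y f z + d_y g z" if "z \<in> V" for z
  proof -
    have "frechet_derivative (\<lambda>z. f z + g z) (at z) = (\<lambda>h. frechet_derivative f (at z) h + frechet_derivative g (at z) h)"
      using Suc.prems that
      by (intro frechet_derivative_at[symmetric] derivative_intros) (auto simp: frechet_derivative_works)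
    then show "d_x (\<lambda>z. f z + g z) z = d_x f z + d_x g z" "d_y (\<lambda>z. f z + g z) z = d_y f z + d_y g z"
      by (simp_all add: d_x_def d_y_def)
  qed note eq = this
  have "real_C_diff_on n (d_x (\<lambda>z. f z + g z)) V"
    by (rule real_C_diff_on_cong[OF assms(1) eq(1) Suc.IH]) (use Suc.prems in simp_all)
  moreover have "real_C_diff_on n (d_y (\<lambda>z. f z + g z)) V"
    by (rule real_C_diff_on_cong[OF assms(1) eq(2) Suc.IH]) (use Suc.prems in simp_all)
  ultimately show ?case using Suc.prems by (simp add: differentiable_add)
qed

text \<open>A superposition of power functions over an arbitrary measure space, so that the sum over
  k and the integral along the contours can be treated as a single integral.\<close>

definition mellin :: "'a measure \<Rightarrow> ('a \<Rightarrow> complex) \<Rightarrow> ('a \<Rightarrow> complex) \<Rightarrow> ('a \<Rightarrow> complex) \<Rightarrow> complex \<Rightarrow> complex" where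
  "mellin M c s s' z = (\<integral>x. c x * cpow z (s x) (s' x) \<partial>M)"

text \<open>The weight of degree \<open>N\<close> pays for N derivatives, each of which brings down
  one exponent. \<open>V\<close> stays away from 0 because a derivative also divides by z or its
  conjugate, and the majorant is uniform in \<open>V\<close>, as needed for differentiation under
  the integral.\<close>

definition mellin_dom ::
  "nat \<Rightarrow> 'a measure \<Rightarrow> ('a \<Rightarrow> complex) \<Rightarrow> ('a \<Rightarrow> complex) \<Rightarrow> ('a \<Rightarrow> complex) \<Rightarrow> complex set \<Rightarrow> bool" where
  "mellin_dom N M c s s' V \<longleftrightarrow>
     c \<in> borel_measurable M \<and> s \<in> borel_measurable M \<and> s' \<in> borel_measurable M \<and>
     (\<forall>x\<in>space M. s x - s' x \<in> \<int>) \<and> open V \<and> (\<exists>r>0. \<forall>z\<in>V. r \<le> norm z) \<and>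
     (\<exists>B. integrable M B \<and> (\<forall>x\<in>space M. \<forall>z\<in>V.
        norm (c x) * (1 + norm (s x) + norm (s' x)) ^ N * norm (cpow z (s x) (s' x)) \<le> B x))"

lemma mellin_dom_transfer:
  assumes dom: "mellin_dom N M c s s' V"
    and m: "d \<in> borel_measurable M" "t \<in> borel_measurable M" "t' \<in> borel_measurable M"
    and i: "\<And>x. x \<in> space M \<Longrightarrow> t x - t' x \<in> \<int>"
    and le: "\<And>x z. x \<in> space M \<Longrightarrow> z \<in> V \<Longrightarrow>
       norm (d x) * (1 + norm (t x) + norm (t' x)) ^ K * norm (cpow z (t x) (t' x)) \<le>
       C * (norm (c x) * (1 + norm (s x) + norm (s' x)) ^ N * norm (cpow z (s x) (s' x)))"
    and C: "C \<ge> 0"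
  shows "mellin_dom K M d t t' V"
proof -
  obtain B where B: "integrable M B" "\<And>x z. x \<in> space M \<Longrightarrow> z \<in> V \<Longrightarrow>
        norm (c x) * (1 + norm (s x) + norm (s' x)) ^ N * norm (cpow z (s x) (s' x)) \<le> B x"
    using dom by (auto simp: mellin_dom_def)
  have "\<forall>x\<in>space M. \<forall>z\<in>V. norm (d x) * (1 + norm (t x) + norm (t' x)) ^ K * norm (cpow z (t x) (t' x)) \<le> C * B x"
    using order_trans[OF le mult_left_mono[OF B(2) C]] by blast
  moreover have "integrable M (\<lambda>x. C * B x)" using B by simp
  ultimately show ?thesis using dom m i unfolding mellin_dom_def by blast
qed

text \<open>Each operation consumes one factor of the weight. The last two clauses are the effect of
  the Wirtinger derivatives: lowering an exponent by 1 at most doubles the weight and divides the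
  power by |z| >= r, hence the constant \<open>2 ^ N / r\<close> there.\<close>

lemma mellin_dom_SucD:
  assumes "mellin_dom (Suc N) M c s s' V"
  shows "mellin_dom N M c s s' V"
    "mellin_dom N M (\<lambda>x. c x * (s x + a)) s s' V"
    "mellin_dom N M (\<lambda>x. c x * (s' x + a)) s s' V"
    "mellin_dom N M (\<lambda>x. c x * s x) (\<lambda>x. s x - 1) s' V"
    "mellin_dom N M (\<lambda>x. c x * s' x) s (\<lambda>x. s' x - 1) V"
proof -
  have [measurable]: "c \<in> borel_measurable M" "s \<in> borel_measurable M" "s' \<in> borel_measurable M"
    and I: "\<And>x. x \<in> space M \<Longrightarrow> s x - s' x \<in> \<int>"
    using assms by (auto simp: mellin_dom_def)
  obtain r where r: "r > 0" "\<And>z. z \<in> V \<Longrightarrow> r \<le> norm z" using assms by (auto simp: mellin_dom_def)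
  have I1: "s x - 1 - s' x \<in> \<int>" "s x - (s' x - 1) \<in> \<int>" if "x \<in> space M" for x
  proof -
    have "s x - 1 - s' x = (s x - s' x) - 1" "s x - (s' x - 1) = (s x - s' x) + 1" by simp_all
    then show "s x - 1 - s' x \<in> \<int>" "s x - (s' x - 1) \<in> \<int>" using I[OF that] by (metis Ints_1 Ints_diff, metis Ints_1 Ints_add)
  qed
  define w where "w = (\<lambda>x. 1 + norm (s x) + norm (s' x))"
  have w: "w x \<ge> 1" "norm (s x) \<le> w x" "norm (s' x) \<le> w x" for x by (auto simp: w_def)
  have mono: "A * w x ^ N * E \<le> K * (norm (c x) * w x ^ Suc N * E)"
    if "A \<le> K * norm (c x) * w x" "E \<ge> 0" for A K E x
  proof -
    have "A * (w x ^ N * E) \<le> (K * norm (c x) * w x) * (w x ^ N * E)"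
      using that w(1)[of x] by (intro mult_right_mono) auto
    then show ?thesis by (simp add: mult_ac)
  qed
  show "mellin_dom N M c s s' V"
  proof (rule mellin_dom_transfer[OF assms, where C = 1])
    fix x z assume "x \<in> space M" "z \<in> V"
    have "norm (c x) \<le> 1 * norm (c x) * w x" using w(1)[of x] by (simp add: mult_le_cancel_left1)
    from mono[OF this] show "norm (c x) * (1 + norm (s x) + norm (s' x)) ^ N * norm (cpow z (s x) (s' x)) \<le>
       1 * (norm (c x) * (1 + norm (s x) + norm (s' x)) ^ Suc N * norm (cpow z (s x) (s' x)))"
      by (simp add: w_def)
  qed (use I in auto)
  show "mellin_dom N M (\<lambda>x. c x * (s x + a)) s s' V"
  proof (rule mellin_dom_transfer[OF assms, where C = "1 + norm a"])
    fix x z assume "x \<in> space M" "z \<in> V"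
    have "norm (s x + a) \<le> norm (s x) + norm a" by (rule norm_triangle_ineq)
    also have "\<dots> \<le> w x + norm a * w x" using w[of x] by (intro add_mono) (auto simp: mult_le_cancel_left1)
    finally have "norm (c x) * norm (s x + a) \<le> norm (c x) * (w x + norm a * w x)"
      by (rule mult_left_mono) simp
    then have "norm (c x * (s x + a)) \<le> (1 + norm a) * norm (c x) * w x"
      unfolding norm_mult by (simp add: algebra_simps)
    from mono[OF this] show "norm (c x * (s x + a)) * (1 + norm (s x) + norm (s' x)) ^ N * norm (cpow z (s x) (s' x)) \<le>
       (1 + norm a) * (norm (c x) * (1 + norm (s x) + norm (s' x)) ^ Suc N * norm (cpow z (s x) (s' x)))"
      by (simp add: w_def)
  qed (use I in auto)
  show "mellin_dom N M (\<lambda>x. c x * (s' x + a)) s s' V"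
  proof (rule mellin_dom_transfer[OF assms, where C = "1 + norm a"])
    fix x z assume "x \<in> space M" "z \<in> V"
    have "norm (s' x + a) \<le> norm (s' x) + norm a" by (rule norm_triangle_ineq)
    also have "\<dots> \<le> w x + norm a * w x" using w[of x] by (intro add_mono) (auto simp: mult_le_cancel_left1)
    finally have "norm (c x) * norm (s' x + a) \<le> norm (c x) * (w x + norm a * w x)"
      by (rule mult_left_mono) simp
    then have "norm (c x * (s' x + a)) \<le> (1 + norm a) * norm (c x) * w x"
      unfolding norm_mult by (simp add: algebra_simps)
    from mono[OF this] show "norm (c x * (s' x + a)) * (1 + norm (s x) + norm (s' x)) ^ N * norm (cpow z (s x) (s' x)) \<le>
       (1 + norm a) * (norm (c x) * (1 + norm (s x) + norm (s' x)) ^ Suc N * norm (cpow z (s x) (s' x)))"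
      by (simp add: w_def)
  qed (use I in auto)
  have shift: "norm (c x * y) * u ^ N * (norm (cpow z (s x) (s' x)) / norm z) \<le>
       (2 ^ N / r) * (norm (c x) * w x ^ Suc N * norm (cpow z (s x) (s' x)))"
    if "norm y \<le> w x" "0 \<le> u" "u \<le> 2 * w x" "z \<in> V" for x y u z
  proof -
    have "norm (cpow z (s x) (s' x)) / norm z \<le> norm (cpow z (s x) (s' x)) / r"
      using r(1) r(2)[OF that(4)] by (intro divide_left_mono mult_pos_pos) auto
    moreover have "norm (c x * y) \<le> norm (c x) * w x" using that by (auto simp: norm_mult mult_left_mono)
    moreover have "u ^ N \<le> (2 * w x) ^ N" using that by (intro power_mono) auto
    ultimately have "norm (c x * y) * u ^ N * (norm (cpow z (s x) (s' x)) / norm z) \<le>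
        (norm (c x) * w x) * (2 * w x) ^ N * (norm (cpow z (s x) (s' x)) / r)"
      using that r w(1)[of x] by (intro mult_mono) (auto intro!: mult_nonneg_nonneg)
    also have "\<dots> = (2 ^ N / r) * (norm (c x) * w x ^ Suc N * norm (cpow z (s x) (s' x)))"
      by (simp add: power_mult_distrib mult_ac)
    finally show ?thesis .
  qed
  show "mellin_dom N M (\<lambda>x. c x * s x) (\<lambda>x. s x - 1) s' V"
  proof (rule mellin_dom_transfer[OF assms, where C = "2 ^ N / r"])
    fix x z assume x: "x \<in> space M" and z: "z \<in> V"
    have "norm (cpow z (s x - 1) (s' x)) = norm (cpow z (s x) (s' x)) / norm z"
      using r(1) r(2)[OF z] by (subst cpow_minus1_left[OF I[OF x]]) (auto simp: norm_divide)
    moreover have "1 + norm (s x - 1) + norm (s' x) \<le> 2 * w x"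
      using norm_triangle_ineq4[of "s x" 1] norm_ge_zero[of "s x"] norm_ge_zero[of "s' x"]
      unfolding w_def ring_distribs norm_one by linarith
    ultimately show "norm (c x * s x) * (1 + norm (s x - 1) + norm (s' x)) ^ N * norm (cpow z (s x - 1) (s' x)) \<le>
       (2 ^ N / r) * (norm (c x) * (1 + norm (s x) + norm (s' x)) ^ Suc N * norm (cpow z (s x) (s' x)))"
      using shift[OF w(2) _ _ z, of "1 + norm (s x - 1) + norm (s' x)" x] unfolding w_def by simp
  qed (use I1 r in auto)
  show "mellin_dom N M (\<lambda>x. c x * s' x) s (\<lambda>x. s' x - 1) V"
  proof (rule mellin_dom_transfer[OF assms, where C = "2 ^ N / r"])
    fix x z assume x: "x \<in> space M" and z: "z \<in> V"
    have "norm (cpow z (s x) (s' x - 1)) = norm (cpow z (s x) (s' x)) / norm z"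
      using r(1) r(2)[OF z] by (subst cpow_minus1_right[OF I[OF x]]) (auto simp: norm_divide)
    moreover have "1 + norm (s x) + norm (s' x - 1) \<le> 2 * w x"
      using norm_triangle_ineq4[of "s' x" 1] norm_ge_zero[of "s x"] norm_ge_zero[of "s' x"]
      unfolding w_def ring_distribs norm_one by linarith
    ultimately show "norm (c x * s' x) * (1 + norm (s x) + norm (s' x - 1)) ^ N * norm (cpow z (s x) (s' x - 1)) \<le>
       (2 ^ N / r) * (norm (c x) * (1 + norm (s x) + norm (s' x)) ^ Suc N * norm (cpow z (s x) (s' x)))"
      using shift[OF w(3) _ _ z, of "1 + norm (s x) + norm (s' x - 1)" x] unfolding w_def by simp
  qed (use I1 r in auto)
qed

lemma mellin_dom_le: "mellin_dom N M c s s' V \<Longrightarrow> n \<le> N \<Longrightarrow> mellin_dom n M c s s' V"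
  by (induction N) (auto simp: le_Suc_eq mellin_dom_SucD(1))

lemma mellin_dom_integrable:
  assumes "mellin_dom 0 M c s s' V" "z \<in> V"
  shows "integrable M (\<lambda>x. c x * cpow z (s x) (s' x))"
proof -
  have [measurable]: "c \<in> borel_measurable M" "s \<in> borel_measurable M" "s' \<in> borel_measurable M"
    and I: "\<And>x. x \<in> space M \<Longrightarrow> s x - s' x \<in> \<int>" and "z \<noteq> 0"
    using assms by (auto simp: mellin_dom_def)
  have "(\<lambda>x. c x * exp (s x * Ln z + s' x * cnj (Ln z))) \<in> borel_measurable M" by measurable
  then have m: "(\<lambda>x. c x * cpow z (s x) (s' x)) \<in> borel_measurable M"
    using I \<open>z \<noteq> 0\<close> by (subst measurable_cong) (auto simp: cpow_Ln)
  obtain B where B: "integrable M B" "\<And>x z. x \<in> space M \<Longrightarrow> z \<in> V \<Longrightarrow> norm (c x) * norm (cpow z (s x) (s' x)) \<le> B x"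
    using assms by (auto simp: mellin_dom_def)
  show ?thesis
    by (rule Bochner_Integration.integrable_bound[OF B(1) m])
      (use B(2) assms in \<open>auto simp: norm_mult intro!: AE_I2 order_trans[OF B(2)]\<close>)
qed

lemma has_derivative_mellin:
  assumes dom: "mellin_dom 1 M c s s' V" and z: "z \<in> V"
  shows "(mellin M c s s' has_derivative
     (\<lambda>h. mellin M (\<lambda>x. c x * s x) (\<lambda>x. s x - 1) s' z * h +
          mellin M (\<lambda>x. c x * s' x) s (\<lambda>x. s' x - 1) z * cnj h)) (at z)"
proof -
  have "open V" using dom by (simp add: mellin_dom_def)
  \<comment> \<open>\<open>has_derivative_integral\<close> asks for a convex set, which the annuli
    used later are not.\<close>
  then obtain e where e: "e > 0" "ball z e \<subseteq> V" using z openE by blast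
  note dom0 = mellin_dom_SucD[of 0, unfolded One_nat_def[symmetric], OF dom]
  have I: "\<And>x. x \<in> space M \<Longrightarrow> s x - s' x \<in> \<int>" and nz: "\<And>z. z \<in> V \<Longrightarrow> z \<noteq> 0"
    using dom by (auto simp: mellin_dom_def)
  obtain B1 where B1: "integrable M B1" "\<And>x z. x \<in> space M \<Longrightarrow> z \<in> V \<Longrightarrow> norm (c x * s x) * norm (cpow z (s x - 1) (s' x)) \<le> B1 x"
    using dom0(4) by (auto simp: mellin_dom_def)
  obtain B2 where B2: "integrable M B2" "\<And>x z. x \<in> space M \<Longrightarrow> z \<in> V \<Longrightarrow> norm (c x * s' x) * norm (cpow z (s x) (s' x - 1)) \<le> B2 x"
    using dom0(5) by (auto simp: mellin_dom_def)
  show ?thesis unfolding mellin_def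
  proof (rule has_derivative_integral[where V = "ball z e" and B = "\<lambda>x. max (B1 x) (B2 x)"])
    show "integrable M (\<lambda>x. c x * cpow w (s x) (s' x))" if "w \<in> ball z e" for w
      using mellin_dom_integrable[OF dom0(1)] that e by auto
    show "(\<lambda>x. c x * s x * cpow w (s x - 1) (s' x)) \<in> borel_measurable M" if "w \<in> ball z e" for w
      using mellin_dom_integrable[OF dom0(4)] that e by auto
    show "(\<lambda>x. c x * s' x * cpow w (s x) (s' x - 1)) \<in> borel_measurable M" if "w \<in> ball z e" for w
      using mellin_dom_integrable[OF dom0(5)] that e by auto
    show "((\<lambda>z. c x * cpow z (s x) (s' x)) has_derivative
       (\<lambda>h. c x * s x * cpow w (s x - 1) (s' x) * h + c x * s' x * cpow w (s x) (s' x - 1) * cnj h)) (at w)"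
      if "x \<in> space M" "w \<in> ball z e" for x w
      using has_derivative_mult_right[OF has_derivative_cpow[OF I[OF that(1)]], of w "c x"] nz e that
      by (auto simp: algebra_simps)
    show "integrable M (\<lambda>x. max (B1 x) (B2 x))" using B1 B2 by auto
    show "norm (c x * s x * cpow w (s x - 1) (s' x)) \<le> max (B1 x) (B2 x)"
      "norm (c x * s' x * cpow w (s x) (s' x - 1)) \<le> max (B1 x) (B2 x)"
      if "x \<in> space M" "w \<in> ball z e" for x w
      using B1(2)[of x w] B2(2)[of x w] that e by (auto simp: norm_mult le_max_iff_disj)
  qed (use e in auto)
qed

lemma continuous_on_mellin:
  assumes dom: "mellin_dom 0 M c s s' V"
  shows "continuous_on V (mellin M c s s')"
proof -
  have "open V" using dom by (simp add: mellin_dom_def)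
  have I: "\<And>x. x \<in> space M \<Longrightarrow> s x - s' x \<in> \<int>" and nz: "\<And>z. z \<in> V \<Longrightarrow> z \<noteq> 0"
    using dom by (auto simp: mellin_dom_def)
  obtain B where B: "integrable M B" "\<And>x z. x \<in> space M \<Longrightarrow> z \<in> V \<Longrightarrow> norm (c x) * norm (cpow z (s x) (s' x)) \<le> B x"
    using dom by (auto simp: mellin_dom_def)
  show ?thesis unfolding continuous_on_sequentially comp_def mellin_def
  proof safe
    fix X z assume X: "\<forall>n. X n \<in> V" "X \<longlonglongrightarrow> z" and z: "z \<in> V"
    show "(\<lambda>n. \<integral>x. c x * cpow (X n) (s x) (s' x) \<partial>M) \<longlonglongrightarrow> (\<integral>x. c x * cpow z (s x) (s' x) \<partial>M)"
    proof (rule integral_dominated_convergence[OF _ _ B(1)])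
      show "(\<lambda>x. c x * cpow z (s x) (s' x)) \<in> borel_measurable M"
        using mellin_dom_integrable[OF dom z] by auto
      show "(\<lambda>x. c x * cpow (X n) (s x) (s' x)) \<in> borel_measurable M" for n
        using mellin_dom_integrable[OF dom, of "X n"] X by auto
      show "AE x in M. (\<lambda>n. c x * cpow (X n) (s x) (s' x)) \<longlonglongrightarrow> c x * cpow z (s x) (s' x)"
      proof (rule AE_I2)
        fix x assume x: "x \<in> space M"
        have "isCont (\<lambda>w. cpow w (s x) (s' x)) z"
          using has_derivative_cpow[OF I[OF x] nz[OF z]] has_derivative_continuous by blast
        then have "(\<lambda>n. cpow (X n) (s x) (s' x)) \<longlonglongrightarrow> cpow z (s x) (s' x)"
          using X(2) by (rule isCont_tendsto_compose)
        then show "(\<lambda>n. c x * cpow (X n) (s x) (s' x)) \<longlonglongrightarrow> c x * cpow z (s x) (s' x)"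
          by (intro tendsto_intros)
      qed
      show "AE x in M. norm (c x * cpow (X n) (s x) (s' x)) \<le> B x" for n
        using B(2) X by (auto simp: norm_mult intro!: AE_I2)
    qed
  qed
qed

text \<open>\<open>d_x\<close> is the sum of the Wirtinger derivatives and \<open>d_y\<close> is
  \<i> times their difference. Both are again sums of two \<open>mellin\<close> integrals whose
  weight has one degree less, so induction on \<open>N\<close> applies.\<close>

lemma real_C_diff_on_mellin:
  "mellin_dom N M c s s' V \<Longrightarrow> real_C_diff_on N (mellin M c s s') V"
proof (induction N arbitrary: c s s')
  case 0
  then show ?case by (simp add: continuous_on_mellin)
next
  case (Suc N)
  have V: "open V" using Suc.prems by (simp add: mellin_dom_def)
  have dom1: "mellin_dom 1 M c s s' V" using mellin_dom_le[OF Suc.prems] by simp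
  note D = has_derivative_mellin[OF dom1]
  note cases = mellin_dom_SucD[OF Suc.prems]
  have i: "mellin_dom N M (\<lambda>x. \<i> * c x) s s' V" "mellin_dom N M (\<lambda>x. - \<i> * c x) s s' V"
    if "mellin_dom N M c s s' V" for c s s'
    using that by (auto simp: mellin_dom_def norm_mult)
  have ieq: "mellin M (\<lambda>x. k * c x) s s' z = k * mellin M c s s' z" for k c s s' z
    by (simp add: mellin_def mult.assoc)
  have "real_C_diff_on N (d_x (mellin M c s s')) V"
    by (rule real_C_diff_on_cong[OF V _ real_C_diff_on_add[OF V Suc.IH[OF cases(4)] Suc.IH[OF cases(5)]]])
      (use has_derivative_imp_wirtinger[OF D] in auto)
  moreover have "real_C_diff_on N (d_y (mellin M c s s')) V"
    by (rule real_C_diff_on_cong[OF V _ real_C_diff_on_add[OF V Suc.IH[OF i(1)[OF cases(4)]] Suc.IH[OF i(2)[OF cases(5)]]]])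
      (simp only: ieq has_derivative_imp_wirtinger(2)[OF D], simp)
  moreover have "mellin M c s s' differentiable (at z)" if "z \<in> V" for z
    using D[OF that] by (auto simp: differentiable_def)
  ultimately show ?case by simp
qed

text \<open>Euler operators are diagonal on power functions: the factor z, or its conjugate, undoes
  the lowering of the exponent, and a factor \<open>s x + e\<close>, or \<open>s' x + e\<close>, in
  the coefficient is all that remains.\<close>

lemma mellin_z_d_z:
  assumes dom: "mellin_dom 1 M c s s' V" and z: "z \<in> V"
  shows "z * d_z (mellin M c s s') z + e * mellin M c s s' z = mellin M (\<lambda>x. c x * (s x + e)) s s' z"
    "cnj z * d_zbar (mellin M c s s') z + e * mellin M c s s' z = mellin M (\<lambda>x. c x * (s' x + e)) s s' z"
proof -
  note dom0 = mellin_dom_SucD[of 0, unfolded One_nat_def[symmetric], OF dom]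
  have I: "\<And>x. x \<in> space M \<Longrightarrow> s x - s' x \<in> \<int>" and nz: "z \<noteq> 0"
    using dom z by (auto simp: mellin_dom_def)
  note int = mellin_dom_integrable[OF dom0(1) z] mellin_dom_integrable[OF dom0(4) z] mellin_dom_integrable[OF dom0(5) z]
  have "z * d_z (mellin M c s s') z + e * mellin M c s s' z
     = (\<integral>x. z * (c x * s x * cpow z (s x - 1) (s' x)) + e * (c x * cpow z (s x) (s' x)) \<partial>M)"
    unfolding has_derivative_imp_wirtinger(3)[OF has_derivative_mellin[OF dom z]] unfolding mellin_def
    using int by simp
  also have "\<dots> = mellin M (\<lambda>x. c x * (s x + e)) s s' z"
    unfolding mellin_def using I nz
    by (intro Bochner_Integration.integral_cong) (auto simp: cpow_minus1_left algebra_simps)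
  finally show "z * d_z (mellin M c s s') z + e * mellin M c s s' z = mellin M (\<lambda>x. c x * (s x + e)) s s' z" .
  have "cnj z * d_zbar (mellin M c s s') z + e * mellin M c s s' z
     = (\<integral>x. cnj z * (c x * s' x * cpow z (s x) (s' x - 1)) + e * (c x * cpow z (s x) (s' x)) \<partial>M)"
    unfolding has_derivative_imp_wirtinger(4)[OF has_derivative_mellin[OF dom z]] unfolding mellin_def
    using int by simp
  also have "\<dots> = mellin M (\<lambda>x. c x * (s' x + e)) s s' z"
    unfolding mellin_def using I nz
    by (intro Bochner_Integration.integral_cong) (auto simp: cpow_minus1_right algebra_simps)
  finally show "cnj z * d_zbar (mellin M c s s') z + e * mellin M c s s' z = mellin M (\<lambda>x. c x * (s' x + e)) s s' z" .
qed

text \<open>Peels off the innermost operator, the one acting first. Inductions over \<open>n\<close>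
  therefore have to generalise the function and its coefficient.\<close>

lemma op_prod_Suc: "op_prod (Suc n) T F = op_prod n T (T (Suc n) F)"
proof -
  have "foldr (\<lambda>j S. T j \<circ> S) xs (g :: 'f \<Rightarrow> 'f) = foldr (\<lambda>j S. T j \<circ> S) xs id \<circ> g" for xs and T :: "nat \<Rightarrow> 'f \<Rightarrow> 'f" and g
    by (induction xs) (auto simp: o_assoc)
  from this[of _ _ "T (Suc n)"] show ?thesis by (simp add: op_prod_def)
qed

lemma op_prod_d_z_mellin:
  assumes "mellin_dom n M c s s' V" "\<And>z. z \<in> V \<Longrightarrow> F z = mellin M c s s' z" "z \<in> V"
  shows "op_prod n (\<lambda>j f w. w * d_z f w + e j * f w) F z = mellin M (\<lambda>x. c x * (\<Prod>j=1..n. s x + e j)) s s' z"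
  using assms(1,2)
proof (induction n arbitrary: c F)
  case 0
  then show ?case using assms(3) by (simp add: op_prod_def)
next
  case (Suc n)
  have V: "open V" using Suc.prems by (simp add: mellin_dom_def)
  have dom1: "mellin_dom 1 M c s s' V" using mellin_dom_le[OF Suc.prems(1)] by simp
  have "op_prod n (\<lambda>j f w. w * d_z f w + e j * f w) (\<lambda>w. w * d_z F w + e (Suc n) * F w) z
      = mellin M (\<lambda>x. c x * (s x + e (Suc n)) * (\<Prod>j=1..n. s x + e j)) s s' z"
    by (rule Suc.IH[OF mellin_dom_SucD(2)[OF Suc.prems(1)]])
      (use mellin_z_d_z(1)[OF dom1] Suc.prems(2) d_cong_open(3)[OF V, of _ F] in simp)
  then show ?case by (simp add: op_prod_Suc mult_ac)
qed

lemma op_prod_d_zbar_mellin: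
  assumes "mellin_dom n M c s s' V" "\<And>z. z \<in> V \<Longrightarrow> F z = mellin M c s s' z" "z \<in> V"
  shows "op_prod n (\<lambda>j f w. cnj w * d_zbar f w + e j * f w) F z = mellin M (\<lambda>x. c x * (\<Prod>j=1..n. s' x + e j)) s s' z"
  using assms(1,2)
proof (induction n arbitrary: c F)
  case 0
  then show ?case using assms(3) by (simp add: op_prod_def)
next
  case (Suc n)
  have V: "open V" using Suc.prems by (simp add: mellin_dom_def)
  have dom1: "mellin_dom 1 M c s s' V" using mellin_dom_le[OF Suc.prems(1)] by simp
  have "op_prod n (\<lambda>j f w. cnj w * d_zbar f w + e j * f w) (\<lambda>w. cnj w * d_zbar F w + e (Suc n) * F w) z
      = mellin M (\<lambda>x. c x * (s' x + e (Suc n)) * (\<Prod>j=1..n. s' x + e j)) s s' z"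
    by (rule Suc.IH[OF mellin_dom_SucD(3)[OF Suc.prems(1)]])
      (use mellin_z_d_z(2)[OF dom1] Suc.prems(2) d_cong_open(4)[OF V, of _ F] in simp)
  then show ?case by (simp add: op_prod_Suc mult_ac)
qed

section \<open>Bounds for the kernel\<close>

definition K_pole_free :: "nat \<Rightarrow> nat \<Rightarrow> (nat \<Rightarrow> complex) \<Rightarrow> (nat \<Rightarrow> complex) \<Rightarrow> (nat \<Rightarrow> complex) \<Rightarrow> (nat \<Rightarrow> complex) \<Rightarrow>
     int \<Rightarrow> complex \<Rightarrow> bool" where
  "K_pole_free p q a a' b b' k \<sigma> \<longleftrightarrow>
     (\<forall>\<alpha>\<in>{1..q}. \<not> Gamma_C_pole (a \<alpha> + (of_int k + \<sigma>) / 2) (a' \<alpha> + (- of_int k + \<sigma>) / 2)) \<and>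
     (\<forall>\<beta>\<in>{1..p}. \<not> Gamma_C_pole (b \<beta> + (- of_int k - \<sigma>) / 2) (b' \<beta> + (of_int k - \<sigma>) / 2))"

lemma K_C_field_differentiable:
  assumes "\<And>\<alpha>. \<alpha> \<in> {1..q} \<Longrightarrow> (a \<alpha>, a' \<alpha>) \<in> Lambda_C"
    and "\<And>\<beta>. \<beta> \<in> {1..p} \<Longrightarrow> (b \<beta>, b' \<beta>) \<in> Lambda_C"
    and pf: "K_pole_free p q a a' b b' k \<sigma>"
  shows "K_C p q a a' b b' k field_differentiable (at \<sigma>)"
proof -
  have prod: "(\<lambda>x. \<Prod>i\<in>I. f i x) field_differentiable (at z)"
    if "finite I" "\<And>i. i \<in> I \<Longrightarrow> f i field_differentiable (at z)" for I :: "nat set" and f :: "nat \<Rightarrow> complex \<Rightarrow> complex" and z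
    using that by (induction I) (auto intro!: field_differentiable_mult)
  have A: "(\<lambda>\<sigma>. Gamma_C (a \<alpha> + (of_int k + \<sigma>) / 2) (a' \<alpha> + (- of_int k + \<sigma>) / 2)) field_differentiable (at \<sigma>)"
    if "\<alpha> \<in> {1..q}" for \<alpha>
  proof -
    have "(a \<alpha> + of_int k / 2) - (a' \<alpha> - of_int k / 2) = (a \<alpha> - a' \<alpha>) + of_int k" by (simp add: field_simps)
    also have "\<dots> \<in> \<int>" using assms(1)[OF that] by (auto simp: Lambda_C_def)
    finally have int: "(a \<alpha> + of_int k / 2) - (a' \<alpha> - of_int k / 2) \<in> \<int>" .
    have np: "\<not> Gamma_C_pole (a \<alpha> + (of_int k + \<sigma>) / 2) (a' \<alpha> + (- of_int k + \<sigma>) / 2)"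
      using pf that unfolding K_pole_free_def by blast
    have eq: "a \<alpha> + (of_int k + w) / 2 = (a \<alpha> + of_int k / 2) + 1 / 2 * w"
      "a' \<alpha> + (- of_int k + w) / 2 = (a' \<alpha> - of_int k / 2) + 1 / 2 * w" for w
      by (simp_all add: field_simps)
    show ?thesis
      using Gamma_C_field_differentiable[OF int, of "1 / 2" \<sigma>] np unfolding eq by blast
  qed
  have B: "(\<lambda>\<sigma>. Gamma_C (b \<beta> + (- of_int k - \<sigma>) / 2) (b' \<beta> + (of_int k - \<sigma>) / 2)) field_differentiable (at \<sigma>)"
    if "\<beta> \<in> {1..p}" for \<beta>
  proof -
    have "(b \<beta> - of_int k / 2) - (b' \<beta> + of_int k / 2) = (b \<beta> - b' \<beta>) - of_int k" by (simp add: field_simps)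
    also have "\<dots> \<in> \<int>" using assms(2)[OF that] by (auto simp: Lambda_C_def)
    finally have int: "(b \<beta> - of_int k / 2) - (b' \<beta> + of_int k / 2) \<in> \<int>" .
    have np: "\<not> Gamma_C_pole (b \<beta> + (- of_int k - \<sigma>) / 2) (b' \<beta> + (of_int k - \<sigma>) / 2)"
      using pf that unfolding K_pole_free_def by blast
    have eq: "b \<beta> + (- of_int k - w) / 2 = (b \<beta> - of_int k / 2) + - (1 / 2) * w"
      "b' \<beta> + (of_int k - w) / 2 = (b' \<beta> + of_int k / 2) + - (1 / 2) * w" for w
      by (simp_all add: field_simps)
    show ?thesis
      using Gamma_C_field_differentiable[OF int, of "- (1 / 2)" \<sigma>] np unfolding eq by blast
  qed
  show ?thesis unfolding K_C_def
    by (intro field_differentiable_mult prod A B) auto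
qed

locale mb_kernel =
  fixes p q :: nat and a a' b b' :: "nat \<Rightarrow> complex"
  assumes La: "\<And>\<alpha>. \<alpha> \<in> {1..q} \<Longrightarrow> (a \<alpha>, a' \<alpha>) \<in> Lambda_C"
    and Lb: "\<And>\<beta>. \<beta> \<in> {1..p} \<Longrightarrow> (b \<beta>, b' \<beta>) \<in> Lambda_C"
    and Ra: "\<And>\<alpha>. \<alpha> \<in> {1..q} \<Longrightarrow> Re (a \<alpha> + a' \<alpha>) > 0"
    and Rb: "\<And>\<beta>. \<beta> \<in> {1..p} \<Longrightarrow> Re (b \<beta> + b' \<beta>) > 0"
    and sum_less: "(\<Sum>\<alpha>=1..q. Re (a \<alpha> + a' \<alpha>)) + (\<Sum>\<beta>=1..p. Re (b \<beta> + b' \<beta>)) < real (p + q)"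
    and p_le_q: "p \<le> q"
begin

abbreviation "K \<equiv> K_C p q a a' b b'"
abbreviation "pole_free \<equiv> K_pole_free p q a a' b b'"

text \<open>In the closed left half plane the two arguments have real parts with sum Re(b + b') - Re
  \<sigma> > 0, so all poles of the b-factors lie strictly to the right of the axis.\<close>

lemma b_not_Gamma_C_pole:
  assumes "Re \<sigma> \<le> 0" "\<beta> \<in> {1..p}"
  shows "\<not> Gamma_C_pole (b \<beta> + (- of_int k - \<sigma>) / 2) (b' \<beta> + (of_int k - \<sigma>) / 2)"
  using Rb[OF assms(2)] assms(1) by (intro not_Gamma_C_poleI disjI2) (auto simp: field_simps intro: le_less_trans[of _ 0])

text \<open>A pole of an a-factor has Im \<sigma> = -2 Im a and -Re \<sigma> >= Re(a + a') + |k +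
  Re(a - a')|. The three alternatives avoid it by height, by small depth compared with |k|, or by
  lying on the axis.\<close>

lemma pole_freeI:
  assumes "Re \<sigma> \<le> 0"
    and "\<And>\<alpha>. \<alpha> \<in> {1..q} \<Longrightarrow> 2 * \<bar>Im (a \<alpha>)\<bar> < \<bar>Im \<sigma>\<bar> \<or> - Re \<sigma> \<le> \<bar>real_of_int k\<bar> - \<bar>Re (a \<alpha> - a' \<alpha>)\<bar> \<or> Re \<sigma> = 0"
  shows "pole_free k \<sigma>"
  unfolding K_pole_free_def
proof (intro conjI ballI)
  fix \<alpha> assume \<alpha>: "\<alpha> \<in> {1..q}"
  show "\<not> Gamma_C_pole (a \<alpha> + (of_int k + \<sigma>) / 2) (a' \<alpha> + (- of_int k + \<sigma>) / 2)"
  proof (rule not_Gamma_C_poleI)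
    have 1: "Im (a \<alpha> + (of_int k + \<sigma>) / 2) = Im (a \<alpha>) + Im \<sigma> / 2" by simp
    have 2: "Re ((a \<alpha> + (of_int k + \<sigma>) / 2) + (a' \<alpha> + (- of_int k + \<sigma>) / 2)) = Re (a \<alpha> + a' \<alpha>) + Re \<sigma>"
      by (simp add: field_simps)
    have 3: "Re ((a \<alpha> + (of_int k + \<sigma>) / 2) - (a' \<alpha> + (- of_int k + \<sigma>) / 2)) = Re (a \<alpha> - a' \<alpha>) + of_int k"
      by (simp add: field_simps)
    show "Im (a \<alpha> + (of_int k + \<sigma>) / 2) \<noteq> 0 \<or>
      Re ((a \<alpha> + (of_int k + \<sigma>) / 2) + (a' \<alpha> + (- of_int k + \<sigma>) / 2)) >
      - \<bar>Re ((a \<alpha> + (of_int k + \<sigma>) / 2) - (a' \<alpha> + (- of_int k + \<sigma>) / 2))\<bar>"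
      unfolding 1 2 3 using assms(2)[OF \<alpha>] Ra[OF \<alpha>] by linarith
  qed
qed (use b_not_Gamma_C_pole assms in auto)

text \<open>\<open>Gamma_C_plus1_both\<close> in every factor: the a-factors gain their linear terms
  in passing to \<sigma> + 2, the b-factors in coming back. There is no division, so no linear term
  has to be nonzero; Re \<sigma> <= -2 keeps \<sigma> + 2 where the b-factors have no poles.\<close>

lemma K_shift2:
  assumes pf: "pole_free k \<sigma>" and re: "Re \<sigma> \<le> - 2"
  shows "norm (K k \<sigma>) * (\<Prod>\<alpha>=1..q. norm (a \<alpha> + (of_int k + \<sigma>) / 2) * norm (a' \<alpha> + (- of_int k + \<sigma>) / 2)) =
     norm (K k (\<sigma> + 2)) * (\<Prod>\<beta>=1..p. norm (b \<beta> - 1 - (of_int k + \<sigma>) / 2) * norm (b' \<beta> - 1 - (- of_int k + \<sigma>) / 2))"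
proof -
  have A: "norm (Gamma_C (a \<alpha> + (of_int k + (\<sigma> + 2)) / 2) (a' \<alpha> + (- of_int k + (\<sigma> + 2)) / 2)) =
     norm (a \<alpha> + (of_int k + \<sigma>) / 2) * norm (a' \<alpha> + (- of_int k + \<sigma>) / 2) *
     norm (Gamma_C (a \<alpha> + (of_int k + \<sigma>) / 2) (a' \<alpha> + (- of_int k + \<sigma>) / 2))" if "\<alpha> \<in> {1..q}" for \<alpha>
  proof -
    let ?S = "a \<alpha> + (of_int k + \<sigma>) / 2" and ?S' = "a' \<alpha> + (- of_int k + \<sigma>) / 2"
    have "?S - ?S' = (a \<alpha> - a' \<alpha>) + of_int k" by (simp add: field_simps)
    also have "\<dots> \<in> \<int>" using La[OF that] by (auto simp: Lambda_C_def)
    finally have "Gamma_C (?S + 1) (?S' + 1) = - ?S * ?S' * Gamma_C ?S ?S'"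
      using pf that by (intro Gamma_C_plus1_both) (auto simp: K_pole_free_def)
    moreover have "a \<alpha> + (of_int k + (\<sigma> + 2)) / 2 = ?S + 1" "a' \<alpha> + (- of_int k + (\<sigma> + 2)) / 2 = ?S' + 1"
      by (simp_all add: field_simps)
    ultimately show ?thesis by (simp only: norm_mult norm_minus_cancel)
  qed
  have B: "norm (Gamma_C (b \<beta> + (- of_int k - \<sigma>) / 2) (b' \<beta> + (of_int k - \<sigma>) / 2)) =
     norm (b \<beta> - 1 - (of_int k + \<sigma>) / 2) * norm (b' \<beta> - 1 - (- of_int k + \<sigma>) / 2) *
     norm (Gamma_C (b \<beta> + (- of_int k - (\<sigma> + 2)) / 2) (b' \<beta> + (of_int k - (\<sigma> + 2)) / 2))" if "\<beta> \<in> {1..p}" for \<beta>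
  proof -
    let ?S = "b \<beta> + (- of_int k - (\<sigma> + 2)) / 2" and ?S' = "b' \<beta> + (of_int k - (\<sigma> + 2)) / 2"
    have "?S - ?S' = (b \<beta> - b' \<beta>) - of_int k" by (simp add: field_simps)
    also have "\<dots> \<in> \<int>" using Lb[OF that] by (auto simp: Lambda_C_def)
    finally have "Gamma_C (?S + 1) (?S' + 1) = - ?S * ?S' * Gamma_C ?S ?S'"
      using b_not_Gamma_C_pole[of "\<sigma> + 2", OF _ that] re by (intro Gamma_C_plus1_both) auto
    moreover have "b \<beta> + (- of_int k - \<sigma>) / 2 = ?S + 1" "b' \<beta> + (of_int k - \<sigma>) / 2 = ?S' + 1"
      "b \<beta> - 1 - (of_int k + \<sigma>) / 2 = ?S" "b' \<beta> - 1 - (- of_int k + \<sigma>) / 2 = ?S'"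
      by (simp_all add: field_simps)
    ultimately show ?thesis by (simp only: norm_mult norm_minus_cancel)
  qed
  show ?thesis
    unfolding K_C_def norm_mult prod_norm[symmetric]
    by (simp only: prod.cong[OF refl A, of "{1..q}" "\<lambda>x. x"] prod.cong[OF refl B, of "{1..p}" "\<lambda>x. x"] prod.distrib mult_ac)
qed

text \<open>D stands for a bound on the parameters, M for a lower bound on |k + \<sigma>| / 2 and
  |\<sigma> - k| / 2. As M grows the expression tends to r^2 if p = q and to 0 if p < q; so \<theta>
  is the midpoint of r and 1 in the first case and 1/2 in the second.\<close>

lemma shift_ratio_limit:
  fixes r D :: real
  assumes "r > 0" "p = q \<longrightarrow> r < 1"
  obtains \<theta> M0 where "0 < \<theta>" "\<theta> < 1" "M0 > D" "M0 \<ge> 1"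
    "\<And>M. M \<ge> M0 \<Longrightarrow> (1 + D / M) ^ (2 * p) / (1 - D / M) ^ (2 * q) / M ^ (2 * (q - p)) * r\<^sup>2 \<le> \<theta>\<^sup>2"
proof -
  define \<theta> where "\<theta> = (if p = q then (1 + r) / 2 else 1 / 2)"
  have \<theta>: "0 < \<theta>" "\<theta> < 1" using assms by (auto simp: \<theta>_def)
  define l :: real where "l = (if p = q then 1 else 0)"
  have "((\<lambda>M. inverse M ^ (2 * (q - p))) \<longlongrightarrow> l) at_top"
  proof (cases "p = q")
    case False
    have "((\<lambda>M :: real. inverse M ^ (2 * (q - p))) \<longlongrightarrow> 0 ^ (2 * (q - p))) at_top"
      by (rule tendsto_power[OF tendsto_inverse_0_at_top[OF filterlim_ident]])
    moreover have "2 * (q - p) \<noteq> 0" using False p_le_q by simp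
    ultimately show ?thesis unfolding l_def power_0_left using False by (simp only: if_False)
  qed (simp add: l_def)
  moreover have "((\<lambda>M. D / M) \<longlongrightarrow> 0) at_top"
    by (intro real_tendsto_divide_at_top[OF tendsto_const filterlim_ident])
  ultimately have "((\<lambda>M. (1 + D / M) ^ (2 * p) / (1 - D / M) ^ (2 * q) * inverse M ^ (2 * (q - p)) * r\<^sup>2) \<longlongrightarrow>
      (1 + 0) ^ (2 * p) / (1 - 0) ^ (2 * q) * l * r\<^sup>2) at_top"
    by (intro tendsto_intros) auto
  moreover have "(1 + 0) ^ (2 * p) / (1 - 0) ^ (2 * q) * l * r\<^sup>2 < \<theta>\<^sup>2"
  proof (cases "p = q")
    case True
    then have "r < \<theta>" using assms by (simp add: \<theta>_def)
    then show ?thesis using assms True by (simp add: l_def power_strict_mono)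
  qed (use \<theta> in \<open>simp add: l_def\<close>)
  ultimately have "eventually (\<lambda>M. (1 + D / M) ^ (2 * p) / (1 - D / M) ^ (2 * q) * inverse M ^ (2 * (q - p)) * r\<^sup>2 < \<theta>\<^sup>2) at_top"
    by (rule order_tendstoD(2))
  then obtain N where N: "\<And>M. M \<ge> N \<Longrightarrow> (1 + D / M) ^ (2 * p) / (1 - D / M) ^ (2 * q) * inverse M ^ (2 * (q - p)) * r\<^sup>2 < \<theta>\<^sup>2"
    by (auto simp: eventually_at_top_linorder)
  show ?thesis
    by (rule that[OF \<theta>, of "max N (max 1 (D + 1))"])
      (use N in \<open>auto simp: divide_inverse power_inverse less_imp_le mult.assoc\<close>)
qed

text \<open>Put s = (k + \<sigma>)/2 and s' = (-k + \<sigma>)/2. If both have modulus at least M,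
  every linear factor of \<open>K_shift2\<close> is comparable with |s| or |s'|: the a-factors from
  below with 1 - D/M, the b-factors from above with 1 + D/M.\<close>

lemma K_shift2_bound:
  assumes r: "r > 0" "p = q \<longrightarrow> r < 1"
  obtains \<theta> M where "0 < \<theta>" "\<theta> < 1" "M > 0" "\<And>k \<sigma>. pole_free k \<sigma> \<Longrightarrow> Re \<sigma> \<le> - 2 \<Longrightarrow>
     norm (of_int k + \<sigma>) \<ge> M \<Longrightarrow> norm (- of_int k + \<sigma>) \<ge> M \<Longrightarrow>
     norm (K k \<sigma>) * r\<^sup>2 \<le> \<theta>\<^sup>2 * norm (K k (\<sigma> + 2))"
proof -
  define D where "D = (\<Sum>\<alpha>=1..q. norm (a \<alpha>) + norm (a' \<alpha>)) + (\<Sum>\<beta>=1..p. norm (b \<beta> - 1) + norm (b' \<beta> - 1))"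
  have s1: "norm (a \<alpha>) + norm (a' \<alpha>) \<le> (\<Sum>\<alpha>=1..q. norm (a \<alpha>) + norm (a' \<alpha>))" if "\<alpha> \<in> {1..q}" for \<alpha>
    by (rule member_le_sum) (use that in auto)
  have s2: "norm (b \<beta> - 1) + norm (b' \<beta> - 1) \<le> (\<Sum>\<beta>=1..p. norm (b \<beta> - 1) + norm (b' \<beta> - 1))" if "\<beta> \<in> {1..p}" for \<beta>
    by (rule member_le_sum) (use that in auto)
  have s3: "0 \<le> (\<Sum>\<alpha>=1..q. norm (a \<alpha>) + norm (a' \<alpha>))" "0 \<le> (\<Sum>\<beta>=1..p. norm (b \<beta> - 1) + norm (b' \<beta> - 1))"
    by (auto intro: sum_nonneg)
  have Da: "norm (a \<alpha>) \<le> D" "norm (a' \<alpha>) \<le> D" if "\<alpha> \<in> {1..q}" for \<alpha>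
    using s1[OF that] s3 norm_ge_zero[of "a \<alpha>"] norm_ge_zero[of "a' \<alpha>"] unfolding D_def by linarith+
  have Db: "norm (b \<beta> - 1) \<le> D" "norm (b' \<beta> - 1) \<le> D" if "\<beta> \<in> {1..p}" for \<beta>
    using s2[OF that] s3 norm_ge_zero[of "b \<beta> - 1"] norm_ge_zero[of "b' \<beta> - 1"] unfolding D_def by linarith+
  have D0: "D \<ge> 0" using s3 by (simp add: D_def)
  obtain \<theta> M where \<theta>: "0 < \<theta>" "\<theta> < 1" and M: "M > D" "M \<ge> 1"
    and lim: "(1 + D / M) ^ (2 * p) / (1 - D / M) ^ (2 * q) / M ^ (2 * (q - p)) * r\<^sup>2 \<le> \<theta>\<^sup>2"
    by (rule shift_ratio_limit[OF r, of D]) auto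
  show ?thesis
  proof (rule that[OF \<theta>, of "2 * M"])
    show "2 * M > 0" using M by simp
    fix k \<sigma> assume pf: "pole_free k \<sigma>" "Re \<sigma> \<le> - 2" and big: "norm (of_int k + \<sigma>) \<ge> 2 * M" "norm (- of_int k + \<sigma>) \<ge> 2 * M"
    define s s' where "s = (of_int k + \<sigma>) / 2" and "s' = (- of_int k + \<sigma>) / 2"
    have s: "norm s \<ge> M" "norm s' \<ge> M" using big by (auto simp: s_def s'_def norm_divide)
    define \<eta> where "\<eta> = D / M"
    have \<eta>: "0 \<le> \<eta>" "\<eta> < 1" using D0 M by (auto simp: \<eta>_def)
    define X where "X = norm s * norm s'"
    have X: "X \<ge> M\<^sup>2" unfolding X_def power2_eq_square using s M by (intro mult_mono) auto
    then have X0: "X > 0" using M by (smt (verit) zero_less_power2)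
    have lo: "(1 - \<eta>) * norm t \<le> norm (x + t)" if "norm x \<le> D" "norm t \<ge> M" for x t :: complex
    proof -
      have "D = \<eta> * M" using M D0 by (simp add: \<eta>_def)
      also have "\<dots> \<le> \<eta> * norm t" using that \<eta> by (intro mult_left_mono) auto
      finally have "norm t - norm x \<ge> (1 - \<eta>) * norm t" using that by (simp add: algebra_simps)
      moreover have "norm t - norm x \<le> norm (x + t)" by (metis add.commute norm_diff_ineq)
      ultimately show ?thesis by linarith
    qed
    have hi: "norm (x - t) \<le> (1 + \<eta>) * norm t" if "norm x \<le> D" "norm t \<ge> M" for x t :: complex
    proof -
      have "D = \<eta> * M" using M D0 by (simp add: \<eta>_def)
      also have "\<dots> \<le> \<eta> * norm t" using that \<eta> by (intro mult_left_mono) auto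
      finally have "norm t + norm x \<le> (1 + \<eta>) * norm t" using that by (simp add: algebra_simps)
      moreover have "norm (x - t) \<le> norm x + norm t" by (rule norm_triangle_ineq4)
      ultimately show ?thesis by linarith
    qed
    have "((1 - \<eta>)\<^sup>2 * X) ^ q \<le> (\<Prod>\<alpha>=1..q. norm (a \<alpha> + s) * norm (a' \<alpha> + s'))"
    proof -
      have "(1 - \<eta>)\<^sup>2 * X \<le> norm (a \<alpha> + s) * norm (a' \<alpha> + s')" if "\<alpha> \<in> {1..q}" for \<alpha>
      proof -
        have "((1 - \<eta>) * norm s) * ((1 - \<eta>) * norm s') \<le> norm (a \<alpha> + s) * norm (a' \<alpha> + s')"
          using lo[OF Da(1)[OF that] s(1)] lo[OF Da(2)[OF that] s(2)] \<eta> by (intro mult_mono) auto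
        then show ?thesis by (simp add: X_def power2_eq_square mult_ac)
      qed
      then have "(\<Prod>\<alpha>=1..q. (1 - \<eta>)\<^sup>2 * X) \<le> (\<Prod>\<alpha>=1..q. norm (a \<alpha> + s) * norm (a' \<alpha> + s'))"
        using X0 by (intro prod_mono) auto
      then show ?thesis by simp
    qed
    then have "norm (K k \<sigma>) * ((1 - \<eta>)\<^sup>2 * X) ^ q \<le> norm (K k \<sigma>) * (\<Prod>\<alpha>=1..q. norm (a \<alpha> + s) * norm (a' \<alpha> + s'))"
      by (intro mult_left_mono) auto
    also have "\<dots> = norm (K k (\<sigma> + 2)) * (\<Prod>\<beta>=1..p. norm (b \<beta> - 1 - s) * norm (b' \<beta> - 1 - s'))"
      unfolding s_def s'_def by (rule K_shift2[OF pf])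
    also have "(\<Prod>\<beta>=1..p. norm (b \<beta> - 1 - s) * norm (b' \<beta> - 1 - s')) \<le> ((1 + \<eta>)\<^sup>2 * X) ^ p"
    proof -
      have "norm (b \<beta> - 1 - s) * norm (b' \<beta> - 1 - s') \<le> (1 + \<eta>)\<^sup>2 * X" if "\<beta> \<in> {1..p}" for \<beta>
      proof -
        have "norm (b \<beta> - 1 - s) * norm (b' \<beta> - 1 - s') \<le> ((1 + \<eta>) * norm s) * ((1 + \<eta>) * norm s')"
          using hi[OF Db(1)[OF that] s(1)] hi[OF Db(2)[OF that] s(2)] \<eta> by (intro mult_mono) auto
        then show ?thesis by (simp add: X_def power2_eq_square mult_ac)
      qed
      then have "(\<Prod>\<beta>=1..p. norm (b \<beta> - 1 - s) * norm (b' \<beta> - 1 - s')) \<le> (\<Prod>\<beta>=1..p. (1 + \<eta>)\<^sup>2 * X)"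
        by (intro prod_mono) auto
      then show ?thesis by simp
    qed
    finally have *: "norm (K k \<sigma>) * ((1 - \<eta>)\<^sup>2 * X) ^ q \<le> norm (K k (\<sigma> + 2)) * ((1 + \<eta>)\<^sup>2 * X) ^ p"
      by (simp add: mult_left_mono)
    \<comment> \<open>Here p <= q is used: X^p cancels, and the surplus X^(q - p) is bounded below
      by M^(2 (q - p)).\<close>
    have Xq: "X ^ q = X ^ p * X ^ (q - p)" using p_le_q by (simp flip: power_add)
    have "norm (K k \<sigma>) * ((1 - \<eta>) ^ (2 * q) * X ^ (q - p)) * X ^ p \<le> norm (K k (\<sigma> + 2)) * (1 + \<eta>) ^ (2 * p) * X ^ p"
      using * unfolding power_mult[of _ 2] by (simp add: power_mult_distrib Xq mult_ac)
    then have "norm (K k \<sigma>) * ((1 - \<eta>) ^ (2 * q) * X ^ (q - p)) \<le> norm (K k (\<sigma> + 2)) * (1 + \<eta>) ^ (2 * p)"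
      using X0 by (simp add: mult_le_cancel_right)
    moreover have "norm (K k \<sigma>) * ((1 - \<eta>) ^ (2 * q) * M ^ (2 * (q - p))) \<le> norm (K k \<sigma>) * ((1 - \<eta>) ^ (2 * q) * X ^ (q - p))"
      using X M \<eta> by (intro mult_left_mono) (auto simp: power_mult intro!: power_mono)
    ultimately have "norm (K k \<sigma>) * ((1 - \<eta>) ^ (2 * q) * M ^ (2 * (q - p))) \<le> norm (K k (\<sigma> + 2)) * (1 + \<eta>) ^ (2 * p)"
      by linarith
    then have "norm (K k \<sigma>) \<le> norm (K k (\<sigma> + 2)) * ((1 + \<eta>) ^ (2 * p) / (1 - \<eta>) ^ (2 * q) / M ^ (2 * (q - p)))"
      using \<eta> M by (simp add: field_simps)
    then have "norm (K k \<sigma>) * r\<^sup>2 \<le> norm (K k (\<sigma> + 2)) * ((1 + \<eta>) ^ (2 * p) / (1 - \<eta>) ^ (2 * q) / M ^ (2 * (q - p)) * r\<^sup>2)"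
      unfolding mult.assoc[symmetric] by (intro mult_right_mono) (auto simp: mult.assoc)
    also have "\<dots> \<le> norm (K k (\<sigma> + 2)) * \<theta>\<^sup>2"
      using lim by (intro mult_left_mono) (auto simp: \<eta>_def)
    finally show "norm (K k \<sigma>) * r\<^sup>2 \<le> \<theta>\<^sup>2 * norm (K k (\<sigma> + 2))" by (simp add: mult.commute)
  qed
qed

text \<open>The exponent in the power decay of the kernel on the axis: each a-factor contributes 1 -
  Re(a + a') and each b-factor 1 - Re(b + b').\<close>

definition decay :: real where
  "decay = real (p + q) - ((\<Sum>\<alpha>=1..q. Re (a \<alpha> + a' \<alpha>)) + (\<Sum>\<beta>=1..p. Re (b \<beta> + b' \<beta>)))"

lemma decay_pos: "decay > 0" using sum_less by (simp add: decay_def)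

text \<open>A product of \<open>Gamma_C_strip_bound\<close> over all factors; a b-factor is of the
  same shape with (k, \<sigma>) replaced by (-k, -\<sigma>). The width 2 of the strip matches the
  step of \<open>K_shift2\<close>.\<close>

lemma K_strip_bound:
  obtains C M where "C > 0" "M \<ge> 1" "\<And>k \<sigma>. - 2 \<le> Re \<sigma> \<Longrightarrow> Re \<sigma> \<le> 0 \<Longrightarrow>
     norm (Complex (of_int k) (Im \<sigma>)) \<ge> M \<Longrightarrow> norm (K k \<sigma>) \<le> C * norm (Complex (of_int k) (Im \<sigma>)) powr (- decay)"
proof -
  have "\<forall>\<alpha>\<in>{1..q}. \<exists>C M. C > 0 \<and> M > 0 \<and> (\<forall>k \<sigma>. \<bar>Re \<sigma>\<bar> \<le> 2 \<longrightarrow> norm (Complex (of_int k) (Im \<sigma>)) \<ge> M \<longrightarrow>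
     norm (Gamma_C (a \<alpha> + (of_int k + \<sigma>) / 2) (a' \<alpha> + (- of_int k + \<sigma>) / 2)) \<le>
       C * norm (Complex (of_int k) (Im \<sigma>)) powr (Re (a \<alpha> + a' \<alpha>) + Re \<sigma> - 1))"
    using Gamma_C_strip_bound[OF La, of _ 2] by (metis zero_le_numeral)
  then obtain CA MA where A: "\<And>\<alpha>. \<alpha> \<in> {1..q} \<Longrightarrow> CA \<alpha> > 0" "\<And>\<alpha>. \<alpha> \<in> {1..q} \<Longrightarrow> MA \<alpha> > (0 :: real)"
    "\<And>\<alpha> k \<sigma>. \<alpha> \<in> {1..q} \<Longrightarrow> \<bar>Re \<sigma>\<bar> \<le> 2 \<Longrightarrow> norm (Complex (of_int k) (Im \<sigma>)) \<ge> MA \<alpha> \<Longrightarrow>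
     norm (Gamma_C (a \<alpha> + (of_int k + \<sigma>) / 2) (a' \<alpha> + (- of_int k + \<sigma>) / 2)) \<le>
       CA \<alpha> * norm (Complex (of_int k) (Im \<sigma>)) powr (Re (a \<alpha> + a' \<alpha>) + Re \<sigma> - 1)"
    by metis
  have "\<forall>\<beta>\<in>{1..p}. \<exists>C M. C > 0 \<and> M > 0 \<and> (\<forall>k \<sigma>. \<bar>Re \<sigma>\<bar> \<le> 2 \<longrightarrow> norm (Complex (of_int k) (Im \<sigma>)) \<ge> M \<longrightarrow>
     norm (Gamma_C (b \<beta> + (of_int k + \<sigma>) / 2) (b' \<beta> + (- of_int k + \<sigma>) / 2)) \<le>
       C * norm (Complex (of_int k) (Im \<sigma>)) powr (Re (b \<beta> + b' \<beta>) + Re \<sigma> - 1))"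
    using Gamma_C_strip_bound[OF Lb, of _ 2] by (metis zero_le_numeral)
  then obtain CB MB where B: "\<And>\<beta>. \<beta> \<in> {1..p} \<Longrightarrow> CB \<beta> > 0" "\<And>\<beta>. \<beta> \<in> {1..p} \<Longrightarrow> MB \<beta> > (0 :: real)"
    "\<And>\<beta> k \<sigma>. \<beta> \<in> {1..p} \<Longrightarrow> \<bar>Re \<sigma>\<bar> \<le> 2 \<Longrightarrow> norm (Complex (of_int k) (Im \<sigma>)) \<ge> MB \<beta> \<Longrightarrow>
     norm (Gamma_C (b \<beta> + (of_int k + \<sigma>) / 2) (b' \<beta> + (- of_int k + \<sigma>) / 2)) \<le>
       CB \<beta> * norm (Complex (of_int k) (Im \<sigma>)) powr (Re (b \<beta> + b' \<beta>) + Re \<sigma> - 1)"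
    by metis
  define M where "M = 1 + (\<Sum>\<alpha>=1..q. MA \<alpha>) + (\<Sum>\<beta>=1..p. MB \<beta>)"
  have nn: "0 \<le> (\<Sum>\<alpha>=1..q. MA \<alpha>)" "0 \<le> (\<Sum>\<beta>=1..p. MB \<beta>)"
    by (intro sum_nonneg less_imp_le[OF A(2)] less_imp_le[OF B(2)]; simp)+
  have MA: "MA \<alpha> \<le> M" if "\<alpha> \<in> {1..q}" for \<alpha>
  proof -
    have "MA \<alpha> \<le> (\<Sum>\<alpha>=1..q. MA \<alpha>)" using that A(2) by (intro member_le_sum) (auto intro: less_imp_le)
    then show ?thesis using nn by (simp add: M_def)
  qed
  have MB: "MB \<beta> \<le> M" if "\<beta> \<in> {1..p}" for \<beta>
  proof -
    have "MB \<beta> \<le> (\<Sum>\<beta>=1..p. MB \<beta>)" using that B(2) by (intro member_le_sum) (auto intro: less_imp_le)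
    then show ?thesis using nn by (simp add: M_def)
  qed
  show ?thesis
  proof
    show "(\<Prod>\<alpha>=1..q. CA \<alpha>) * (\<Prod>\<beta>=1..p. CB \<beta>) > 0" using A(1) B(1) by (intro mult_pos_pos prod_pos) auto
    show "M \<ge> 1" using nn by (simp add: M_def)
    fix k :: int and \<sigma> :: complex
    assume re: "- 2 \<le> Re \<sigma>" "Re \<sigma> \<le> 0" and big: "norm (Complex (of_int k) (Im \<sigma>)) \<ge> M"
    define Q where "Q = norm (Complex (of_int k) (Im \<sigma>))"
    have Q: "Q \<ge> 1" using big \<open>M \<ge> 1\<close> by (simp add: Q_def)
    have Q': "norm (Complex (of_int (- k)) (Im (- \<sigma>))) = Q" by (simp add: Q_def cmod_def)
    have "norm (K k \<sigma>) = (\<Prod>\<alpha>=1..q. norm (Gamma_C (a \<alpha> + (of_int k + \<sigma>) / 2) (a' \<alpha> + (- of_int k + \<sigma>) / 2))) *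
        (\<Prod>\<beta>=1..p. norm (Gamma_C (b \<beta> + (of_int (- k) + - \<sigma>) / 2) (b' \<beta> + (- of_int (- k) + - \<sigma>) / 2)))"
      unfolding K_C_def norm_mult prod_norm[symmetric] by simp
    also have "\<dots> \<le> (\<Prod>\<alpha>=1..q. CA \<alpha> * Q powr (Re (a \<alpha> + a' \<alpha>) + Re \<sigma> - 1)) *
        (\<Prod>\<beta>=1..p. CB \<beta> * Q powr (Re (b \<beta> + b' \<beta>) + Re (- \<sigma>) - 1))"
    proof (intro mult_mono prod_mono conjI)
      show "norm (Gamma_C (a \<alpha> + (of_int k + \<sigma>) / 2) (a' \<alpha> + (- of_int k + \<sigma>) / 2)) \<le> CA \<alpha> * Q powr (Re (a \<alpha> + a' \<alpha>) + Re \<sigma> - 1)"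
        if "\<alpha> \<in> {1..q}" for \<alpha>
        unfolding Q_def using re big MA[OF that] by (intro A(3) that) auto
      show "norm (Gamma_C (b \<beta> + (of_int (- k) + - \<sigma>) / 2) (b' \<beta> + (- of_int (- k) + - \<sigma>) / 2)) \<le>
          CB \<beta> * Q powr (Re (b \<beta> + b' \<beta>) + Re (- \<sigma>) - 1)" if "\<beta> \<in> {1..p}" for \<beta>
        using B(3)[OF that, of "- \<sigma>" "- k"] re big MB[OF that] unfolding Q' by (auto simp: Q_def)
      show "0 \<le> (\<Prod>\<alpha>=1..q. CA \<alpha> * Q powr (Re (a \<alpha> + a' \<alpha>) + Re \<sigma> - 1))"
        using A(1) by (intro prod_nonneg mult_nonneg_nonneg) (auto intro: less_imp_le)
    qed (auto intro: prod_nonneg)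
    also have "\<dots> = ((\<Prod>\<alpha>=1..q. CA \<alpha>) * (\<Prod>\<beta>=1..p. CB \<beta>)) *
        Q powr ((\<Sum>\<alpha>=1..q. Re (a \<alpha> + a' \<alpha>) + Re \<sigma> - 1) + (\<Sum>\<beta>=1..p. Re (b \<beta> + b' \<beta>) + Re (- \<sigma>) - 1))"
      using Q by (simp add: prod.distrib powr_add powr_sum del: powr_sum) (simp add: powr_sum)
    also have "(\<Sum>\<alpha>=1..q. Re (a \<alpha> + a' \<alpha>) + Re \<sigma> - 1) + (\<Sum>\<beta>=1..p. Re (b \<beta> + b' \<beta>) + Re (- \<sigma>) - 1)
       = - decay + real (q - p) * Re \<sigma>"
      using p_le_q by (simp add: decay_def sum.distrib sum_subtractf of_nat_diff algebra_simps)
    also have "((\<Prod>\<alpha>=1..q. CA \<alpha>) * (\<Prod>\<beta>=1..p. CB \<beta>)) * Q powr (- decay + real (q - p) * Re \<sigma>) \<le>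
        ((\<Prod>\<alpha>=1..q. CA \<alpha>) * (\<Prod>\<beta>=1..p. CB \<beta>)) * Q powr (- decay)"
      using Q re \<open>(\<Prod>\<alpha>=1..q. CA \<alpha>) * (\<Prod>\<beta>=1..p. CB \<beta>) > 0\<close>
      by (intro mult_left_mono powr_mono) (auto simp: mult_nonneg_nonpos)
    finally show "norm (K k \<sigma>) \<le> ((\<Prod>\<alpha>=1..q. CA \<alpha>) * (\<Prod>\<beta>=1..p. CB \<beta>)) * norm (Complex (of_int k) (Im \<sigma>)) powr (- decay)"
      by (simp add: Q_def)
  qed
qed

text \<open>Induction over strips of width 2: \<open>K_strip_bound\<close> on the first one, then
  \<open>K_shift2_bound\<close> from \<sigma> + 2 to \<sigma>, each step gaining \<theta>^2. The
  decay factor depends only on k and Im \<sigma> and is carried along unchanged. The factor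
  \<open>r powr (- Re \<sigma>)\<close> bounds the power of z for |z| <= r.\<close>

lemma K_main_estimate:
  assumes r: "r > 0" "p = q \<longrightarrow> r < 1"
  obtains C \<theta> T B where "C > 0" "0 < \<theta>" "\<theta> < 1" "T \<ge> 1" "B \<ge> 1"
    "\<And>\<alpha>. \<alpha> \<in> {1..q} \<Longrightarrow> \<bar>Re (a \<alpha> - a' \<alpha>)\<bar> + 2 \<le> B"
    "\<And>k \<sigma>. Re \<sigma> \<le> 0 \<Longrightarrow> \<bar>Im \<sigma>\<bar> \<ge> T \<or> - Re \<sigma> \<le> (\<bar>real_of_int k\<bar> - B) / 2 \<Longrightarrow>
       pole_free k \<sigma> \<and> norm (K k \<sigma>) * r powr (- Re \<sigma>) \<le>
         C * norm (Complex (of_int k) (Im \<sigma>)) powr (- decay) * \<theta> powr (- Re \<sigma>)"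
proof -
  obtain \<theta> M1 where \<theta>: "0 < \<theta>" "\<theta> < 1" and "M1 > 0" and step: "\<And>k \<sigma>. pole_free k \<sigma> \<Longrightarrow> Re \<sigma> \<le> - 2 \<Longrightarrow>
     norm (of_int k + \<sigma>) \<ge> M1 \<Longrightarrow> norm (- of_int k + \<sigma>) \<ge> M1 \<Longrightarrow>
     norm (K k \<sigma>) * r\<^sup>2 \<le> \<theta>\<^sup>2 * norm (K k (\<sigma> + 2))"
    using K_shift2_bound[OF r] by metis
  obtain C M2 where C: "C > 0" and M2: "M2 \<ge> 1" and strip: "\<And>k \<sigma>. - 2 \<le> Re \<sigma> \<Longrightarrow> Re \<sigma> \<le> 0 \<Longrightarrow>
     norm (Complex (of_int k) (Im \<sigma>)) \<ge> M2 \<Longrightarrow> norm (K k \<sigma>) \<le> C * norm (Complex (of_int k) (Im \<sigma>)) powr (- decay)"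
    using K_strip_bound by metis
  define T where "T = M1 + M2 + (\<Sum>\<alpha>=1..q. 2 * \<bar>Im (a \<alpha>)\<bar>)"
  define B where "B = M1 + M2 + 2 + (\<Sum>\<alpha>=1..q. \<bar>Re (a \<alpha> - a' \<alpha>)\<bar>)"
  have nn: "0 \<le> (\<Sum>\<alpha>=1..q. 2 * \<bar>Im (a \<alpha>)\<bar>)" "0 \<le> (\<Sum>\<alpha>=1..q. \<bar>Re (a \<alpha> - a' \<alpha>)\<bar>)"
    by (auto intro: sum_nonneg)
  have TB: "T \<ge> M1" "T \<ge> M2" "B \<ge> M1" "B \<ge> M2" using nn \<open>M1 > 0\<close> M2 by (auto simp: T_def B_def)
  have Ta: "2 * \<bar>Im (a \<alpha>)\<bar> < T" if "\<alpha> \<in> {1..q}" for \<alpha>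
  proof -
    have "2 * \<bar>Im (a \<alpha>)\<bar> \<le> (\<Sum>\<alpha>=1..q. 2 * \<bar>Im (a \<alpha>)\<bar>)" using that by (intro member_le_sum) auto
    then show ?thesis using \<open>M1 > 0\<close> M2 unfolding T_def by linarith
  qed
  have Ba: "\<bar>Re (a \<alpha> - a' \<alpha>)\<bar> + 2 \<le> B" if "\<alpha> \<in> {1..q}" for \<alpha>
  proof -
    have "\<bar>Re (a \<alpha> - a' \<alpha>)\<bar> \<le> (\<Sum>\<alpha>=1..q. \<bar>Re (a \<alpha> - a' \<alpha>)\<bar>)"
      using that member_le_sum[of \<alpha> "{1..q}" "\<lambda>\<alpha>. \<bar>Re (a \<alpha> - a' \<alpha>)\<bar>"] by simp
    then show ?thesis using \<open>M1 > 0\<close> M2 unfolding B_def by linarith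
  qed
  \<comment> \<open>On the first strip -Re \<sigma> lies in [0, 2], where r^(-Re \<sigma>) <= max 1
    r^2 and \<theta>^(-Re \<sigma>) >= \<theta>^2.\<close>
  define E where "E = max 1 (r\<^sup>2) / \<theta>\<^sup>2"
  \<comment> \<open>Moving to the right by 2 keeps a point in this region, so the induction never
    leaves it.\<close>
  define reg where "reg = (\<lambda>(k :: int) \<sigma>. \<bar>Im \<sigma>\<bar> \<ge> T \<or> - Re \<sigma> \<le> (\<bar>real_of_int k\<bar> - B) / 2)"
  have pf: "pole_free k \<sigma>" if "Re \<sigma> \<le> 0" "reg k \<sigma>" for k \<sigma>
  proof (rule pole_freeI)
    fix \<alpha> assume \<alpha>: "\<alpha> \<in> {1..q}"
    have "- Re \<sigma> \<le> \<bar>real_of_int k\<bar> - \<bar>Re (a \<alpha> - a' \<alpha>)\<bar>" if "- Re \<sigma> \<le> (\<bar>real_of_int k\<bar> - B) / 2"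
    proof -
      have "2 * (- Re \<sigma>) \<le> \<bar>real_of_int k\<bar> - B" using that by simp
      then show ?thesis using Ba[OF \<alpha>] \<open>Re \<sigma> \<le> 0\<close> by linarith
    qed
    then show "2 * \<bar>Im (a \<alpha>)\<bar> < \<bar>Im \<sigma>\<bar> \<or> - Re \<sigma> \<le> \<bar>real_of_int k\<bar> - \<bar>Re (a \<alpha> - a' \<alpha>)\<bar> \<or> Re \<sigma> = 0"
      using Ta[OF \<alpha>] \<open>reg k \<sigma>\<close> unfolding reg_def by linarith
  qed (use that in auto)
  have main: "norm (K k \<sigma>) * r powr (- Re \<sigma>) \<le>
         C * E * norm (Complex (of_int k) (Im \<sigma>)) powr (- decay) * \<theta> powr (- Re \<sigma>)"
    if "Re \<sigma> \<le> 0" "reg k \<sigma>" "- Re \<sigma> \<le> 2 * real n + 2" for k \<sigma> n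
    using that
  proof (induction n arbitrary: \<sigma>)
    case 0
    have "M2 \<le> norm (Complex (of_int k) (Im \<sigma>))"
    proof (cases "\<bar>Im \<sigma>\<bar> \<ge> T")
      case True
      then show ?thesis using abs_Im_le_cmod[of "Complex (of_int k) (Im \<sigma>)"] TB by simp
    next
      case False
      then have "\<bar>real_of_int k\<bar> \<ge> B" using 0 by (simp add: reg_def)
      then show ?thesis using abs_Re_le_cmod[of "Complex (of_int k) (Im \<sigma>)"] TB by simp
    qed
    then have "norm (K k \<sigma>) \<le> C * norm (Complex (of_int k) (Im \<sigma>)) powr (- decay)"
      using 0 by (intro strip) auto
    moreover have "r powr (- Re \<sigma>) \<le> E * \<theta> powr (- Re \<sigma>)"
    proof -
      have "r powr (- Re \<sigma>) \<le> max 1 (r\<^sup>2)"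
      proof (cases "r \<le> 1")
        case True
        then have "r powr (- Re \<sigma>) \<le> 1 powr (- Re \<sigma>)" using r 0 by (intro powr_mono2) auto
        then show ?thesis by simp
      next
        case False
        then have "r powr (- Re \<sigma>) \<le> r powr 2" using 0 by (intro powr_mono) auto
        then show ?thesis using r by simp
      qed
      also have "max 1 (r\<^sup>2) = E * \<theta> powr 2" using \<theta> by (simp add: E_def)
      also have "\<dots> \<le> E * \<theta> powr (- Re \<sigma>)"
        using \<theta> 0 by (intro mult_left_mono powr_mono') (auto simp: E_def)
      finally show ?thesis .
    qed
    ultimately have "norm (K k \<sigma>) * r powr (- Re \<sigma>) \<le>
        (C * norm (Complex (of_int k) (Im \<sigma>)) powr (- decay)) * (E * \<theta> powr (- Re \<sigma>))"
      using C by (intro mult_mono) auto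
    then show ?case by (simp add: mult_ac)
  next
    case (Suc n)
    show ?case
    proof (cases "- Re \<sigma> \<le> 2 * real n + 2")
      case True
      then show ?thesis using Suc by simp
    next
      case False
      then have re: "Re \<sigma> \<le> - 2" by simp
      have ih: "norm (K k (\<sigma> + 2)) * r powr (- Re (\<sigma> + 2)) \<le>
         C * E * norm (Complex (of_int k) (Im (\<sigma> + 2))) powr (- decay) * \<theta> powr (- Re (\<sigma> + 2))"
        using Suc.prems re by (intro Suc.IH) (auto simp: reg_def)
      \<comment> \<open>Either the height alone exceeds M1, or |k| >= B + 2 |Re \<sigma>|, and then
        subtracting |Re \<sigma>| from |k| still leaves at least B. This is why the allowed depth is
        half of |k| - B.\<close>
      have bigs: "M1 \<le> norm (of_int k + \<sigma>)" "M1 \<le> norm (- of_int k + \<sigma>)"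
      proof -
        have "M1 \<le> norm (of_int k + \<sigma>) \<and> M1 \<le> norm (- of_int k + \<sigma>)"
        proof (cases "\<bar>Im \<sigma>\<bar> \<ge> T")
          case True
          then show ?thesis using abs_Im_le_cmod[of "of_int k + \<sigma>"] abs_Im_le_cmod[of "- of_int k + \<sigma>"] TB by simp
        next
          case False
          then have "2 * (- Re \<sigma>) \<le> \<bar>real_of_int k\<bar> - B" using Suc.prems by (auto simp: reg_def)
          moreover have "Re \<sigma> \<le> 0" by fact
          ultimately have "\<bar>of_int k + Re \<sigma>\<bar> \<ge> B" "\<bar>- of_int k + Re \<sigma>\<bar> \<ge> B"
            using TB(3) \<open>M1 > 0\<close> by linarith+
          then show ?thesis using abs_Re_le_cmod[of "of_int k + \<sigma>"] abs_Re_le_cmod[of "- of_int k + \<sigma>"] TB by simp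
        qed
        then show "M1 \<le> norm (of_int k + \<sigma>)" "M1 \<le> norm (- of_int k + \<sigma>)" by auto
      qed
      have "norm (K k \<sigma>) * r\<^sup>2 \<le> \<theta>\<^sup>2 * norm (K k (\<sigma> + 2))"
        using Suc.prems by (intro step pf re bigs) auto
      moreover have pw: "x powr (- Re \<sigma>) = x\<^sup>2 * x powr (- Re (\<sigma> + 2))" if "x > 0" for x :: real
      proof -
        have "x powr (- Re \<sigma>) = x powr (2 + - Re (\<sigma> + 2))" by simp
        then show ?thesis using that unfolding powr_add by simp
      qed
      ultimately have "norm (K k \<sigma>) * r\<^sup>2 * r powr (- Re (\<sigma> + 2)) \<le> \<theta>\<^sup>2 * norm (K k (\<sigma> + 2)) * r powr (- Re (\<sigma> + 2))"
        by (intro mult_right_mono) auto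
      also have "\<dots> = \<theta>\<^sup>2 * (norm (K k (\<sigma> + 2)) * r powr (- Re (\<sigma> + 2)))" by (simp only: mult.assoc)
      also have "\<dots> \<le> \<theta>\<^sup>2 * (C * E * norm (Complex (of_int k) (Im (\<sigma> + 2))) powr (- decay) * \<theta> powr (- Re (\<sigma> + 2)))"
        by (rule mult_left_mono[OF ih]) simp
      also have "\<dots> = C * E * norm (Complex (of_int k) (Im \<sigma>)) powr (- decay) * (\<theta>\<^sup>2 * \<theta> powr (- Re (\<sigma> + 2)))"
        by (simp add: mult_ac)
      finally show ?thesis unfolding pw[OF r(1)] pw[OF \<theta>(1)] by (simp only: mult.assoc)
    qed
  qed
  show ?thesis
  proof (rule that[of "C * E" \<theta> T B])
    show "C * E > 0" using C \<theta> by (auto simp: E_def intro!: mult_pos_pos divide_pos_pos)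
    show "T \<ge> 1" "B \<ge> 1" using M2 TB by linarith+
    fix k \<sigma> assume re: "Re \<sigma> \<le> 0" and "\<bar>Im \<sigma>\<bar> \<ge> T \<or> - Re \<sigma> \<le> (\<bar>real_of_int k\<bar> - B) / 2"
    then have reg: "reg k \<sigma>" by (simp add: reg_def)
    obtain n :: nat where "- Re \<sigma> \<le> real n" using real_arch_simple by blast
    then show "pole_free k \<sigma> \<and> norm (K k \<sigma>) * r powr (- Re \<sigma>) \<le>
         C * E * norm (Complex (of_int k) (Im \<sigma>)) powr (- decay) * \<theta> powr (- Re \<sigma>)"
      using pf[OF re reg] main[OF re reg, of n] by auto
  qed (use \<theta> Ba in auto)
qed

end

section \<open>Deformation of contours\<close>

text \<open>The contour with vertical segment on \<open>Re = - L\<close>, parametrised with unit speed; \<open>cweight\<close> is its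
  derivative.\<close>

definition cpath :: "real \<Rightarrow> real \<Rightarrow> real \<Rightarrow> complex" where
  "cpath L T t = of_real (- L - max 0 (\<bar>t\<bar> - T)) + \<i> * of_real (max (- T) (min T t))"

definition cweight :: "real \<Rightarrow> real \<Rightarrow> complex" where
  "cweight T t = (if \<bar>t\<bar> \<le> T then \<i> else if t > T then - 1 else 1)"

lemma Re_cpath [simp]: "Re (cpath L T t) = - L - max 0 (\<bar>t\<bar> - T)"
  and Im_cpath [simp]: "Im (cpath L T t) = max (- T) (min T t)"
  by (simp_all add: cpath_def)

lemma continuous_on_cpath: "continuous_on S (cpath L T)"
  unfolding cpath_def by (intro continuous_intros)

lemma norm_cweight [simp]: "norm (cweight T t) = 1"
  by (simp add: cweight_def)

lemma borel_measurable_cweight [measurable]: "cweight T \<in> borel_measurable borel"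
  unfolding cweight_def by measurable

lemma cpath_shift_pos: "t > T + d \<Longrightarrow> T > 0 \<Longrightarrow> d \<ge> 0 \<Longrightarrow> cpath L T t = cpath (L + d) T (t - d) \<and> cweight T t = cweight T (t - d)"
  by (auto simp: cpath_def cweight_def)

lemma cpath_shift_neg: "t < - (T + d) \<Longrightarrow> T > 0 \<Longrightarrow> d \<ge> 0 \<Longrightarrow> cpath L T t = cpath (L + d) T (t + d) \<and> cweight T t = cweight T (t + d)"
  by (auto simp: cpath_def cweight_def)

lemma cpath_has_vector_derivative:
  assumes T: "T > 0" and t: "t \<notin> {- T, T}"
  shows "(cpath L T has_vector_derivative cweight T t) (at t)"
proof -
  consider "\<bar>t\<bar> < T" | "t > T" | "t < - T" using t by fastforce
  then show ?thesis
  proof cases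
    case 1
    have "((\<lambda>t. of_real (- L) + \<i> * of_real t) has_vector_derivative \<i>) (at t)"
      by (auto intro!: derivative_eq_intros)
    then have "(cpath L T has_vector_derivative \<i>) (at t)"
      by (rule has_vector_derivative_transform_within_open[where S = "{- T<..<T}"]) (use 1 in \<open>auto simp: cpath_def\<close>)
    then show ?thesis using 1 by (simp add: cweight_def)
  next
    case 2
    have "((\<lambda>t. of_real (- L) - (of_real t - of_real T) + \<i> * of_real T) has_vector_derivative - 1) (at t)"
      by (auto intro!: derivative_eq_intros)
    then have "(cpath L T has_vector_derivative - 1) (at t)"
      by (rule has_vector_derivative_transform_within_open[where S = "{T<..}"]) (use 2 T in \<open>auto simp: cpath_def\<close>)
    then show ?thesis using 2 T by (simp add: cweight_def)
  next
    case 3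
    have "((\<lambda>t. of_real (- L) - (- of_real t - of_real T) - \<i> * of_real T) has_vector_derivative 1) (at t)"
      by (auto intro!: derivative_eq_intros)
    then have "(cpath L T has_vector_derivative 1) (at t)"
      by (rule has_vector_derivative_transform_within_open[where S = "{..<- T}"]) (use 3 T in \<open>auto simp: cpath_def\<close>)
    then show ?thesis using 3 T by (simp add: cweight_def)
  qed
qed

text \<open>\<open>F\<close> collects the corners of the path. The derivative of \<open>G\<close> is
  only required within \<open>S\<close>, so that primitives on closed convex regions can be used up
  to the boundary.\<close>

lemma path_integral_primitive:
  fixes G g :: "complex \<Rightarrow> complex"
  assumes G: "\<And>z. z \<in> S \<Longrightarrow> (G has_field_derivative g z) (at z within S)"
    and uv: "u \<le> v" and cont: "continuous_on {u..v} p" and fin: "finite F"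
    and S: "\<And>t. t \<in> {u..v} \<Longrightarrow> p t \<in> S"
    and der: "\<And>t. t \<in> {u..v} - F \<Longrightarrow> (p has_vector_derivative p' t) (at t within {u..v})"
  shows "((\<lambda>t. g (p t) * p' t) has_integral (G (p v) - G (p u))) {u..v}"
proof (rule fundamental_theorem_of_calculus_interior_strong[OF fin uv])
  fix t assume t: "t \<in> {u<..<v} - F"
  have "(G has_field_derivative g (p t)) (at (p t) within p ` {u..v})"
    by (rule has_field_derivative_subset[OF G]) (use S t in auto)
  moreover have "(p has_vector_derivative p' t) (at t within {u..v})" using t by (intro der) auto
  ultimately have "((\<lambda>t. G (p t)) has_vector_derivative g (p t) * p' t) (at t within {u..v})"
    using field_vector_diff_chain_within[of p "p' t" t "{u..v}" G "g (p t)"] by (simp add: o_def mult.commute)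
  then show "((\<lambda>t. G (p t)) has_vector_derivative g (p t) * p' t) (at t)"
    using t at_within_interior[of t "{u..v}"] by (simp add: interior_atLeastAtMost_real)
next
  have "continuous_on S G" using G by (auto intro!: DERIV_continuous_on)
  then show "continuous_on {u..v} (\<lambda>t. G (p t))"
    by (rule continuous_on_compose2[OF _ cont]) (use S in auto)
qed

lemma cpath_integral_primitive:
  fixes G g :: "complex \<Rightarrow> complex"
  assumes "\<And>z. z \<in> S \<Longrightarrow> (G has_field_derivative g z) (at z within S)"
    and "u \<le> v" "T > 0" "\<And>t. t \<in> {u..v} \<Longrightarrow> cpath L T t \<in> S"
  shows "((\<lambda>t. g (cpath L T t) * cweight T t) has_integral (G (cpath L T v) - G (cpath L T u))) {u..v}"
  using assms
  by (intro path_integral_primitive[where S = S and F = "{- T, T}", OF assms(1)] continuous_on_cpath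
      has_vector_derivative_at_within[OF cpath_has_vector_derivative]) simp_all

text \<open>To the left of Re = -L' the two contours run along the same rays, with parameters
  differing by d = L' - L. The remaining parts, |t| <= T + d of the first and |t| <= T of the
  second, join the same end points inside a rectangle, where \<open>g\<close> has a
  primitive.\<close>

lemma cpath_integral_shift:
  fixes g :: "complex \<Rightarrow> complex"
  assumes T: "T > 0" and L: "L \<le> L'"
    and fd: "\<And>z. - L' \<le> Re z \<Longrightarrow> Re z \<le> - L \<Longrightarrow> \<bar>Im z\<bar> \<le> T \<Longrightarrow> g field_differentiable at z"
    and int: "integrable lborel (\<lambda>t. g (cpath L T t) * cweight T t)"
    and int': "integrable lborel (\<lambda>t. g (cpath L' T t) * cweight T t)"
  shows "(\<integral>t. g (cpath L T t) * cweight T t \<partial>lborel) = (\<integral>t. g (cpath L' T t) * cweight T t \<partial>lborel)"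
proof -
  define d where "d = L' - L"
  have d: "d \<ge> 0" "L' = L + d" using L by (auto simp: d_def)
  define f f' where "f = (\<lambda>t. g (cpath L T t) * cweight T t)" and "f' = (\<lambda>t. g (cpath L' T t) * cweight T t)"
  define S where "S = {z. - L' \<le> Re z \<and> Re z \<le> - L \<and> - T \<le> Im z \<and> Im z \<le> T}"
  have "convex S"
  proof -
    have "S = cbox (Complex (- L') (- T)) (Complex (- L) T)"
      by (auto simp: S_def in_cbox_complex_iff)
    then show ?thesis by simp
  qed
  have fdS: "g field_differentiable at z" if "z \<in> S" for z using fd that by (auto simp: S_def)
  then have "continuous_on S g"
    by (intro continuous_at_imp_continuous_on ballI field_differentiable_imp_continuous_at)
  then obtain G where G: "\<And>z. z \<in> S \<Longrightarrow> (G has_field_derivative g z) (at z within S)"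
    using holomorphic_convex_primitive[OF \<open>convex S\<close>, of "{}" g] fdS interior_subset by blast
  have mid: "(f has_integral (G (cpath L T (T + d)) - G (cpath L T (- (T + d))))) {- (T + d)..T + d}"
    unfolding f_def using T d by (intro cpath_integral_primitive[where S = S] G) (auto simp: S_def)
  have mid': "(f' has_integral (G (cpath L' T T) - G (cpath L' T (- T)))) {- T..T}"
    unfolding f'_def using T d by (intro cpath_integral_primitive[where S = S] G) (auto simp: S_def)
  have ends: "cpath L T (T + d) = cpath L' T T" "cpath L T (- (T + d)) = cpath L' T (- T)"
    using T d by (auto simp: cpath_def)
  have split: "(\<integral>t. h t \<partial>lborel) = (\<integral>t. indicator {..<-X} t *\<^sub>R h t \<partial>lborel) + integral {-X..X} h
      + (\<integral>t. indicator {X<..} t *\<^sub>R h t \<partial>lborel)"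
    if h: "integrable lborel h" and X: "X > 0" for h :: "real \<Rightarrow> complex" and X
  proof -
    have i: "set_integrable lborel A h" if "A \<in> sets borel" for A
      unfolding set_integrable_def using h that by (intro integrable_mult_indicator) auto
    have "(\<integral>t. h t \<partial>lborel) = (\<integral>t. indicator {..<-X} t *\<^sub>R h t + indicator {-X..X} t *\<^sub>R h t + indicator {X<..} t *\<^sub>R h t \<partial>lborel)"
      using X by (intro Bochner_Integration.integral_cong) (auto simp: indicator_def)
    also have "\<dots> = (\<integral>t. indicator {..<-X} t *\<^sub>R h t \<partial>lborel) + (\<integral>t. indicator {-X..X} t *\<^sub>R h t \<partial>lborel)
      + (\<integral>t. indicator {X<..} t *\<^sub>R h t \<partial>lborel)"
      using i[of "{..<-X}"] i[of "{-X..X}"] i[of "{X<..}"] unfolding set_integrable_def by simp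
    also have "(\<integral>t. indicator {-X..X} t *\<^sub>R h t \<partial>lborel) = integral {-X..X} h"
      using set_borel_integral_eq_integral(2)[OF i[of "{-X..X}"]] by (simp add: set_lebesgue_integral_def)
    finally show ?thesis .
  qed
  have "(\<integral>t. f t \<partial>lborel) = (\<integral>t. indicator {..<-(T + d)} t *\<^sub>R f t \<partial>lborel) + integral {-(T + d)..T + d} f
      + (\<integral>t. indicator {T + d<..} t *\<^sub>R f t \<partial>lborel)"
    using int T d by (intro split) (auto simp: f_def)
  also have "(\<integral>t. indicator {..<-(T + d)} t *\<^sub>R f t \<partial>lborel) = (\<integral>t. indicator {..<-T} t *\<^sub>R f' t \<partial>lborel)"
  proof -
    have "(\<integral>t. indicator {..<-(T + d)} t *\<^sub>R f t \<partial>lborel) = (\<integral>t. indicator {..<-T} (d + 1 * t) *\<^sub>R f' (d + 1 * t) \<partial>lborel)"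
      using T d cpath_shift_neg[of _ T d L]
      by (intro Bochner_Integration.integral_cong) (auto simp: indicator_def f_def f'_def add.commute)
    then show ?thesis using lborel_integral_real_affine[of 1 "\<lambda>t. indicator {..<-T} t *\<^sub>R f' t" d] by simp
  qed
  also have "(\<integral>t. indicator {T + d<..} t *\<^sub>R f t \<partial>lborel) = (\<integral>t. indicator {T<..} t *\<^sub>R f' t \<partial>lborel)"
  proof -
    have "(\<integral>t. indicator {T + d<..} t *\<^sub>R f t \<partial>lborel) = (\<integral>t. indicator {T<..} (- d + 1 * t) *\<^sub>R f' (- d + 1 * t) \<partial>lborel)"
      using T d cpath_shift_pos[of T d _ L]
      by (intro Bochner_Integration.integral_cong) (auto simp: indicator_def f_def f'_def)
    then show ?thesis using lborel_integral_real_affine[of 1 "\<lambda>t. indicator {T<..} t *\<^sub>R f' t" "- d"] by simp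
  qed
  also have "integral {-(T + d)..T + d} f = integral {-T..T} f'"
    using integral_unique[OF mid] integral_unique[OF mid'] unfolding ends by simp
  also have "(\<integral>t. indicator {..<-T} t *\<^sub>R f' t \<partial>lborel) + integral {-T..T} f'
      + (\<integral>t. indicator {T<..} t *\<^sub>R f' t \<partial>lborel) = (\<integral>t. f' t \<partial>lborel)"
    using int' T by (intro split[symmetric]) (auto simp: f'_def)
  finally show ?thesis by (simp add: f_def f'_def)
qed

text \<open>The sign \<open>e\<close> selects the upper or the lower quarter plane.\<close>

lemma quarter_plane_primitive:
  fixes g :: "complex \<Rightarrow> complex" and \<phi> :: "real \<Rightarrow> real"
  assumes e: "e = 1 \<or> e = - 1" and mu: "\<mu> > 0"
    and fd: "\<And>z. Re z \<le> 0 \<Longrightarrow> e * Im z \<ge> T \<Longrightarrow> g field_differentiable at z"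
    and bound: "\<And>z. Re z \<le> 0 \<Longrightarrow> e * Im z \<ge> T \<Longrightarrow> norm (g z) \<le> \<phi> (e * Im z) * exp (\<mu> * Re z)"
    and phi: "\<And>y. y \<ge> T \<Longrightarrow> \<phi> y \<le> \<Phi>"
  obtains G where "\<And>z. z \<in> {z. Re z \<le> 0 \<and> e * Im z \<ge> T} \<Longrightarrow>
      (G has_field_derivative g z) (at z within {z. Re z \<le> 0 \<and> e * Im z \<ge> T})"
    "\<And>x y. x \<ge> 0 \<Longrightarrow> y \<ge> T \<Longrightarrow> norm (G (\<i> * of_real (e * y)) - G (of_real (- x) + \<i> * of_real (e * T))) \<le>
       \<phi> y / \<mu> + \<Phi> * exp (- \<mu> * x) * (y - T)"
proof -
  define S where "S = {z. Re z \<le> 0 \<and> e * Im z \<ge> T}"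
  have S_eq: "S = {z. Re z \<le> 0} \<inter> (if e = 1 then {z. Im z \<ge> T} else {z. Im z \<le> - T})"
    using e by (auto simp: S_def)
  have "convex S" unfolding S_eq
    by (auto intro!: convex_Int convex_halfspace_Re_le convex_halfspace_Im_ge convex_halfspace_Im_le)
  have fdS: "g field_differentiable at z" if "z \<in> S" for z using fd that by (auto simp: S_def)
  then have "continuous_on S g"
    by (intro continuous_at_imp_continuous_on ballI field_differentiable_imp_continuous_at)
  then obtain G where G: "\<And>z. z \<in> S \<Longrightarrow> (G has_field_derivative g z) (at z within S)"
    using holomorphic_convex_primitive[OF \<open>convex S\<close>, of "{}" g] fdS interior_subset by blast
  have ee: "e * (e * y) = y" for y using e by auto
  have abse: "\<bar>e\<bar> = 1" using e by auto
  \<comment> \<open>Nonnegativity of \<phi> is forced by \<open>bound\<close> at points of the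
    imaginary axis.\<close>
  have phi0: "\<phi> y \<ge> 0" if "y \<ge> T" for y
    using bound[of "\<i> * of_real (e * y)"] that order_trans[OF norm_ge_zero] by (auto simp: ee)
  show ?thesis
  proof (rule that[of G])
    show "(G has_field_derivative g z) (at z within {z. Re z \<le> 0 \<and> e * Im z \<ge> T})"
      if "z \<in> {z. Re z \<le> 0 \<and> e * Im z \<ge> T}" for z
      using G that by (simp add: S_def)
    fix x y :: real assume x: "x \<ge> 0" and y: "y \<ge> T"
    \<comment> \<open>From the axis at height y go left to Re = -x, then vertically to height T. The
      horizontal leg costs at most \<phi> y / \<mu> by integrating the exponential, the vertical one
      at most its length y - T times \<Phi> e^(-\<mu> x).\<close>
    define p where "p = (\<lambda>u :: real. - of_real u + \<i> * of_real (e * y))"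
    have "((\<lambda>u. g (p u) * (- 1)) has_integral (G (p x) - G (p 0))) {0..x}"
      by (rule path_integral_primitive[OF G, where F = "{}"])
        (use x y in \<open>auto simp: p_def S_def ee intro!: continuous_intros derivative_eq_intros\<close>)
    then have i1: "G (p x) - G (p 0) = integral {0..x} (\<lambda>u. g (p u) * (- 1))" "(\<lambda>u. g (p u) * (- 1)) integrable_on {0..x}"
      by (simp_all only: integral_unique has_integral_integrable)
    have i2: "((\<lambda>u. \<phi> y * exp (- \<mu> * u)) has_integral (\<phi> y * (- exp (- \<mu> * x) / \<mu>) - \<phi> y * (- exp (- \<mu> * 0) / \<mu>))) {0..x}"
      using mu by (intro fundamental_theorem_of_calculus x)
        (auto intro!: derivative_eq_intros simp flip: has_real_derivative_iff_has_vector_derivative)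
    have "norm (G (p x) - G (p 0)) \<le> integral {0..x} (\<lambda>u. \<phi> y * exp (- \<mu> * u))"
      unfolding i1(1)
    proof (rule integral_norm_bound_integral[OF i1(2)])
      show "(\<lambda>u. \<phi> y * exp (- \<mu> * u)) integrable_on {0..x}" using i2 by (rule has_integral_integrable)
      fix u assume "u \<in> {0..x}"
      then show "norm (g (p u) * (- 1)) \<le> \<phi> y * exp (- \<mu> * u)"
        using bound[of "p u"] y by (simp add: p_def ee)
    qed
    also have "\<dots> = \<phi> y / \<mu> - \<phi> y * exp (- \<mu> * x) / \<mu>"
      using integral_unique[OF i2] by simp
    also have "\<dots> \<le> \<phi> y / \<mu>" using phi0[OF y] mu by simp
    finally have A: "norm (G (p x) - G (p 0)) \<le> \<phi> y / \<mu>" .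
    define R where "R = S \<inter> {z. Re z = - x}"
    have "{z. Re z = - x} = {z. Re z \<le> - x} \<inter> {z. Re z \<ge> - x}" by auto
    then have "convex R" unfolding R_def
      by (auto intro!: convex_Int \<open>convex S\<close> convex_halfspace_Re_le convex_halfspace_Re_ge)
    have "norm (G (p x) - G (of_real (- x) + \<i> * of_real (e * T))) \<le>
        (\<Phi> * exp (- \<mu> * x)) * norm (p x - (of_real (- x) + \<i> * of_real (e * T)))"
    proof (rule field_differentiable_bound[OF \<open>convex R\<close>])
      fix z assume z: "z \<in> R"
      show "(G has_field_derivative g z) (at z within R)"
        by (rule has_field_derivative_subset[OF G]) (use z in \<open>auto simp: R_def\<close>)
      have "norm (g z) \<le> \<phi> (e * Im z) * exp (\<mu> * Re z)" by (rule bound) (use z in \<open>auto simp: R_def S_def\<close>)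
      also have "\<dots> \<le> \<Phi> * exp (- \<mu> * x)" using z phi by (auto simp: R_def S_def)
      finally show "norm (g z) \<le> \<Phi> * exp (- \<mu> * x)" .
    qed (use x y in \<open>auto simp: R_def S_def p_def ee\<close>)
    also have "norm (p x - (of_real (- x) + \<i> * of_real (e * T))) = y - T"
    proof -
      have "p x - (of_real (- x) + \<i> * of_real (e * T)) = \<i> * of_real (e * (y - T))"
        by (simp add: p_def algebra_simps)
      also have "norm \<dots> = \<bar>e * (y - T)\<bar>" by (simp only: norm_mult norm_ii norm_of_real mult_1_left)
      finally show ?thesis using y by (simp add: abs_mult abse)
    qed
    finally have B: "norm (G (p x) - G (of_real (- x) + \<i> * of_real (e * T))) \<le> \<Phi> * exp (- \<mu> * x) * (y - T)" .
    have "p 0 = \<i> * of_real (e * y)" by (simp add: p_def)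
    then show "norm (G (\<i> * of_real (e * y)) - G (of_real (- x) + \<i> * of_real (e * T))) \<le>
       \<phi> y / \<mu> + \<Phi> * exp (- \<mu> * x) * (y - T)"
      using A B norm_triangle_le[of "G (p 0) - G (p x)" "G (p x) - G (of_real (- x) + \<i> * of_real (e * T))"
        "\<phi> y / \<mu> + \<Phi> * exp (- \<mu> * x) * (y - T)"]
      by (simp add: norm_minus_commute)
  qed
qed

text \<open>Both contours share the middle segment, where continuity is enough. Beyond it, truncated
  integrals are differences of the primitives of \<open>quarter_plane_primitive\<close>, and the
  estimate there compares their end points. Only \<phi> -> 0 is required, not integrability of
  \<phi>, so the line integral may converge conditionally.\<close>

lemma line_integral_eq_cpath_integral:
  fixes g :: "complex \<Rightarrow> complex" and \<phi> :: "real \<Rightarrow> real"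
  assumes T: "T > 0" and mu: "\<mu> > 0"
    and fd: "\<And>z. Re z \<le> 0 \<Longrightarrow> \<bar>Im z\<bar> \<ge> T \<Longrightarrow> g field_differentiable at z"
    and cont: "continuous_on {-T..T} (\<lambda>t. g (\<i> * of_real t))"
    and bound: "\<And>z. Re z \<le> 0 \<Longrightarrow> \<bar>Im z\<bar> \<ge> T \<Longrightarrow> norm (g z) \<le> \<phi> \<bar>Im z\<bar> * exp (\<mu> * Re z)"
    and phi: "\<And>y. y \<ge> T \<Longrightarrow> \<phi> y \<le> \<Phi>" "(\<phi> \<longlongrightarrow> 0) at_top"
    and int: "integrable lborel (\<lambda>t. g (cpath 0 T t) * cweight T t)"
  shows "((\<lambda>t. g (\<i> * of_real t) * \<i>) has_integral (\<integral>t. g (cpath 0 T t) * cweight T t \<partial>lborel)) UNIV"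
proof -
  define f where "f = (\<lambda>t. g (cpath 0 T t) * cweight T t)"
  define h where "h = (\<lambda>t :: real. g (\<i> * of_real t) * \<i>)"
  define J where "J = (\<integral>t. f t \<partial>lborel)"
  have b1: "norm (g z) \<le> \<phi> (1 * Im z) * exp (\<mu> * Re z)" if "Re z \<le> 0" "1 * Im z \<ge> T" for z
    using bound[of z] that T by simp
  have b2: "norm (g z) \<le> \<phi> (- 1 * Im z) * exp (\<mu> * Re z)" if "Re z \<le> 0" "- 1 * Im z \<ge> T" for z
    using bound[of z] that T by simp
  obtain G1 where G1: "\<And>z. z \<in> {z. Re z \<le> 0 \<and> 1 * Im z \<ge> T} \<Longrightarrow>
      (G1 has_field_derivative g z) (at z within {z. Re z \<le> 0 \<and> 1 * Im z \<ge> T})"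
    "\<And>x y. x \<ge> 0 \<Longrightarrow> y \<ge> T \<Longrightarrow> norm (G1 (\<i> * of_real (1 * y)) - G1 (of_real (- x) + \<i> * of_real (1 * T))) \<le>
       \<phi> y / \<mu> + \<Phi> * exp (- \<mu> * x) * (y - T)"
    by (rule quarter_plane_primitive[of 1 \<mu> T g \<phi> \<Phi>, OF _ mu _ b1 phi(1)]) (use fd in auto)
  obtain G2 where G2: "\<And>z. z \<in> {z. Re z \<le> 0 \<and> - 1 * Im z \<ge> T} \<Longrightarrow>
      (G2 has_field_derivative g z) (at z within {z. Re z \<le> 0 \<and> - 1 * Im z \<ge> T})"
    "\<And>x y. x \<ge> 0 \<Longrightarrow> y \<ge> T \<Longrightarrow> norm (G2 (\<i> * of_real (- 1 * y)) - G2 (of_real (- x) + \<i> * of_real (- 1 * T))) \<le>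
       \<phi> y / \<mu> + \<Phi> * exp (- \<mu> * x) * (y - T)"
    by (rule quarter_plane_primitive[of "- 1" \<mu> T g \<phi> \<Phi>, OF _ mu _ b2 phi(1)]) (use fd in auto)
  define m where "m = integral {-T..T} h"
  have mh: "(h has_integral m) {-T..T}"
    unfolding m_def h_def by (intro integrable_integral integrable_continuous_real continuous_intros cont)
  have mf: "(f has_integral m) {-T..T}"
    by (rule has_integral_eq[OF _ mh]) (use T in \<open>auto simp: f_def h_def cpath_def cweight_def\<close>)
  have hi: "(h has_integral (G1 (\<i> * of_real y) - G1 (\<i> * of_real T))) {T..y}" if "y \<ge> T" for y
    unfolding h_def
    by (rule path_integral_primitive[OF G1(1), where F = "{}"])
      (use that in \<open>auto intro!: continuous_intros derivative_eq_intros\<close>)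
  have lo: "(h has_integral (G2 (- (\<i> * of_real T)) - G2 (- (\<i> * of_real y)))) {-y..-T}" if "y \<ge> T" for y
  proof -
    have "(h has_integral (G2 (\<i> * of_real (- T)) - G2 (\<i> * of_real (- y)))) {-y..-T}"
      unfolding h_def
      by (rule path_integral_primitive[OF G2(1), where F = "{}"])
        (use that in \<open>auto intro!: continuous_intros derivative_eq_intros\<close>)
    then show ?thesis by simp
  qed
  have h_box: "(h has_integral ((G2 (- (\<i> * of_real T)) - G2 (- (\<i> * of_real y'))) + m + (G1 (\<i> * of_real y) - G1 (\<i> * of_real T)))) {-y'..y}"
    if "y \<ge> T" "y' \<ge> T" for y y'
    using T that by (intro has_integral_combine[OF _ _ has_integral_combine[OF _ _ lo mh] hi]) auto
  have f_hi: "(f has_integral (G1 (of_real (- x) + \<i> * of_real T) - G1 (\<i> * of_real T))) {T..T + x}" if "x \<ge> 0" for x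
  proof -
    have "cpath 0 T (T + x) = of_real (- x) + \<i> * of_real T" "cpath 0 T T = \<i> * of_real T"
      using T that by (simp_all add: cpath_def)
    then show ?thesis
      using cpath_integral_primitive[OF G1(1), of T "T + x" T 0] that T unfolding f_def by simp
  qed
  have f_lo: "(f has_integral (G2 (- (\<i> * of_real T)) - G2 (of_real (- x) - \<i> * of_real T))) {- (T + x)..- T}" if "x \<ge> 0" for x
  proof -
    have "cpath 0 T (- (T + x)) = of_real (- x) - \<i> * of_real T" "cpath 0 T (- T) = - (\<i> * of_real T)"
      using T that by (simp_all add: cpath_def)
    then show ?thesis
      using cpath_integral_primitive[OF G2(1), of "- (T + x)" "- T" T 0] that T unfolding f_def by simp
  qed
  have f_box: "(f has_integral ((G2 (- (\<i> * of_real T)) - G2 (of_real (- x) - \<i> * of_real T)) + m +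
      (G1 (of_real (- x) + \<i> * of_real T) - G1 (\<i> * of_real T)))) {- (T + x)..T + x}" if "x \<ge> 0" for x
    using T that by (intro has_integral_combine[OF _ _ has_integral_combine[OF _ _ f_lo mf] f_hi]) auto
  have nbox: "\<not> (\<exists>a b. (UNIV :: real set) = cbox a b)"
    using bounded_cbox not_bounded_UNIV by metis
  \<comment> \<open>Over \<open>UNIV\<close> the integral is a limit over all intervals [a, b] that
    contain a large ball, so the two ends have to be handled independently.\<close>
  have "(h has_integral J) UNIV"
  proof (subst has_integral_alt, subst if_not_P[OF nbox], intro allI impI)
    fix \<epsilon> :: real assume eps: "\<epsilon> > 0"
    have "eventually (\<lambda>y. \<phi> y < \<epsilon> * \<mu> / 8) at_top"
      using phi(2) eps mu by (intro order_tendstoD(2)) auto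
    then obtain Y where Y: "\<And>y. y \<ge> Y \<Longrightarrow> \<phi> y < \<epsilon> * \<mu> / 8"
      by (auto simp: eventually_at_top_linorder)
    define B where "B = max (T + 1) Y"
    show "\<exists>B>0. \<forall>(a :: real) b. ball 0 B \<subseteq> cbox a b \<longrightarrow>
      (\<exists>z. ((\<lambda>x. if x \<in> UNIV then h x else 0) has_integral z) (cbox a b) \<and> norm (z - J) < \<epsilon>)"
    proof (intro exI[of _ B] conjI allI impI)
      show "B > 0" using T by (simp add: B_def)
      fix a b :: real assume "ball 0 B \<subseteq> cbox a b"
      then have "{-B<..<B} \<subseteq> {a..b}" by (auto simp: ball_eq_greaterThanLessThan)
      then have ab: "a \<le> - B" "B \<le> b" using \<open>B > 0\<close> by (auto simp: greaterThanLessThan_subseteq_atLeastAtMost_iff)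
      define y' where "y' = - a"
      have yy: "y' \<ge> T" "b \<ge> T" "y' \<ge> Y" "b \<ge> Y" "a = - y'" using ab by (auto simp: B_def y'_def)
      define z where "z = (G2 (- (\<i> * of_real T)) - G2 (- (\<i> * of_real y'))) + m + (G1 (\<i> * of_real b) - G1 (\<i> * of_real T))"
      \<comment> \<open>The abscissa -x is chosen after a and b, because e^(-\<mu> x) has to beat
        the lengths b - T and y' - T of the vertical legs.\<close>
      have "((\<lambda>x. exp (- \<mu> * x)) \<longlongrightarrow> 0) at_top"
        using mu by (intro filterlim_compose[OF exp_at_bot] filterlim_tendsto_neg_mult_at_bot[OF tendsto_const _ filterlim_ident]) simp
      then have "((\<lambda>x. \<Phi> * exp (- \<mu> * x) * (b - T) + \<Phi> * exp (- \<mu> * x) * (y' - T)) \<longlongrightarrow> \<Phi> * 0 * (b - T) + \<Phi> * 0 * (y' - T)) at_top"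
        by (intro tendsto_intros)
      then have "eventually (\<lambda>x. \<Phi> * exp (- \<mu> * x) * (b - T) + \<Phi> * exp (- \<mu> * x) * (y' - T) < \<epsilon> / 4) at_top"
        using eps by (intro order_tendstoD(2)) auto
      then obtain X where X: "\<And>x. x \<ge> X \<Longrightarrow> \<Phi> * exp (- \<mu> * x) * (b - T) + \<Phi> * exp (- \<mu> * x) * (y' - T) < \<epsilon> / 4"
        by (auto simp: eventually_at_top_linorder)
      have "(f has_integral J) UNIV" unfolding J_def by (rule has_integral_integral_lborel) (use int in \<open>simp add: f_def\<close>)
      then obtain B1 where B1: "B1 > 0" "\<And>a b. ball 0 B1 \<subseteq> cbox a b \<Longrightarrow>
         \<exists>z. ((\<lambda>x. if x \<in> UNIV then f x else 0) has_integral z) (cbox a b) \<and> norm (z - J) < \<epsilon> / 4"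
        using eps has_integral_altD[OF _ nbox, of f J "\<epsilon> / 4"] by (metis zero_less_divide_iff zero_less_numeral)
      define x where "x = max X (max 0 B1)"
      have x: "x \<ge> X" "x \<ge> 0" "x \<ge> B1" by (auto simp: x_def)
      have "ball 0 B1 \<subseteq> cbox (- (T + x)) (T + x)" using x T by (auto simp: dist_norm abs_less_iff)
      from B1(2)[OF this] obtain w where w: "(f has_integral w) {- (T + x)..T + x}" "norm (w - J) < \<epsilon> / 4" by auto
      have weq: "w = (G2 (- (\<i> * of_real T)) - G2 (of_real (- x) - \<i> * of_real T)) + m +
         (G1 (of_real (- x) + \<i> * of_real T) - G1 (\<i> * of_real T))"
        using has_integral_unique[OF w(1) f_box[OF x(2)]] .
      have "norm (z - w) = norm ((G1 (\<i> * of_real b) - G1 (of_real (- x) + \<i> * of_real T)) -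
         (G2 (- (\<i> * of_real y')) - G2 (of_real (- x) - \<i> * of_real T)))"
        unfolding z_def weq by (simp add: algebra_simps)
      also have "\<dots> \<le> norm (G1 (\<i> * of_real b) - G1 (of_real (- x) + \<i> * of_real T)) +
         norm (G2 (- (\<i> * of_real y')) - G2 (of_real (- x) - \<i> * of_real T))"
        by (rule norm_triangle_ineq4)
      also have "\<dots> \<le> (\<phi> b / \<mu> + \<Phi> * exp (- \<mu> * x) * (b - T)) + (\<phi> y' / \<mu> + \<Phi> * exp (- \<mu> * x) * (y' - T))"
        using G1(2)[OF x(2) yy(2)] G2(2)[OF x(2) yy(1)] by (intro add_mono) simp_all
      also have "\<dots> < \<epsilon> / 8 + \<epsilon> / 8 + \<epsilon> / 4"
      proof -
        have "\<phi> b / \<mu> < \<epsilon> / 8" "\<phi> y' / \<mu> < \<epsilon> / 8" using Y[OF yy(4)] Y[OF yy(3)] mu by (simp_all add: field_simps)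
        then show ?thesis using X[OF x(1)] by linarith
      qed
      finally have "norm (z - w) < \<epsilon> / 2" by simp
      then have "norm (z - J) < \<epsilon>"
        using w(2) eps norm_triangle_ineq[of "z - w" "w - J"] by simp
      moreover have "(h has_integral z) {a..b}" unfolding yy(5) z_def by (rule h_box[OF yy(2,1)])
      ultimately show "\<exists>z. ((\<lambda>x. if x \<in> UNIV then h x else 0) has_integral z) (cbox a b) \<and> norm (z - J) < \<epsilon>"
        by auto
    qed
  qed
  then show ?thesis by (simp add: h_def J_def f_def)
qed

section \<open>Integration over a family of lines\<close>

lemma integrable_exp_minus_abs:
  assumes "\<mu> > 0"
  shows "integrable lborel (\<lambda>t :: real. exp (- \<mu> * \<bar>t\<bar>))"
proof -
  have "(\<lambda>t. exp (- \<mu> * t)) absolutely_integrable_on {0..}"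
    using assms by (intro nonnegative_absolutely_integrable_1 integrable_on_exp_minus_to_infinity) auto
  then have "integrable lebesgue (\<lambda>t. indicator {0..} t *\<^sub>R exp (- \<mu> * t))"
    unfolding set_integrable_def .
  then have i: "integrable lborel (\<lambda>t. indicator {0..} t *\<^sub>R exp (- \<mu> * t))"
    by (subst (asm) integrable_completion) auto
  have i': "integrable lborel (\<lambda>t. indicator {0..} (0 + - 1 * t) *\<^sub>R exp (- \<mu> * (0 + - 1 * t)))"
    by (rule lborel_integrable_real_affine[OF i]) simp
  show ?thesis
    by (rule Bochner_Integration.integrable_bound[OF Bochner_Integration.integrable_add[OF i i']])
      (auto simp: indicator_def abs_if intro!: AE_I2)
qed

lemma summable_on_exp_minus_abs_int:
  assumes "\<mu> > 0"
  shows "(\<lambda>k :: int. exp (- \<mu> * \<bar>real_of_int k\<bar>)) summable_on UNIV"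
proof -
  have "summable (\<lambda>n. exp (- \<mu>) ^ n)" using assms by (intro summable_geometric) simp
  then have s: "(\<lambda>n :: nat. exp (- \<mu>) ^ n) summable_on UNIV"
    by (intro norm_summable_imp_summable_on) simp
  have eq: "exp (- (\<mu> * real n)) = exp (- \<mu>) ^ n" for n by (simp add: exp_of_nat_mult[symmetric] mult.commute)
  have "(\<lambda>k :: int. exp (- \<mu> * \<bar>real_of_int k\<bar>)) summable_on (range int)"
    by (subst summable_on_reindex) (use s in \<open>auto simp: o_def eq\<close>)
  moreover have "(\<lambda>k :: int. exp (- \<mu> * \<bar>real_of_int k\<bar>)) summable_on (range (\<lambda>n. - int n))"
    by (subst summable_on_reindex) (use s in \<open>auto simp: o_def eq inj_on_def\<close>)
  ultimately have "(\<lambda>k :: int. exp (- \<mu> * \<bar>real_of_int k\<bar>)) summable_on (range int \<union> range (\<lambda>n. - int n))"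
    by (rule summable_on_union)
  moreover have "range int \<union> range (\<lambda>n. - int n) = UNIV"
    by (auto simp: image_iff) (metis int_cases2)
  ultimately show ?thesis by simp
qed

text \<open>Absorbs the polynomial weight of \<open>mellin_dom\<close> into an exponential; 1 + 4 x
  is the form in which that weight gets bounded on the contours. The N-th root reduces the claim to
  1 + \<nu> x <= e^(\<nu> x).\<close>

lemma power_le_exp:
  fixes \<mu> :: real
  assumes "\<mu> > 0"
  obtains D where "D > 0" "\<And>x. x \<ge> 0 \<Longrightarrow> (1 + 4 * x) ^ N \<le> D * exp (\<mu> * x)"
proof -
  define \<nu> where "\<nu> = \<mu> / (real N + 1)"
  have nu: "\<nu> > 0" using assms by (simp add: \<nu>_def)
  define m where "m = min 1 (\<nu> / 4)"
  have m: "m > 0" "m \<le> 1" "4 * m \<le> \<nu>" using nu by (auto simp: m_def)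
  show ?thesis
  proof (rule that[of "(1 / m) ^ N"])
    show "(1 / m) ^ N > 0" using m by simp
    fix x :: real assume x: "x \<ge> 0"
    have "m * (1 + 4 * x) \<le> 1 + \<nu> * x"
      using m x mult_right_mono[OF m(3) x] by (simp add: algebra_simps)
    also have "\<dots> \<le> exp (\<nu> * x)" by (rule exp_ge_add_one_self)
    finally have "1 + 4 * x \<le> 1 / m * exp (\<nu> * x)" using m by (simp add: field_simps)
    then have "(1 + 4 * x) ^ N \<le> (1 / m * exp (\<nu> * x)) ^ N" using x by (intro power_mono) auto
    also have "\<dots> = (1 / m) ^ N * exp (real N * (\<nu> * x))" by (simp only: power_mult_distrib exp_of_nat_mult)
    also have "\<dots> \<le> (1 / m) ^ N * exp (\<mu> * x)"
    proof -
      have "real N * \<nu> \<le> \<mu>" using assms by (simp add: \<nu>_def field_simps)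
      then have "real N * \<nu> * x \<le> \<mu> * x" using x by (rule mult_right_mono)
      then show ?thesis using m by (intro mult_left_mono) (auto simp: mult.assoc)
    qed
    finally show "(1 + 4 * x) ^ N \<le> (1 / m) ^ N * exp (\<mu> * x)" .
  qed
qed

lemma cpath_integrable:
  fixes g :: "complex \<Rightarrow> complex"
  assumes cont: "continuous_on UNIV (\<lambda>t. g (cpath L T t))" and mu: "\<mu> > 0" and T: "T > 0"
    and bound: "\<And>t. \<bar>t\<bar> \<ge> T \<Longrightarrow> norm (g (cpath L T t)) \<le> D * exp (- \<mu> * \<bar>t\<bar>)"
  shows "integrable lborel (\<lambda>t. g (cpath L T t) * cweight T t)"
proof -
  have "compact ((\<lambda>t. g (cpath L T t)) ` {-T..T})"
    by (intro compact_continuous_image continuous_on_subset[OF cont]) auto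
  then obtain E where E: "\<And>t. t \<in> {-T..T} \<Longrightarrow> norm (g (cpath L T t)) \<le> E"
    using compact_imp_bounded by (metis (no_types, lifting) bounded_iff imageI)
  define F where "F = max D (E * exp (\<mu> * T))"
  have "norm (g (cpath L T t)) \<le> F * exp (- \<mu> * \<bar>t\<bar>)" for t
  proof (cases "\<bar>t\<bar> \<ge> T")
    case True
    have "D * exp (- \<mu> * \<bar>t\<bar>) \<le> F * exp (- \<mu> * \<bar>t\<bar>)" by (intro mult_right_mono) (auto simp: F_def)
    then show ?thesis using bound[OF True] by linarith
  next
    case False
    then have e: "norm (g (cpath L T t)) \<le> E" by (intro E) auto
    then have "E \<ge> 0" using norm_ge_zero order_trans by blast
    have "1 \<le> exp (\<mu> * T) * exp (- \<mu> * \<bar>t\<bar>)"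
      using False mu by (simp flip: exp_add)
    then have "E \<le> E * (exp (\<mu> * T) * exp (- \<mu> * \<bar>t\<bar>))" using \<open>E \<ge> 0\<close> by (simp add: mult_le_cancel_left1)
    also have "\<dots> \<le> F * exp (- \<mu> * \<bar>t\<bar>)"
      unfolding mult.assoc[symmetric] by (intro mult_right_mono) (auto simp: F_def)
    finally show ?thesis using e by linarith
  qed note le = this
  have i: "integrable lborel (\<lambda>t. F * exp (- \<mu> * \<bar>t\<bar>))"
    by (intro integrable_mult_right integrable_exp_minus_abs[OF mu])
  have [measurable]: "(\<lambda>t. g (cpath L T t)) \<in> borel_measurable borel"
    by (rule borel_measurable_continuous_onI[OF cont])
  show ?thesis
    by (rule Bochner_Integration.integrable_bound[OF i])
      (use le in \<open>auto simp: norm_mult intro!: AE_I2 order_trans[OF le]\<close>)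
qed

text \<open>Counting measure in k times Lebesgue measure in the contour parameter: one
  differentiation under the integral then covers the sum over k as well.\<close>

definition kline :: "(int \<times> real) measure" where
  "kline = count_space UNIV \<Otimes>\<^sub>M lborel"

interpretation kline: pair_sigma_finite "count_space UNIV :: int measure" "lborel :: real measure"
  unfolding pair_sigma_finite_def
  by (simp add: sigma_finite_measure_count_space sigma_finite_lborel)

lemma space_kline [simp]: "space kline = UNIV"
  by (simp add: kline_def space_pair_measure)

lemma measurable_kline:
  assumes "\<And>k. (\<lambda>t. f (k, t)) \<in> borel_measurable borel"
  shows "f \<in> borel_measurable kline"
  unfolding kline_def by (rule measurable_pair_measure_countable1) (use assms in auto)

lemma integrable_kline_slice:
  fixes f :: "int \<times> real \<Rightarrow> complex"
  assumes "integrable kline f"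
  shows "integrable lborel (\<lambda>t. f (k, t))"
  using kline.AE_integrable_fst'[OF assms[unfolded kline_def]] by (simp add: AE_count_space)

text \<open>Fubini gives absolute summability in k, hence the unordered summation in which
  \<open>G_C\<close> is defined.\<close>

lemma integral_kline:
  fixes f :: "int \<times> real \<Rightarrow> complex"
  assumes "integrable kline f"
  shows "((\<lambda>k. \<integral>t. f (k, t) \<partial>lborel) has_sum (\<integral>x. f x \<partial>kline)) UNIV"
proof -
  have abs: "Infinite_Set_Sum.abs_summable_on (\<lambda>k. \<integral>t. f (k, t) \<partial>lborel) UNIV"
    using kline.integrable_fst'[OF assms[unfolded kline_def]] by (simp add: abs_summable_on_def)
  have "infsetsum (\<lambda>k. \<integral>t. f (k, t) \<partial>lborel) UNIV = (\<integral>x. f x \<partial>kline)"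
    unfolding infsetsum_def kline_def by (rule kline.integral_fst'[OF assms[unfolded kline_def]])
  then show ?thesis
    using infsetsum_infsum[OF abs] abs_summable_summable[OF abs[folded abs_summable_equivalent]]
    by (metis has_sum_infsum)
qed

lemma integrable_kline_exp:
  assumes "\<mu> > 0"
  shows "integrable kline (\<lambda>(k, t). exp (- \<mu> * (\<bar>real_of_int k\<bar> + \<bar>t\<bar>)))"
  unfolding kline_def
proof (rule kline.Fubini_integrable)
  have eq: "exp (- (\<mu> * (\<bar>real_of_int k\<bar> + \<bar>t\<bar>))) = exp (- (\<mu> * \<bar>real_of_int k\<bar>)) * exp (- (\<mu> * \<bar>t\<bar>))" for k t
    by (simp add: algebra_simps flip: exp_add)
  show "(\<lambda>(k, t). exp (- \<mu> * (\<bar>real_of_int k\<bar> + \<bar>t\<bar>))) \<in> borel_measurable (count_space UNIV \<Otimes>\<^sub>M lborel)"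
    by (rule measurable_pair_measure_countable1) auto
  show "integrable (count_space UNIV) (\<lambda>k :: int. \<integral>t. norm (case (k, t) of (k, t) \<Rightarrow> exp (- \<mu> * (\<bar>real_of_int k\<bar> + \<bar>t\<bar>))) \<partial>lborel)"
  proof -
    have "Infinite_Set_Sum.abs_summable_on (\<lambda>k :: int. exp (- \<mu> * \<bar>real_of_int k\<bar>)) UNIV"
      using summable_on_exp_minus_abs_int[OF assms] by (simp flip: abs_summable_equivalent)
    then have "integrable (count_space UNIV) (\<lambda>k :: int. exp (- \<mu> * \<bar>real_of_int k\<bar>))"
      by (simp add: abs_summable_on_def)
    then show ?thesis by (simp add: eq)
  qed
  show "AE k in count_space UNIV. integrable lborel (\<lambda>t. case (k :: int, t) of (k, t) \<Rightarrow> exp (- \<mu> * (\<bar>real_of_int k\<bar> + \<bar>t\<bar>)))"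
    using integrable_exp_minus_abs[OF assms] by (simp add: eq AE_count_space)
qed

lemma has_integral_reflect_UNIV:
  fixes f :: "real \<Rightarrow> complex"
  assumes "(f has_integral I) UNIV"
  shows "((\<lambda>t. f (- t)) has_integral I) UNIV"
proof -
  have nbox: "\<not> (\<exists>a b. (UNIV :: real set) = cbox a b)"
    using bounded_cbox not_bounded_UNIV by metis
  show ?thesis
  proof (subst has_integral_alt, subst if_not_P[OF nbox], intro allI impI)
    fix e :: real assume "e > 0"
    with has_integral_altD[OF assms nbox] obtain B where B: "B > 0"
      "\<And>a b. ball 0 B \<subseteq> cbox a b \<Longrightarrow> \<exists>z. ((\<lambda>x. if x \<in> UNIV then f x else 0) has_integral z) (cbox a b) \<and> norm (z - I) < e"
      by metis
    have "\<exists>z. ((\<lambda>x. if x \<in> UNIV then f (- x) else 0) has_integral z) (cbox a b) \<and> norm (z - I) < e"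
      if "ball 0 B \<subseteq> cbox a b" for a b :: real
    proof -
      have "ball 0 B \<subseteq> cbox (- b) (- a)"
      proof
        fix x :: real assume "x \<in> ball 0 B"
        then have "- x \<in> ball 0 B" by simp
        then have "- x \<in> cbox a b" using that by blast
        then show "x \<in> cbox (- b) (- a)" by auto
      qed
      from B(2)[OF this] obtain z where "(f has_integral z) {- b..- a}" "norm (z - I) < e" by auto
      then show ?thesis using has_integral_reflect_real[of f z "- a" "- b"] by auto
    qed
    then show "\<exists>B>0. \<forall>(a :: real) b. ball 0 B \<subseteq> cbox a b \<longrightarrow>
        (\<exists>z. ((\<lambda>x. if x \<in> UNIV then f (- x) else 0) has_integral z) (cbox a b) \<and> norm (z - I) < e)"
      using B(1) by blast
  qed
qed

section \<open>The deformed contours\<close>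

text \<open>The kernel with all \<open>a\<close> raised by 1 is the common form of both terms of the
  equation for \<open>D_op\<close>: this is the term with the a-factors,
  \<open>K_shift_right\<close> treats the one with the b-factors. The primed versions raise
  \<open>a'\<close> and serve \<open>Dbar_op\<close>.\<close>

lemma K_C_shift_left:
  assumes "\<And>\<alpha>. \<alpha> \<in> {1..q} \<Longrightarrow> (a \<alpha>, a' \<alpha>) \<in> Lambda_C"
    and pf: "K_pole_free p q a a' b b' k \<sigma>"
  shows "K_C p q a a' b b' k \<sigma> * (\<Prod>\<alpha>=1..q. a \<alpha> + (of_int k + \<sigma>) / 2) = K_C p q (\<lambda>\<alpha>. a \<alpha> + 1) a' b b' k \<sigma>"
proof -
  have "Gamma_C (a \<alpha> + 1 + (of_int k + \<sigma>) / 2) (a' \<alpha> + (- of_int k + \<sigma>) / 2) =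
     (a \<alpha> + (of_int k + \<sigma>) / 2) * Gamma_C (a \<alpha> + (of_int k + \<sigma>) / 2) (a' \<alpha> + (- of_int k + \<sigma>) / 2)"
    if "\<alpha> \<in> {1..q}" for \<alpha>
  proof -
    have "(a \<alpha> + (of_int k + \<sigma>) / 2) - (a' \<alpha> + (- of_int k + \<sigma>) / 2) = (a \<alpha> - a' \<alpha>) + of_int k" by (simp add: field_simps)
    also have "\<dots> \<in> \<int>" using assms(1)[OF that] by (auto simp: Lambda_C_def)
    finally show ?thesis
      using Gamma_C_plus1_left[of "a \<alpha> + (of_int k + \<sigma>) / 2" "a' \<alpha> + (- of_int k + \<sigma>) / 2"] pf that
      by (auto simp: K_pole_free_def add_ac)
  qed
  then have "(\<Prod>\<alpha>=1..q. Gamma_C (a \<alpha> + 1 + (of_int k + \<sigma>) / 2) (a' \<alpha> + (- of_int k + \<sigma>) / 2)) =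
    (\<Prod>\<alpha>=1..q. (a \<alpha> + (of_int k + \<sigma>) / 2) * Gamma_C (a \<alpha> + (of_int k + \<sigma>) / 2) (a' \<alpha> + (- of_int k + \<sigma>) / 2))"
    by (rule prod.cong[OF refl])
  then show ?thesis unfolding K_C_def prod.distrib by (simp only: mult_ac)
qed

lemma K_C_shift_left':
  assumes "\<And>\<alpha>. \<alpha> \<in> {1..q} \<Longrightarrow> (a \<alpha>, a' \<alpha>) \<in> Lambda_C"
    and pf: "K_pole_free p q a a' b b' k \<sigma>"
  shows "K_C p q a a' b b' k \<sigma> * (\<Prod>\<alpha>=1..q. - (a' \<alpha> + (- of_int k + \<sigma>) / 2)) = K_C p q a (\<lambda>\<alpha>. a' \<alpha> + 1) b b' k \<sigma>"
proof -
  have "Gamma_C (a \<alpha> + (of_int k + \<sigma>) / 2) (a' \<alpha> + 1 + (- of_int k + \<sigma>) / 2) =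
     - (a' \<alpha> + (- of_int k + \<sigma>) / 2) * Gamma_C (a \<alpha> + (of_int k + \<sigma>) / 2) (a' \<alpha> + (- of_int k + \<sigma>) / 2)"
    if "\<alpha> \<in> {1..q}" for \<alpha>
  proof -
    have "(a \<alpha> + (of_int k + \<sigma>) / 2) - (a' \<alpha> + (- of_int k + \<sigma>) / 2) = (a \<alpha> - a' \<alpha>) + of_int k" by (simp add: field_simps)
    also have "\<dots> \<in> \<int>" using assms(1)[OF that] by (auto simp: Lambda_C_def)
    finally show ?thesis
      using Gamma_C_plus1_right[of "a \<alpha> + (of_int k + \<sigma>) / 2" "a' \<alpha> + (- of_int k + \<sigma>) / 2"] pf that
      by (auto simp: K_pole_free_def add_ac)
  qed
  then have "(\<Prod>\<alpha>=1..q. Gamma_C (a \<alpha> + (of_int k + \<sigma>) / 2) (a' \<alpha> + 1 + (- of_int k + \<sigma>) / 2)) =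
    (\<Prod>\<alpha>=1..q. - (a' \<alpha> + (- of_int k + \<sigma>) / 2) * Gamma_C (a \<alpha> + (of_int k + \<sigma>) / 2) (a' \<alpha> + (- of_int k + \<sigma>) / 2))"
    by (rule prod.cong[OF refl])
  then show ?thesis unfolding K_C_def prod.distrib by (simp only: mult_ac)
qed

context mb_kernel
begin

text \<open>Passing from (k, \<sigma>) to (k + 1, \<sigma> + 1) changes only the first components:
  it raises those of the a-factors by 1 and lowers those of the b-factors by 1. Re \<sigma> <= -1
  keeps \<sigma> + 1 in the half plane without b-poles.\<close>

lemma K_shift_right:
  assumes "Re \<sigma> \<le> - 1"
  shows "K (k + 1) (\<sigma> + 1) * (\<Prod>\<beta>=1..p. b \<beta> + (- of_int (k + 1) - (\<sigma> + 1)) / 2) = K_C p q (\<lambda>\<alpha>. a \<alpha> + 1) a' b b' k \<sigma>"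
proof -
  have "Gamma_C (b \<beta> + (- of_int k - \<sigma>) / 2) (b' \<beta> + (of_int k - \<sigma>) / 2) =
     (b \<beta> + (- of_int (k + 1) - (\<sigma> + 1)) / 2) *
     Gamma_C (b \<beta> + (- of_int (k + 1) - (\<sigma> + 1)) / 2) (b' \<beta> + (of_int (k + 1) - (\<sigma> + 1)) / 2)"
    if "\<beta> \<in> {1..p}" for \<beta>
  proof -
    let ?S = "b \<beta> + (- of_int (k + 1) - (\<sigma> + 1)) / 2" and ?S' = "b' \<beta> + (of_int (k + 1) - (\<sigma> + 1)) / 2"
    have "?S - ?S' = (b \<beta> - b' \<beta>) - of_int (k + 1)" by (simp add: field_simps)
    also have "\<dots> \<in> \<int>" using Lb[OF that] by (auto simp: Lambda_C_def intro!: Ints_diff)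
    finally have "Gamma_C (?S + 1) ?S' = ?S * Gamma_C ?S ?S'"
      using b_not_Gamma_C_pole[of "\<sigma> + 1" \<beta> "k + 1"] assms that by (intro Gamma_C_plus1_left) auto
    moreover have "?S + 1 = b \<beta> + (- of_int k - \<sigma>) / 2" "?S' = b' \<beta> + (of_int k - \<sigma>) / 2" by (simp_all add: field_simps)
    ultimately show ?thesis by metis
  qed
  then have B: "(\<Prod>\<beta>=1..p. Gamma_C (b \<beta> + (- of_int k - \<sigma>) / 2) (b' \<beta> + (of_int k - \<sigma>) / 2)) =
    (\<Prod>\<beta>=1..p. (b \<beta> + (- of_int (k + 1) - (\<sigma> + 1)) / 2) *
     Gamma_C (b \<beta> + (- of_int (k + 1) - (\<sigma> + 1)) / 2) (b' \<beta> + (of_int (k + 1) - (\<sigma> + 1)) / 2))"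
    by (rule prod.cong[OF refl])
  have "a \<alpha> + 1 + (of_int k + \<sigma>) / 2 = a \<alpha> + (of_int (k + 1) + (\<sigma> + 1)) / 2"
    "a' \<alpha> + (- of_int k + \<sigma>) / 2 = a' \<alpha> + (- of_int (k + 1) + (\<sigma> + 1)) / 2" for \<alpha>
    by (simp_all add: field_simps)
  then show ?thesis unfolding K_C_def B prod.distrib by (simp only: mult_ac)
qed

lemma K_shift_right':
  assumes "Re \<sigma> \<le> - 1"
  shows "K (k - 1) (\<sigma> + 1) * (\<Prod>\<beta>=1..p. - (b' \<beta> + (of_int (k - 1) - (\<sigma> + 1)) / 2)) = K_C p q a (\<lambda>\<alpha>. a' \<alpha> + 1) b b' k \<sigma>"
proof -
  have "Gamma_C (b \<beta> + (- of_int k - \<sigma>) / 2) (b' \<beta> + (of_int k - \<sigma>) / 2) =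
     - (b' \<beta> + (of_int (k - 1) - (\<sigma> + 1)) / 2) *
     Gamma_C (b \<beta> + (- of_int (k - 1) - (\<sigma> + 1)) / 2) (b' \<beta> + (of_int (k - 1) - (\<sigma> + 1)) / 2)"
    if "\<beta> \<in> {1..p}" for \<beta>
  proof -
    let ?S = "b \<beta> + (- of_int (k - 1) - (\<sigma> + 1)) / 2" and ?S' = "b' \<beta> + (of_int (k - 1) - (\<sigma> + 1)) / 2"
    have "?S - ?S' = (b \<beta> - b' \<beta>) - of_int (k - 1)" by (simp add: field_simps)
    also have "\<dots> \<in> \<int>" using Lb[OF that] by (auto simp: Lambda_C_def intro!: Ints_diff)
    finally have "Gamma_C ?S (?S' + 1) = - ?S' * Gamma_C ?S ?S'"
      using b_not_Gamma_C_pole[of "\<sigma> + 1" \<beta> "k - 1"] assms that by (intro Gamma_C_plus1_right) auto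
    moreover have "?S' + 1 = b' \<beta> + (of_int k - \<sigma>) / 2" "?S = b \<beta> + (- of_int k - \<sigma>) / 2" by (simp_all add: field_simps)
    ultimately show ?thesis by metis
  qed
  then have B: "(\<Prod>\<beta>=1..p. Gamma_C (b \<beta> + (- of_int k - \<sigma>) / 2) (b' \<beta> + (of_int k - \<sigma>) / 2)) =
    (\<Prod>\<beta>=1..p. - (b' \<beta> + (of_int (k - 1) - (\<sigma> + 1)) / 2) *
     Gamma_C (b \<beta> + (- of_int (k - 1) - (\<sigma> + 1)) / 2) (b' \<beta> + (of_int (k - 1) - (\<sigma> + 1)) / 2))"
    by (rule prod.cong[OF refl])
  have "a' \<alpha> + 1 + (- of_int k + \<sigma>) / 2 = a' \<alpha> + (- of_int (k - 1) + (\<sigma> + 1)) / 2"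
    "a \<alpha> + (of_int k + \<sigma>) / 2 = a \<alpha> + (of_int (k - 1) + (\<sigma> + 1)) / 2" for \<alpha>
    by (simp_all add: field_simps)
  then show ?thesis unfolding K_C_def B prod.distrib by (simp only: mult_ac)
qed

end

text \<open>The constants of \<open>K_main_estimate\<close> for a fixed bound \<open>r\<close> on
  |z|; the contours depend on \<open>r\<close> through \<open>T\<close> and
  \<open>B\<close>.\<close>

locale mb_contour = mb_kernel +
  fixes r C \<theta> T B :: real
  assumes r: "r > 0" and C: "C > 0" and theta: "0 < \<theta>" "\<theta> < 1" and T: "T \<ge> 1" and B: "B \<ge> 1"
    and B_ge: "\<And>\<alpha>. \<alpha> \<in> {1..q} \<Longrightarrow> \<bar>Re (a \<alpha> - a' \<alpha>)\<bar> + 2 \<le> B"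
    and main: "\<And>k \<sigma>. Re \<sigma> \<le> 0 \<Longrightarrow> \<bar>Im \<sigma>\<bar> \<ge> T \<or> - Re \<sigma> \<le> (\<bar>real_of_int k\<bar> - B) / 2 \<Longrightarrow>
       pole_free k \<sigma> \<and> norm (K k \<sigma>) * r powr (- Re \<sigma>) \<le>
         C * norm (Complex (of_int k) (Im \<sigma>)) powr (- decay) * \<theta> powr (- Re \<sigma>)"
begin

text \<open>To the left of the axis the poles of \<open>K k\<close> start near \<open>Re \<sigma> = - |k|\<close>; going half that far keeps
  \<open>k + \<sigma>\<close> and \<open>\<sigma> - k\<close> of order \<open>|k|\<close>.\<close>

definition depth :: "int \<Rightarrow> real" where
  "depth k = max 0 ((\<bar>real_of_int k\<bar> - B) / 2)"

abbreviation "kpath k \<equiv> cpath (depth k) T"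

lemma depth_nonneg: "depth k \<ge> 0" by (simp add: depth_def)

lemma T_pos: "T > 0" using T by simp

lemma Re_cpath_le: "L \<ge> 0 \<Longrightarrow> Re (cpath L T t) \<le> 0" by simp

lemma pole_free_region:
  assumes "Re \<sigma> \<le> 0" "\<bar>Im \<sigma>\<bar> \<ge> T \<or> - Re \<sigma> \<le> depth k"
  shows "pole_free k \<sigma>"
proof (cases "\<bar>Im \<sigma>\<bar> \<ge> T \<or> - Re \<sigma> \<le> (\<bar>real_of_int k\<bar> - B) / 2")
  case True
  then show ?thesis using main[OF assms(1)] by blast
next
  case False
  \<comment> \<open>What remains is \<open>depth k\<close> = 0 with |k| < B, that is, a point of the
    axis itself, which no pole meets because Re(a + a') > 0.\<close>
  then have "Re \<sigma> = 0" using assms by (auto simp: depth_def max_def split: if_splits)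
  then show ?thesis by (intro pole_freeI) auto
qed

lemma K_differentiable_region:
  assumes "Re \<sigma> \<le> 0" "\<bar>Im \<sigma>\<bar> \<ge> T \<or> - Re \<sigma> \<le> depth k"
  shows "K k field_differentiable (at \<sigma>)"
  using pole_free_region[OF assms] La Lb by (intro K_C_field_differentiable)

lemma cpath_region:
  assumes "0 \<le> L" "L \<le> depth k"
  shows "\<bar>Im (cpath L T t)\<bar> \<ge> T \<or> - Re (cpath L T t) \<le> depth k"
  using assms T_pos by (auto simp: max_def min_def abs_if)

lemma pole_free_path: "pole_free k (kpath k t)"
  by (rule pole_free_region[OF Re_cpath_le[OF depth_nonneg] cpath_region[OF depth_nonneg order_refl]])

text \<open>\<open>K_main_estimate\<close> covers the contours except the segments |t| < T on the
  axis for the finitely many k with |k| < B. These are handled by compactness, and their maxima are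
  added to the constant.\<close>

lemma K_bound_cpath:
  obtains D where "D > 0" "\<And>k L t. 0 \<le> L \<Longrightarrow> L \<le> depth k \<Longrightarrow>
     norm (K k (cpath L T t)) * r powr (- Re (cpath L T t)) \<le> D * \<theta> powr (- Re (cpath L T t))"
proof -
  define S where "S = {k :: int. \<bar>real_of_int k\<bar> < B}"
  have "S \<subseteq> {- \<lceil>B\<rceil>..\<lceil>B\<rceil>}" by (auto simp: S_def) linarith+
  then have fin: "finite S" by (rule finite_subset) simp
  have "\<exists>E. \<forall>t\<in>{-T..T}. norm (K k (\<i> * of_real t)) \<le> E" for k
  proof -
    have "continuous_on {-T..T} (\<lambda>t. K k (\<i> * of_real t))"
    proof (rule continuous_on_compose2[of "{z. Re z = 0}" "K k"])
      show "continuous_on {z. Re z = 0} (K k)"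
        by (intro continuous_at_imp_continuous_on ballI field_differentiable_imp_continuous_at K_differentiable_region)
          (use depth_nonneg in auto)
    qed (auto intro!: continuous_intros)
    then have "compact ((\<lambda>t. K k (\<i> * of_real t)) ` {-T..T})"
      by (intro compact_continuous_image) auto
    then show ?thesis using compact_imp_bounded by (metis (no_types, lifting) bounded_iff imageI)
  qed
  then obtain E where E: "\<And>k t. t \<in> {-T..T} \<Longrightarrow> norm (K k (\<i> * of_real t)) \<le> E k" by metis
  have E0: "E k \<ge> 0" for k by (rule order_trans[OF norm_ge_zero E[of 0]]) (use T_pos in simp)
  define D where "D = C + sum E S"
  have "0 \<le> sum E S" using E0 by (simp add: sum_nonneg)
  moreover have "E k \<le> sum E S" if "k \<in> S" for k
    using that fin E0 by (intro member_le_sum) auto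
  ultimately have D: "C \<le> D" "\<And>k. k \<in> S \<Longrightarrow> E k \<le> D"
    using C unfolding D_def by (simp, fastforce)
  show ?thesis
  proof (rule that[of D])
    show "D > 0" using C D by simp
    fix k L t assume L: "0 \<le> L" "L \<le> depth k"
    define \<sigma> where "\<sigma> = cpath L T t"
    have re: "Re \<sigma> \<le> 0" using L by (simp add: \<sigma>_def)
    show "norm (K k (cpath L T t)) * r powr (- Re (cpath L T t)) \<le> D * \<theta> powr (- Re (cpath L T t))"
      unfolding \<sigma>_def[symmetric]
    proof (cases "\<bar>Im \<sigma>\<bar> \<ge> T \<or> - Re \<sigma> \<le> (\<bar>real_of_int k\<bar> - B) / 2")
      case True
      then have "norm (Complex (of_int k) (Im \<sigma>)) \<ge> 1"
      proof
        assume "\<bar>Im \<sigma>\<bar> \<ge> T"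
        then show ?thesis using T abs_Im_le_cmod[of "Complex (of_int k) (Im \<sigma>)"] by simp
      next
        assume "- Re \<sigma> \<le> (\<bar>real_of_int k\<bar> - B) / 2"
        then have "\<bar>real_of_int k\<bar> \<ge> B" using re by simp
        then show ?thesis using B abs_Re_le_cmod[of "Complex (of_int k) (Im \<sigma>)"] by simp
      qed
      then have "norm (Complex (of_int k) (Im \<sigma>)) powr (- decay) \<le> 1"
        using decay_pos powr_mono[of "- decay" 0 "norm (Complex (of_int k) (Im \<sigma>))"]
        by (auto split: if_splits)
      then have "C * norm (Complex (of_int k) (Im \<sigma>)) powr (- decay) * \<theta> powr (- Re \<sigma>) \<le> C * 1 * \<theta> powr (- Re \<sigma>)"
        using C by (intro mult_right_mono mult_left_mono) auto
      also have "\<dots> \<le> D * \<theta> powr (- Re \<sigma>)" using D by (intro mult_right_mono) auto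
      finally show "norm (K k \<sigma>) * r powr (- Re \<sigma>) \<le> D * \<theta> powr (- Re \<sigma>)"
        using main[OF re True] by linarith
    next
      case False
      then have "\<bar>t\<bar> < T" using T_pos by (auto simp: \<sigma>_def max_def min_def abs_if split: if_splits)
      then have "- Re \<sigma> = L" "Im \<sigma> = t" by (auto simp: \<sigma>_def)
      then have "L = 0" "\<sigma> = \<i> * of_real t" using False L by (auto simp: depth_def max_def complex_eq_iff split: if_splits)
      moreover have "k \<in> S" using False \<open>L = 0\<close> \<open>- Re \<sigma> = L\<close> by (auto simp: S_def)
      moreover have "t \<in> {-T..T}" using \<open>\<bar>t\<bar> < T\<close> by auto
      ultimately show "norm (K k \<sigma>) * r powr (- Re \<sigma>) \<le> D * \<theta> powr (- Re \<sigma>)"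
        using order_trans[OF E[of t k] D(2)[of k]] r theta \<open>- Re \<sigma> = L\<close> by auto
    qed
  qed
qed

lemma continuous_K_cpath:
  assumes "0 \<le> L" "L \<le> depth k"
  shows "continuous_on UNIV (\<lambda>t. K k (cpath L T t))"
  using assms
  by (intro continuous_at_imp_continuous_on ballI continuous_at_compose[unfolded o_def, of _ "cpath L T" "K k"]
      field_differentiable_imp_continuous_at K_differentiable_region cpath_region Re_cpath_le)
    (use continuous_on_cpath[of UNIV L T] in \<open>auto simp: continuous_on_eq_continuous_at\<close>)

lemma cpow_differentiable:
  assumes "z \<noteq> 0"
  shows "(\<lambda>\<sigma>. cpow z ((- of_int k - \<sigma>) / 2) ((of_int k - \<sigma>) / 2)) field_differentiable (at \<sigma>)"
proof -
  have "(- of_int k - \<sigma>) / 2 - (of_int k - \<sigma>) / 2 = of_int (- k)" for \<sigma> :: complex by (simp add: field_simps)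
  then have "(- of_int k - \<sigma>) / 2 - (of_int k - \<sigma>) / 2 \<in> \<int>" for \<sigma> :: complex by (metis Ints_of_int)
  then have "(\<lambda>\<sigma>. cpow z ((- of_int k - \<sigma>) / 2) ((of_int k - \<sigma>) / 2)) =
     (\<lambda>\<sigma>. exp ((- of_int k - \<sigma>) / 2 * Ln z + (of_int k - \<sigma>) / 2 * cnj (Ln z)))"
    using assms by (simp add: cpow_Ln)
  moreover have "(\<lambda>\<sigma>. exp ((- of_int k - \<sigma>) / 2 * Ln z + (of_int k - \<sigma>) / 2 * cnj (Ln z))) field_differentiable (at \<sigma>)"
    unfolding field_differentiable_def by (rule exI) (auto intro!: derivative_eq_intros)
  ultimately show ?thesis by simp
qed

lemma norm_cpow_integrand:
  assumes "z \<noteq> 0"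
  shows "norm (cpow z ((- of_int k - \<sigma>) / 2) ((of_int k - \<sigma>) / 2)) = norm z powr (- Re \<sigma>)"
proof -
  have "(- of_int k - \<sigma>) / 2 - (of_int k - \<sigma>) / 2 = of_int (- k)" by (simp add: field_simps)
  then have "(- of_int k - \<sigma>) / 2 - (of_int k - \<sigma>) / 2 \<in> \<int>" by (metis Ints_of_int)
  moreover have "Re ((- of_int k - \<sigma>) / 2 + (of_int k - \<sigma>) / 2) = - Re \<sigma>" by (simp add: field_simps)
  ultimately show ?thesis using assms norm_cpow by metis
qed

text \<open>Two moves: \<open>line_integral_eq_cpath_integral\<close> bends the axis into the
  contour of depth 0, with \<mu> = -ln \<theta> and \<phi> y = C y^(-\<open>decay\<close>);
  \<open>cpath_integral_shift\<close> then pushes its vertical segment to \<open>depth k\<close>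
  without meeting a pole.\<close>

lemma line_integral_eq_path_integral:
  assumes z: "z \<noteq> 0" "norm z \<le> r"
  shows "((\<lambda>t. G_integrand p q a a' b b' z k (\<i> * of_real t) * \<i>) has_integral
     (\<integral>t. G_integrand p q a a' b b' z k (kpath k t) * cweight T t \<partial>lborel)) UNIV"
proof -
  define g where "g = G_integrand p q a a' b b' z k"
  define \<mu> where "\<mu> = - ln \<theta>"
  have mu: "\<mu> > 0" using theta by (simp add: \<mu>_def)
  have th: "\<theta> powr x = exp (- \<mu> * x)" for x using theta by (simp add: \<mu>_def powr_def mult.commute)
  have fd: "g field_differentiable at \<sigma>" if "Re \<sigma> \<le> 0" "\<bar>Im \<sigma>\<bar> \<ge> T \<or> - Re \<sigma> \<le> depth k" for \<sigma>
    unfolding g_def G_integrand_def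
    by (intro field_differentiable_mult K_differentiable_region that cpow_differentiable z)
  have ng: "norm (g \<sigma>) \<le> norm (K k \<sigma>) * r powr (- Re \<sigma>)" if "Re \<sigma> \<le> 0" for \<sigma>
    unfolding g_def G_integrand_def norm_mult norm_cpow_integrand[OF z(1)]
    using that z by (intro mult_left_mono powr_mono2) auto
  obtain D where D: "D > 0" "\<And>k L t. 0 \<le> L \<Longrightarrow> L \<le> depth k \<Longrightarrow>
     norm (K k (cpath L T t)) * r powr (- Re (cpath L T t)) \<le> D * \<theta> powr (- Re (cpath L T t))"
    using K_bound_cpath by metis
  have int: "integrable lborel (\<lambda>t. g (cpath L T t) * cweight T t)" if L: "0 \<le> L" "L \<le> depth k" for L
  proof (rule cpath_integrable[OF _ mu T_pos])
    show "continuous_on UNIV (\<lambda>t. g (cpath L T t))"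
      using L
      by (intro continuous_at_imp_continuous_on ballI continuous_at_compose[unfolded o_def, of _ "cpath L T" g]
        field_differentiable_imp_continuous_at fd cpath_region Re_cpath_le)
        (use continuous_on_cpath[of UNIV L T] in \<open>auto simp: continuous_on_eq_continuous_at\<close>)
    fix t assume t: "\<bar>t\<bar> \<ge> T"
    have "norm (g (cpath L T t)) \<le> D * \<theta> powr (- Re (cpath L T t))"
      using ng[OF Re_cpath_le[OF L(1)]] D(2)[OF L] order_trans by blast
    also have "\<dots> = D * exp (- \<mu> * (L + (\<bar>t\<bar> - T)))" using t by (simp add: th)
    also have "\<dots> \<le> D * exp (- \<mu> * (\<bar>t\<bar> - T))"
      using D L mu by (intro mult_left_mono) auto
    also have "\<dots> = D * exp (\<mu> * T) * exp (- \<mu> * \<bar>t\<bar>)" by (simp add: algebra_simps flip: exp_add)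
    finally show "norm (g (cpath L T t)) \<le> D * exp (\<mu> * T) * exp (- \<mu> * \<bar>t\<bar>)" .
  qed
  have "((\<lambda>t. g (\<i> * of_real t) * \<i>) has_integral (\<integral>t. g (cpath 0 T t) * cweight T t \<partial>lborel)) UNIV"
  proof (rule line_integral_eq_cpath_integral[OF T_pos mu, where \<phi> = "\<lambda>y. C * y powr (- decay)" and \<Phi> = C])
    show "continuous_on {-T..T} (\<lambda>t. g (\<i> * of_real t))"
    proof (rule continuous_on_compose2[of "{z. Re z = 0}" g])
      show "continuous_on {z. Re z = 0} g"
        by (intro continuous_at_imp_continuous_on ballI field_differentiable_imp_continuous_at fd)
          (use depth_nonneg in auto)
    qed (auto intro!: continuous_intros)
    show "norm (g \<sigma>) \<le> C * \<bar>Im \<sigma>\<bar> powr (- decay) * exp (\<mu> * Re \<sigma>)" if "Re \<sigma> \<le> 0" "\<bar>Im \<sigma>\<bar> \<ge> T" for \<sigma>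
    proof -
      have "norm (g \<sigma>) \<le> C * norm (Complex (of_int k) (Im \<sigma>)) powr (- decay) * \<theta> powr (- Re \<sigma>)"
        using ng[OF that(1)] main[OF that(1) disjI1[OF that(2)]] order_trans by blast
      also have "\<dots> \<le> C * \<bar>Im \<sigma>\<bar> powr (- decay) * \<theta> powr (- Re \<sigma>)"
        using C T that abs_Im_le_cmod[of "Complex (of_int k) (Im \<sigma>)"] decay_pos
        by (intro mult_right_mono mult_left_mono powr_mono2') auto
      finally show ?thesis by (simp add: th)
    qed
    show "C * y powr (- decay) \<le> C" if "y \<ge> T" for y
    proof -
      have "y powr (- decay) \<le> y powr 0" using that T decay_pos by (intro powr_mono) auto
      then show ?thesis using C that T by simp
    qed
    have "((\<lambda>y. y powr (- decay)) \<longlongrightarrow> 0) at_top"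
      by (rule tendsto_neg_powr) (use decay_pos in \<open>auto intro: filterlim_ident\<close>)
    then show "((\<lambda>y. C * y powr (- decay)) \<longlongrightarrow> 0) at_top" by (rule tendsto_mult_right_zero)
  qed (use fd int[of 0] depth_nonneg in auto)
  also have "(\<integral>t. g (cpath 0 T t) * cweight T t \<partial>lborel) = (\<integral>t. g (kpath k t) * cweight T t \<partial>lborel)"
    by (rule cpath_integral_shift[OF T_pos depth_nonneg]) (use fd int depth_nonneg in auto)
  finally show ?thesis unfolding g_def .
qed

definition coeff_fun :: "int \<times> real \<Rightarrow> complex" where
  "coeff_fun = (\<lambda>(k, t). K k (kpath k t) * cweight T t)"
definition expo :: "int \<times> real \<Rightarrow> complex" where
  "expo = (\<lambda>(k, t). (- of_int k - kpath k t) / 2)"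
definition expo' :: "int \<times> real \<Rightarrow> complex" where
  "expo' = (\<lambda>(k, t). (of_int k - kpath k t) / 2)"

lemma expo_diff: "expo x - expo' x \<in> \<int>"
proof -
  have "expo x - expo' x = of_int (- fst x)" by (cases x) (simp add: expo_def expo'_def field_simps)
  then show ?thesis by (metis Ints_of_int)
qed

text \<open>On the contours kernel times power is O(e^(-\<mu> X)) with \<mu> = -ln \<theta>. Half of
  this rate absorbs a polynomial weight of any degree \<open>N\<close>, and the other half is left
  for integrability over \<open>kline\<close>.\<close>

lemma mellin_dom_contour:
  assumes "r0 > 0"
  shows "mellin_dom N kline coeff_fun expo expo' {z. r0 < norm z \<and> norm z < r}"
proof -
  have "open ({z :: complex. r0 < norm z} \<inter> {z. norm z < r})"
    by (intro open_Int open_Collect_less continuous_intros)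
  then have op: "open {z :: complex. r0 < norm z \<and> norm z < r}" by (simp add: Collect_conj_eq)
  have mp: "(\<lambda>t. kpath k t) \<in> borel_measurable borel" for k
    by (rule borel_measurable_continuous_onI[OF continuous_on_cpath])
  have m1: "coeff_fun \<in> borel_measurable kline"
  proof (rule measurable_kline)
    fix k
    have [measurable]: "(\<lambda>t. K k (kpath k t)) \<in> borel_measurable borel"
      by (rule borel_measurable_continuous_onI[OF continuous_K_cpath]) (use depth_nonneg in auto)
    show "(\<lambda>t. coeff_fun (k, t)) \<in> borel_measurable borel" unfolding coeff_fun_def by simp
  qed
  have m2: "expo \<in> borel_measurable kline" "expo' \<in> borel_measurable kline"
    by (rule measurable_kline, use mp in \<open>simp add: expo_def expo'_def\<close>)+
  define \<mu> where "\<mu> = - ln \<theta>"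
  have mu: "\<mu> > 0" using theta by (simp add: \<mu>_def)
  have th: "\<theta> powr x = exp (- \<mu> * x)" for x using theta by (simp add: \<mu>_def powr_def mult.commute)
  obtain D where D: "D > 0" "\<And>k L t. 0 \<le> L \<Longrightarrow> L \<le> depth k \<Longrightarrow>
     norm (K k (cpath L T t)) * r powr (- Re (cpath L T t)) \<le> D * \<theta> powr (- Re (cpath L T t))"
    using K_bound_cpath by metis
  obtain P where P: "P > 0" "\<And>x. x \<ge> 0 \<Longrightarrow> (1 + 4 * x) ^ N \<le> P * exp (\<mu> / 2 * x)"
    using power_le_exp[of "\<mu> / 2" N] mu by auto
  define E where "E = D * exp (\<mu> * (B / 2 + T)) * ((1 + T) ^ N * P)"
  define BB where "BB = (\<lambda>(k, t). E * (case (k :: int, t) of (k, t) \<Rightarrow> exp (- (\<mu> / 4) * (\<bar>real_of_int k\<bar> + \<bar>t\<bar>))))"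
  have "integrable kline BB"
    using integrable_mult_right[OF integrable_kline_exp[of "\<mu> / 4"], of E] mu by (simp add: BB_def split_def)
  moreover have "norm (coeff_fun x) * (1 + norm (expo x) + norm (expo' x)) ^ N * norm (cpow z (expo x) (expo' x)) \<le> BB x"
    if z: "r0 < norm z" "norm z < r" for x z
  proof -
    obtain k t where x: "x = (k, t)" by (cases x)
    \<comment> \<open>\<open>X\<close> measures the distance travelled to the left: up to the
      constant B/2 + T it is a lower bound for -Re \<sigma>, because the depth is about |k|/2 and
      the rays have unit speed.\<close>
    define X where "X = \<bar>real_of_int k\<bar> / 2 + \<bar>t\<bar>"
    define \<sigma> where "\<sigma> = kpath k t"
    have X: "X \<ge> 0" by (simp add: X_def)
    have z0: "z \<noteq> 0" using z assms by auto
    have re: "Re \<sigma> \<le> 0" unfolding \<sigma>_def by (rule Re_cpath_le[OF depth_nonneg])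
    have re_ge: "- Re \<sigma> \<ge> X - (B / 2 + T)"
      using T_pos by (simp add: \<sigma>_def X_def depth_def max_def field_simps)
    have re_le: "- Re \<sigma> \<le> \<bar>real_of_int k\<bar> + \<bar>t\<bar>"
    proof -
      have "depth k \<le> \<bar>real_of_int k\<bar>" using B by (simp add: depth_def field_simps)
      moreover have "max 0 (\<bar>t\<bar> - T) \<le> \<bar>t\<bar>" using T_pos by simp
      ultimately show ?thesis by (simp add: \<sigma>_def)
    qed
    have im: "\<bar>Im \<sigma>\<bar> \<le> T" using T_pos by (auto simp: \<sigma>_def max_def min_def)
    have "norm \<sigma> \<le> \<bar>Re \<sigma>\<bar> + \<bar>Im \<sigma>\<bar>" by (rule cmod_le)
    then have ns: "norm \<sigma> \<le> \<bar>real_of_int k\<bar> + \<bar>t\<bar> + T" using re re_le im by linarith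
    have "norm (expo x) + norm (expo' x) \<le> \<bar>real_of_int k\<bar> + norm \<sigma>"
    proof -
      have "norm (expo x) = norm (- of_int k - \<sigma>) / 2" "norm (expo' x) = norm (of_int k - \<sigma>) / 2"
        by (simp_all add: x expo_def expo'_def \<sigma>_def norm_divide)
      moreover have "norm (- of_int k - \<sigma>) \<le> \<bar>real_of_int k\<bar> + norm \<sigma>" "norm (of_int k - \<sigma>) \<le> \<bar>real_of_int k\<bar> + norm \<sigma>"
        using norm_triangle_ineq4[of "- of_int k" \<sigma>] norm_triangle_ineq4[of "of_int k" \<sigma>] by simp_all
      ultimately show ?thesis by simp
    qed
    then have "1 + norm (expo x) + norm (expo' x) \<le> 1 + T + 4 * X" using ns by (simp add: X_def)
    also have "\<dots> \<le> (1 + T) * (1 + 4 * X)" using T_pos X by (simp add: algebra_simps)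
    finally have "(1 + norm (expo x) + norm (expo' x)) ^ N \<le> ((1 + T) * (1 + 4 * X)) ^ N" by (intro power_mono) auto
    also have "\<dots> = (1 + T) ^ N * (1 + 4 * X) ^ N" by (rule power_mult_distrib)
    also have "\<dots> \<le> (1 + T) ^ N * (P * exp (\<mu> / 2 * X))" using P(2)[OF X] T_pos by (intro mult_left_mono) auto
    finally have A: "(1 + norm (expo x) + norm (expo' x)) ^ N \<le> (1 + T) ^ N * P * exp (\<mu> / 2 * X)" by (simp add: mult_ac)
    have "norm (coeff_fun x) * norm (cpow z (expo x) (expo' x)) = norm (K k \<sigma>) * norm z powr (- Re \<sigma>)"
      using norm_cpow_integrand[OF z0, of k \<sigma>]
      by (simp add: x coeff_fun_def expo_def expo'_def \<sigma>_def norm_mult)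
    also have "\<dots> \<le> norm (K k \<sigma>) * r powr (- Re \<sigma>)" using z re by (intro mult_left_mono powr_mono2) auto
    also have "\<dots> \<le> D * \<theta> powr (- Re \<sigma>)" unfolding \<sigma>_def by (rule D(2)) (use depth_nonneg in auto)
    also have "\<dots> \<le> D * \<theta> powr (X - (B / 2 + T))"
      using D theta re_ge by (intro mult_left_mono powr_mono') auto
    also have "\<dots> = D * exp (\<mu> * (B / 2 + T)) * exp (- \<mu> * X)"
      unfolding th mult.assoc exp_add[symmetric] by (simp add: algebra_simps)
    finally have F: "norm (coeff_fun x) * norm (cpow z (expo x) (expo' x)) \<le> D * exp (\<mu> * (B / 2 + T)) * exp (- \<mu> * X)" .
    have "norm (coeff_fun x) * norm (cpow z (expo x) (expo' x)) * (1 + norm (expo x) + norm (expo' x)) ^ N \<le>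
       (D * exp (\<mu> * (B / 2 + T)) * exp (- \<mu> * X)) * ((1 + T) ^ N * P * exp (\<mu> / 2 * X))"
      by (rule mult_mono[OF F A]) (use D in auto)
    also have "\<dots> = E * (exp (- \<mu> * X) * exp (\<mu> / 2 * X))" by (simp add: E_def mult_ac)
    also have "exp (- \<mu> * X) * exp (\<mu> / 2 * X) = exp (- \<mu> / 2 * X)" by (simp add: algebra_simps flip: exp_add)
    also have "E * exp (- \<mu> / 2 * X) \<le> E * exp (- (\<mu> / 4) * (\<bar>real_of_int k\<bar> + \<bar>t\<bar>))"
    proof (intro mult_left_mono)
      have "\<mu> * \<bar>t\<bar> \<ge> 0" using mu by simp
      then show "exp (- \<mu> / 2 * X) \<le> exp (- (\<mu> / 4) * (\<bar>real_of_int k\<bar> + \<bar>t\<bar>))"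
        by (simp add: X_def algebra_simps)
      show "E \<ge> 0" using D P T_pos by (simp add: E_def)
    qed
    finally show ?thesis by (simp add: x BB_def mult_ac)
  qed
  ultimately show ?thesis
    unfolding mellin_dom_def using m1 m2 op expo_diff assms by (auto intro!: exI[of _ r0] exI[of _ BB])
qed

text \<open>By Fubini the integral over \<open>kline\<close> is an unordered sum over k whose terms
  are the original line integrals. Convergence of the defining expression and its value come out
  together.\<close>

lemma G_C_eq_mellin:
  assumes z: "z \<noteq> 0" "norm z < r"
  shows "G_C_converges p q a a' b b' z"
    "G_C p q a a' b b' z = 1 / (2 * of_real pi * \<i>) * mellin kline coeff_fun expo expo' z"
proof -
  have "integrable kline (\<lambda>x. coeff_fun x * cpow z (expo x) (expo' x))"
    by (rule mellin_dom_integrable[OF mellin_dom_contour[of "norm z / 2"]]) (use z in auto)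
  from integral_kline[OF this]
  have hs: "((\<lambda>k. \<integral>t. G_integrand p q a a' b b' z k (kpath k t) * cweight T t \<partial>lborel) has_sum
      mellin kline coeff_fun expo expo' z) UNIV"
    by (simp add: mellin_def coeff_fun_def expo_def expo'_def G_integrand_def mult_ac)
  have line: "((\<lambda>t. G_integrand p q a a' b b' z k (\<i> * of_real t) * \<i>) has_integral
     (\<integral>t. G_integrand p q a a' b b' z k (kpath k t) * cweight T t \<partial>lborel)) UNIV" for k
    by (rule line_integral_eq_path_integral) (use z in auto)
  have eq: "imag_axis_integral (G_integrand p q a a' b b' z k) =
     (\<integral>t. G_integrand p q a a' b b' z k (kpath k t) * cweight T t \<partial>lborel)" for k
    unfolding imag_axis_integral_def by (rule integral_unique[OF line])
  show "G_C_converges p q a a' b b' z"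
    unfolding G_C_converges_def imag_axis_integrable_def eq
    using has_integral_integrable[OF line] has_sum_imp_summable[OF hs] by blast
  show "G_C p q a a' b b' z = 1 / (2 * of_real pi * \<i>) * mellin kline coeff_fun expo expo' z"
    unfolding G_C_def eq using infsumI[OF hs] by simp
qed

end

section \<open>The differential equations\<close>

lemma mellin_dom_prod:
  assumes "mellin_dom n M c s s' V"
  shows "mellin_dom 0 M (\<lambda>x. c x * (\<Prod>j=1..n. s x + e j)) s s' V"
    "mellin_dom 0 M (\<lambda>x. c x * (\<Prod>j=1..n. s' x + e j)) s s' V"
  using assms
proof (induction n arbitrary: c)
  case (Suc n)
  {
    case 1
    show ?case using Suc.IH(1)[OF mellin_dom_SucD(2)[OF 1, of "e (Suc n)"]] by (simp add: mult_ac)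
  next
    case 2
    show ?case using Suc.IH(2)[OF mellin_dom_SucD(3)[OF 2, of "e (Suc n)"]] by (simp add: mult_ac)
  }
qed simp_all

lemma mellin_cmult: "mellin M (\<lambda>x. k * c x) s s' z = k * mellin M c s s' z"
  by (simp add: mellin_def mult.assoc)

lemma mellin_dom_cmult:
  assumes "mellin_dom N M c s s' V"
  shows "mellin_dom N M (\<lambda>x. k * c x) s s' V"
  by (rule mellin_dom_transfer[OF assms, where C = "norm k"])
    (use assms in \<open>auto simp: mellin_dom_def norm_mult mult.assoc\<close>)

lemma cpath_plus_1: "cpath L T t = cpath (L + 1) T t + 1"
  by (simp add: cpath_def)

context mb_contour
begin

text \<open>\<open>P\<close> and \<open>Q\<close> are the integrands of the two terms of an
  equation, \<open>A\<close> their common form. Substituting (k + e, \<sigma> + 1) in the second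
  term turns its contour into one deeper by 1 with integrand \<open>A k\<close>; this one is moved
  to \<open>depth k\<close>, and the sum over all k absorbs the shift by \<open>e\<close>.\<close>

lemma contour_sum_shift:
  fixes e :: int and P Q A :: "int \<Rightarrow> complex \<Rightarrow> complex"
  assumes P: "\<And>k t. P k (kpath k t) = A k (kpath k t)"
    and Q: "\<And>k \<sigma>. Re \<sigma> \<le> - 1 \<Longrightarrow> u * Q (k + e) (\<sigma> + 1) = A k \<sigma>"
    and A: "\<And>k \<sigma>. Re \<sigma> \<le> 0 \<Longrightarrow> - Re \<sigma> \<le> max (depth k) (depth (k + e) + 1) \<Longrightarrow> A k field_differentiable (at \<sigma>)"
    and iP: "integrable kline (\<lambda>(k, t). P k (kpath k t) * cweight T t)"
    and iQ: "integrable kline (\<lambda>(k, t). Q k (kpath k t) * cweight T t)"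
  shows "(\<integral>x. (case x of (k, t) \<Rightarrow> P k (kpath k t) * cweight T t) \<partial>kline) =
     u * (\<integral>x. (case x of (k, t) \<Rightarrow> Q k (kpath k t) * cweight T t) \<partial>kline)"
proof -
  define IP where "IP = (\<lambda>k. \<integral>t. P k (kpath k t) * cweight T t \<partial>lborel)"
  define IQ where "IQ = (\<lambda>k. \<integral>t. Q k (kpath k t) * cweight T t \<partial>lborel)"
  have hP: "(IP has_sum (\<integral>x. (case x of (k, t) \<Rightarrow> P k (kpath k t) * cweight T t) \<partial>kline)) UNIV"
    using integral_kline[OF iP] by (simp add: IP_def)
  have hQ: "(IQ has_sum (\<integral>x. (case x of (k, t) \<Rightarrow> Q k (kpath k t) * cweight T t) \<partial>kline)) UNIV"
    using integral_kline[OF iQ] by (simp add: IQ_def)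
  have bij: "bij_betw (\<lambda>k. k + e) UNIV UNIV"
    by (rule bij_betwI[where g = "\<lambda>k. k - e"]) auto
  have "((\<lambda>k. u * IQ (k + e)) has_sum (u * (\<integral>x. (case x of (k, t) \<Rightarrow> Q k (kpath k t) * cweight T t) \<partial>kline))) UNIV"
    using hQ by (intro has_sum_cmult_right) (simp add: has_sum_reindex_bij_betw[OF bij])
  moreover have "u * IQ (k + e) = IP k" for k
  proof -
    \<comment> \<open>The depth of the contour of index k + e after translation by -1.\<close>
    define L where "L = depth (k + e) + 1"
    have L: "L \<ge> 1" using depth_nonneg by (simp add: L_def)
    have AQ: "u * (Q (k + e) (kpath (k + e) t) * cweight T t) = A k (cpath L T t) * cweight T t" for t
    proof -
      have "Re (cpath L T t) \<le> - 1" using L by simp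
      then show ?thesis using Q[of "cpath L T t" k] cpath_plus_1[of "depth (k + e)" T t]
        by (simp add: L_def mult.assoc[symmetric])
    qed
    have "integrable lborel (\<lambda>t. u * (Q (k + e) (kpath (k + e) t) * cweight T t))"
      using integrable_kline_slice[OF iQ, of "k + e"] by simp
    then have iA: "integrable lborel (\<lambda>t. A k (cpath L T t) * cweight T t)" unfolding AQ .
    have iA': "integrable lborel (\<lambda>t. A k (kpath k t) * cweight T t)"
      using integrable_kline_slice[OF iP, of k] by (simp add: P)
    have "u * IQ (k + e) = (\<integral>t. u * (Q (k + e) (kpath (k + e) t) * cweight T t) \<partial>lborel)"
      by (simp add: IQ_def)
    also have "\<dots> = (\<integral>t. A k (cpath L T t) * cweight T t \<partial>lborel)" unfolding AQ ..
    also have "\<dots> = (\<integral>t. A k (kpath k t) * cweight T t \<partial>lborel)"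
    proof (cases "depth k \<le> L")
      case True
      show ?thesis
        by (rule cpath_integral_shift[OF T_pos True _ iA' iA, symmetric])
          (use A depth_nonneg[of k] in \<open>auto simp: L_def max_def\<close>)
    next
      case False
      show ?thesis
        by (rule cpath_integral_shift[OF T_pos _ _ iA iA'])
          (use False A L in \<open>auto simp: L_def max_def\<close>)
    qed
    also have "\<dots> = IP k" by (simp add: IP_def P)
    finally show ?thesis .
  qed
  ultimately show ?thesis using has_sum_unique[OF hP] by simp
qed

text \<open>Raising \<open>a\<close> or \<open>a'\<close> by 1 moves the a-poles one unit further
  left and replaces k by k + e in their position. That unit pays for the translated contour of depth
  \<open>depth (k + e) + 1\<close>; \<open>B_ge\<close> covers the offset Re(a - a').\<close>

lemma K_shifted_differentiable:
  assumes xy: "x = 1 \<and> y = 0 \<and> e = 1 \<or> x = 0 \<and> y = 1 \<and> e = - 1"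
    and \<sigma>: "Re \<sigma> \<le> 0" "- Re \<sigma> \<le> max (depth k) (depth (k + e) + 1)"
  shows "K_C p q (\<lambda>\<alpha>. a \<alpha> + x) (\<lambda>\<alpha>. a' \<alpha> + y) b b' k field_differentiable (at \<sigma>)"
proof (rule K_C_field_differentiable)
  have xyi: "x - y = of_int e" "Re x + Re y = 1" "\<bar>e\<bar> = 1" using xy by auto
  show "(a \<alpha> + x, a' \<alpha> + y) \<in> Lambda_C" if "\<alpha> \<in> {1..q}" for \<alpha>
  proof -
    have "a \<alpha> + x - (a' \<alpha> + y) = (a \<alpha> - a' \<alpha>) + of_int e" using xyi by (simp add: algebra_simps)
    also have "\<dots> \<in> \<int>" using La[OF that] by (auto simp: Lambda_C_def)
    finally show ?thesis by (simp add: Lambda_C_def)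
  qed
  show "K_pole_free p q (\<lambda>\<alpha>. a \<alpha> + x) (\<lambda>\<alpha>. a' \<alpha> + y) b b' k \<sigma>"
    unfolding K_pole_free_def
  proof (intro conjI ballI)
    fix \<alpha> assume \<alpha>: "\<alpha> \<in> {1..q}"
    show "\<not> Gamma_C_pole (a \<alpha> + x + (of_int k + \<sigma>) / 2) (a' \<alpha> + y + (- of_int k + \<sigma>) / 2)"
    proof (intro not_Gamma_C_poleI disjI2)
      have 2: "Re ((a \<alpha> + x + (of_int k + \<sigma>) / 2) + (a' \<alpha> + y + (- of_int k + \<sigma>) / 2)) = Re (a \<alpha> + a' \<alpha>) + 1 + Re \<sigma>"
        using xyi(2) by (simp add: field_simps)
      have "Re x - Re y = of_int e" using xyi(1) by (metis minus_complex.simps(1) Re_complex_of_real of_real_of_int_eq)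
      then have 3: "Re ((a \<alpha> + x + (of_int k + \<sigma>) / 2) - (a' \<alpha> + y + (- of_int k + \<sigma>) / 2)) = Re (a \<alpha> - a' \<alpha>) + of_int (k + e)"
        by (simp add: field_simps)
      have ke: "\<bar>real_of_int k\<bar> \<le> \<bar>real_of_int (k + e)\<bar> + 1" using xyi(3) by linarith
      have d: "depth k \<le> \<bar>real_of_int (k + e) + Re (a \<alpha> - a' \<alpha>)\<bar> + 1"
        "depth (k + e) \<le> \<bar>real_of_int (k + e) + Re (a \<alpha> - a' \<alpha>)\<bar>"
      proof -
        define X where "X = \<bar>real_of_int (k + e) + Re (a \<alpha> - a' \<alpha>)\<bar>"
        have "\<bar>real_of_int (k + e)\<bar> \<le> X + \<bar>Re (a \<alpha> - a' \<alpha>)\<bar>" "X \<ge> 0" unfolding X_def by linarith+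
        then have "\<bar>real_of_int k\<bar> - B \<le> 2 * X + 2" "\<bar>real_of_int (k + e)\<bar> - B \<le> 2 * X"
          using ke B_ge[OF \<alpha>] by linarith+
        then show "depth k \<le> \<bar>real_of_int (k + e) + Re (a \<alpha> - a' \<alpha>)\<bar> + 1"
          "depth (k + e) \<le> \<bar>real_of_int (k + e) + Re (a \<alpha> - a' \<alpha>)\<bar>"
          unfolding X_def[symmetric] depth_def using \<open>X \<ge> 0\<close> by simp_all
      qed
      show "Re ((a \<alpha> + x + (of_int k + \<sigma>) / 2) + (a' \<alpha> + y + (- of_int k + \<sigma>) / 2)) >
         - \<bar>Re ((a \<alpha> + x + (of_int k + \<sigma>) / 2) - (a' \<alpha> + y + (- of_int k + \<sigma>) / 2))\<bar>"
        unfolding 2 3 using Ra[OF \<alpha>] \<sigma> d by (simp add: add.commute)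
    qed
  qed (use b_not_Gamma_C_pole \<sigma> in auto)
qed (use Lb in auto)

text \<open>Symbol calculus for the two operators. In the first identity (-1)^q turns
  \<open>expo x + - a \<alpha>\<close> into a + (k + \<sigma>)/2. In the second one the a'-factors
  already carry the minus sign of Gamma^C(a|a' + 1) = -a' Gamma^C(a|a'), and it is the b'-factors
  that need a sign; hence (-1)^p.\<close>

lemma mellin_identities:
  assumes z: "z \<noteq> 0" "norm z < r"
  shows "(-1) ^ q * mellin kline (\<lambda>x. coeff_fun x * (\<Prod>\<alpha>=1..q. expo x + - a \<alpha>)) expo expo' z =
      z * mellin kline (\<lambda>x. coeff_fun x * (\<Prod>\<beta>=1..p. expo x + b \<beta>)) expo expo' z"
    "(-1) ^ p * mellin kline (\<lambda>x. coeff_fun x * (\<Prod>\<alpha>=1..q. expo' x + - a' \<alpha>)) expo expo' z =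
      cnj z * mellin kline (\<lambda>x. coeff_fun x * (\<Prod>\<beta>=1..p. expo' x + b' \<beta>)) expo expo' z"
proof -
  define V where "V = {w :: complex. norm z / 2 < norm w \<and> norm w < r}"
  have zV: "z \<in> V" using z by (simp add: V_def)
  have dom: "mellin_dom N kline coeff_fun expo expo' V" for N
    unfolding V_def by (rule mellin_dom_contour) (use z in simp)
  define ex ex' where "ex = (\<lambda>k \<sigma>. (- of_int k - \<sigma>) / 2 :: complex)" and "ex' = (\<lambda>k \<sigma>. (of_int k - \<sigma>) / 2 :: complex)"
  define cp where "cp = (\<lambda>k \<sigma>. cpow z (ex k \<sigma>) (ex' k \<sigma>))"
  have exI: "ex k \<sigma> - ex' k \<sigma> \<in> \<int>" for k \<sigma>
  proof -
    have "ex k \<sigma> - ex' k \<sigma> = of_int (- k)" by (simp add: ex_def ex'_def field_simps)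
    then show ?thesis by (metis Ints_of_int)
  qed
  have cpd: "cp k field_differentiable (at \<sigma>)" for k \<sigma>
    unfolding cp_def ex_def ex'_def by (rule cpow_differentiable[OF z(1)])
  have rep: "(\<lambda>x. coeff_fun x * R x * cpow z (expo x) (expo' x)) =
      (\<lambda>(k, t). (K k (kpath k t) * R (k, t) * cp k (kpath k t)) * cweight T t)" for R
    by (auto simp: fun_eq_iff coeff_fun_def expo_def expo'_def cp_def ex_def ex'_def)
  have xex: "expo (k, t) = ex k (kpath k t)" "expo' (k, t) = ex' k (kpath k t)" for k t
    by (simp_all add: expo_def expo'_def ex_def ex'_def)
  have cp1: "z * cp (k + 1) (\<sigma> + 1) = cp k \<sigma>" for k \<sigma>
  proof -
    have "ex (k + 1) (\<sigma> + 1) = ex k \<sigma> - 1" "ex' (k + 1) (\<sigma> + 1) = ex' k \<sigma>"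
      by (simp_all add: ex_def ex'_def field_simps)
    then show ?thesis using z(1) cpow_minus1_left[OF exI z(1), of k \<sigma>] by (simp add: cp_def)
  qed
  have cp2: "cnj z * cp (k + - 1) (\<sigma> + 1) = cp k \<sigma>" for k \<sigma>
  proof -
    have "ex (k + - 1) (\<sigma> + 1) = ex k \<sigma>" "ex' (k + - 1) (\<sigma> + 1) = ex' k \<sigma> - 1"
      by (simp_all add: ex_def ex'_def field_simps)
    then show ?thesis using z(1) cpow_minus1_right[OF exI z(1), of k \<sigma>] by (simp add: cp_def)
  qed
  have int1: "integrable kline (\<lambda>(k, t). (K k (kpath k t) * (\<Prod>j=1..n. ex k (kpath k t) + e j) * cp k (kpath k t)) * cweight T t)"
    for n :: nat and e
    using mellin_dom_integrable[OF mellin_dom_prod(1)[where n = n and e = e, OF dom] zV] unfolding rep xex .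
  have int2: "integrable kline (\<lambda>(k, t). (K k (kpath k t) * (\<Prod>j=1..n. ex' k (kpath k t) + e j) * cp k (kpath k t)) * cweight T t)"
    for n :: nat and e
    using mellin_dom_integrable[OF mellin_dom_prod(2)[where n = n and e = e, OF dom] zV] unfolding rep xex .
  have "(\<integral>x. (case x of (k, t) \<Rightarrow> ((-1) ^ q * (K k (kpath k t) * (\<Prod>\<alpha>=1..q. ex k (kpath k t) + - a \<alpha>) * cp k (kpath k t))) * cweight T t) \<partial>kline) =
     z * (\<integral>x. (case x of (k, t) \<Rightarrow> (K k (kpath k t) * (\<Prod>\<beta>=1..p. ex k (kpath k t) + b \<beta>) * cp k (kpath k t)) * cweight T t) \<partial>kline)"
  proof (rule contour_sum_shift[where A = "\<lambda>k \<sigma>. K_C p q (\<lambda>\<alpha>. a \<alpha> + 1) (\<lambda>\<alpha>. a' \<alpha> + 0) b b' k \<sigma> * cp k \<sigma>" and e = 1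
        and P = "\<lambda>k \<sigma>. (-1) ^ q * (K k \<sigma> * (\<Prod>\<alpha>=1..q. ex k \<sigma> + - a \<alpha>) * cp k \<sigma>)"
        and Q = "\<lambda>k \<sigma>. K k \<sigma> * (\<Prod>\<beta>=1..p. ex k \<sigma> + b \<beta>) * cp k \<sigma>"])
    fix k t
    have "(-1) ^ q * (\<Prod>\<alpha>=1..q. ex k (kpath k t) + - a \<alpha>) = (\<Prod>\<alpha>=1..q. - (ex k (kpath k t) + - a \<alpha>))"
      by (subst prod_uminus) simp
    also have "\<dots> = (\<Prod>\<alpha>=1..q. a \<alpha> + (of_int k + kpath k t) / 2)"
      by (intro prod.cong) (auto simp: ex_def field_simps)
    finally have fin: "(-1) ^ q * (\<Prod>\<alpha>=1..q. ex k (kpath k t) + - a \<alpha>) = (\<Prod>\<alpha>=1..q. a \<alpha> + (of_int k + kpath k t) / 2)" .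
    have KS: "K k (kpath k t) * (\<Prod>\<alpha>=1..q. a \<alpha> + (of_int k + kpath k t) / 2) =
        K_C p q (\<lambda>\<alpha>. a \<alpha> + 1) a' b b' k (kpath k t)"
      by (rule K_C_shift_left[OF _ pole_free_path]) (rule La)
    show "(-1) ^ q * (K k (kpath k t) * (\<Prod>\<alpha>=1..q. ex k (kpath k t) + - a \<alpha>) * cp k (kpath k t)) =
        K_C p q (\<lambda>\<alpha>. a \<alpha> + 1) (\<lambda>\<alpha>. a' \<alpha> + 0) b b' k (kpath k t) * cp k (kpath k t)"
      unfolding add_0_right KS[symmetric] fin[symmetric] by (simp only: mult_ac)
  next
    fix k \<sigma> assume re: "Re \<sigma> \<le> - 1"
    have "(\<Prod>\<beta>=1..p. ex (k + 1) (\<sigma> + 1) + b \<beta>) = (\<Prod>\<beta>=1..p. b \<beta> + (- of_int (k + 1) - (\<sigma> + 1)) / 2)"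
      by (simp add: ex_def add.commute)
    then have "K (k + 1) (\<sigma> + 1) * (\<Prod>\<beta>=1..p. ex (k + 1) (\<sigma> + 1) + b \<beta>) = K_C p q (\<lambda>\<alpha>. a \<alpha> + 1) a' b b' k \<sigma>"
      using K_shift_right[OF re, of k] by simp
    then show "z * (K (k + 1) (\<sigma> + 1) * (\<Prod>\<beta>=1..p. ex (k + 1) (\<sigma> + 1) + b \<beta>) * cp (k + 1) (\<sigma> + 1)) =
       K_C p q (\<lambda>\<alpha>. a \<alpha> + 1) (\<lambda>\<alpha>. a' \<alpha> + 0) b b' k \<sigma> * cp k \<sigma>"
      using cp1[of k \<sigma>] by (simp add: mult_ac)
  next
    fix k \<sigma> assume "Re \<sigma> \<le> 0" "- Re \<sigma> \<le> max (depth k) (depth (k + 1) + 1)"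
    then show "(\<lambda>\<sigma>. K_C p q (\<lambda>\<alpha>. a \<alpha> + 1) (\<lambda>\<alpha>. a' \<alpha> + 0) b b' k \<sigma> * cp k \<sigma>) field_differentiable at \<sigma>"
      by (intro field_differentiable_mult cpd K_shifted_differentiable) auto
  next
    show "integrable kline (\<lambda>(k, t). ((-1) ^ q * (K k (kpath k t) * (\<Prod>\<alpha>=1..q. ex k (kpath k t) + - a \<alpha>) * cp k (kpath k t))) * cweight T t)"
      using integrable_mult_right[OF int1[where n = q and e = "\<lambda>\<alpha>. - a \<alpha>"], of "(-1) ^ q"]
      by (simp add: split_def mult.assoc)
  qed (rule int1)
  then show "(-1) ^ q * mellin kline (\<lambda>x. coeff_fun x * (\<Prod>\<alpha>=1..q. expo x + - a \<alpha>)) expo expo' z =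
      z * mellin kline (\<lambda>x. coeff_fun x * (\<Prod>\<beta>=1..p. expo x + b \<beta>)) expo expo' z"
    unfolding mellin_def rep xex by (simp add: split_def mult.assoc)
  have "(\<integral>x. (case x of (k, t) \<Rightarrow> (K k (kpath k t) * (\<Prod>\<alpha>=1..q. ex' k (kpath k t) + - a' \<alpha>) * cp k (kpath k t)) * cweight T t) \<partial>kline) =
     cnj z * (\<integral>x. (case x of (k, t) \<Rightarrow> ((-1) ^ p * (K k (kpath k t) * (\<Prod>\<beta>=1..p. ex' k (kpath k t) + b' \<beta>) * cp k (kpath k t))) * cweight T t) \<partial>kline)"
  proof (rule contour_sum_shift[where A = "\<lambda>k \<sigma>. K_C p q (\<lambda>\<alpha>. a \<alpha> + 0) (\<lambda>\<alpha>. a' \<alpha> + 1) b b' k \<sigma> * cp k \<sigma>" and e = "- 1"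
        and P = "\<lambda>k \<sigma>. K k \<sigma> * (\<Prod>\<alpha>=1..q. ex' k \<sigma> + - a' \<alpha>) * cp k \<sigma>"
        and Q = "\<lambda>k \<sigma>. (-1) ^ p * (K k \<sigma> * (\<Prod>\<beta>=1..p. ex' k \<sigma> + b' \<beta>) * cp k \<sigma>)"])
    fix k t
    have "(\<Prod>\<alpha>=1..q. ex' k (kpath k t) + - a' \<alpha>) = (\<Prod>\<alpha>=1..q. - (a' \<alpha> + (- of_int k + kpath k t) / 2))"
      by (intro prod.cong) (auto simp: ex'_def field_simps)
    moreover have "K k (kpath k t) * (\<Prod>\<alpha>=1..q. - (a' \<alpha> + (- of_int k + kpath k t) / 2)) =
        K_C p q a (\<lambda>\<alpha>. a' \<alpha> + 1) b b' k (kpath k t)"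
      by (rule K_C_shift_left'[OF _ pole_free_path]) (rule La)
    ultimately show "K k (kpath k t) * (\<Prod>\<alpha>=1..q. ex' k (kpath k t) + - a' \<alpha>) * cp k (kpath k t) =
        K_C p q (\<lambda>\<alpha>. a \<alpha> + 0) (\<lambda>\<alpha>. a' \<alpha> + 1) b b' k (kpath k t) * cp k (kpath k t)"
      by simp
  next
    fix k \<sigma> assume re: "Re \<sigma> \<le> - 1"
    have "(-1) ^ p * (\<Prod>\<beta>=1..p. ex' (k + - 1) (\<sigma> + 1) + b' \<beta>) = (\<Prod>\<beta>=1..p. - (ex' (k + - 1) (\<sigma> + 1) + b' \<beta>))"
      by (subst prod_uminus) simp
    also have "\<dots> = (\<Prod>\<beta>=1..p. - (b' \<beta> + (of_int (k - 1) - (\<sigma> + 1)) / 2))"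
      by (simp add: ex'_def add.commute)
    finally have fin: "(-1) ^ p * (\<Prod>\<beta>=1..p. ex' (k + - 1) (\<sigma> + 1) + b' \<beta>) = (\<Prod>\<beta>=1..p. - (b' \<beta> + (of_int (k - 1) - (\<sigma> + 1)) / 2))" .
    have "(-1) ^ p * (K (k + - 1) (\<sigma> + 1) * (\<Prod>\<beta>=1..p. ex' (k + - 1) (\<sigma> + 1) + b' \<beta>)) =
        K (k + - 1) (\<sigma> + 1) * ((-1) ^ p * (\<Prod>\<beta>=1..p. ex' (k + - 1) (\<sigma> + 1) + b' \<beta>))"
      by (simp only: mult_ac)
    also have "\<dots> = K_C p q a (\<lambda>\<alpha>. a' \<alpha> + 1) b b' k \<sigma>"
      unfolding fin using K_shift_right'[OF re, of k] by simp
    finally have F: "(-1) ^ p * (K (k + - 1) (\<sigma> + 1) * (\<Prod>\<beta>=1..p. ex' (k + - 1) (\<sigma> + 1) + b' \<beta>)) = K_C p q a (\<lambda>\<alpha>. a' \<alpha> + 1) b b' k \<sigma>" .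
    show "cnj z * ((-1) ^ p * (K (k + - 1) (\<sigma> + 1) * (\<Prod>\<beta>=1..p. ex' (k + - 1) (\<sigma> + 1) + b' \<beta>) * cp (k + - 1) (\<sigma> + 1))) =
       K_C p q (\<lambda>\<alpha>. a \<alpha> + 0) (\<lambda>\<alpha>. a' \<alpha> + 1) b b' k \<sigma> * cp k \<sigma>"
      unfolding add_0_right F[symmetric] cp2[of k \<sigma>, symmetric] by (simp only: mult_ac)
  next
    fix k \<sigma> assume "Re \<sigma> \<le> 0" "- Re \<sigma> \<le> max (depth k) (depth (k + - 1) + 1)"
    then show "(\<lambda>\<sigma>. K_C p q (\<lambda>\<alpha>. a \<alpha> + 0) (\<lambda>\<alpha>. a' \<alpha> + 1) b b' k \<sigma> * cp k \<sigma>) field_differentiable at \<sigma>"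
      by (intro field_differentiable_mult cpd K_shifted_differentiable) auto
  next
    show "integrable kline (\<lambda>(k, t). ((-1) ^ p * (K k (kpath k t) * (\<Prod>\<beta>=1..p. ex' k (kpath k t) + b' \<beta>) * cp k (kpath k t))) * cweight T t)"
      using integrable_mult_right[OF int2[where n = p and e = b'], of "(-1) ^ p"]
      by (simp add: split_def mult.assoc)
  qed (rule int2)
  then have "mellin kline (\<lambda>x. coeff_fun x * (\<Prod>\<alpha>=1..q. expo' x + - a' \<alpha>)) expo expo' z =
      (-1) ^ p * (cnj z * mellin kline (\<lambda>x. coeff_fun x * (\<Prod>\<beta>=1..p. expo' x + b' \<beta>)) expo expo' z)"
    unfolding mellin_def rep xex by (simp add: split_def mult.assoc)
  then show "(-1) ^ p * mellin kline (\<lambda>x. coeff_fun x * (\<Prod>\<alpha>=1..q. expo' x + - a' \<alpha>)) expo expo' z =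
      cnj z * mellin kline (\<lambda>x. coeff_fun x * (\<Prod>\<beta>=1..p. expo' x + b' \<beta>)) expo expo' z"
    by (simp flip: mult.assoc power_add)
qed

end

text \<open>Summarises the contour construction with its constants hidden, so that it can be used
  again with the two parameter families exchanged. The factor 1/(2 pi i) goes into the
  coefficient.\<close>

lemma (in mb_kernel) G_C_mellin_representation:
  assumes rr: "0 < r0" "0 < r" "p = q \<longrightarrow> r < 1"
  obtains c s s' where "mellin_dom q kline c s s' {z. r0 < norm z \<and> norm z < r}"
    "\<And>z. r0 < norm z \<Longrightarrow> norm z < r \<Longrightarrow> G_C_converges p q a a' b b' z"
    "\<And>z. r0 < norm z \<Longrightarrow> norm z < r \<Longrightarrow> G_C p q a a' b b' z = mellin kline c s s' z"
    "\<And>z. r0 < norm z \<Longrightarrow> norm z < r \<Longrightarrow>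
      (-1) ^ q * mellin kline (\<lambda>x. c x * (\<Prod>\<alpha>=1..q. s x + - a \<alpha>)) s s' z =
      z * mellin kline (\<lambda>x. c x * (\<Prod>\<beta>=1..p. s x + b \<beta>)) s s' z"
    "\<And>z. r0 < norm z \<Longrightarrow> norm z < r \<Longrightarrow>
      (-1) ^ p * mellin kline (\<lambda>x. c x * (\<Prod>\<alpha>=1..q. s' x + - a' \<alpha>)) s s' z =
      cnj z * mellin kline (\<lambda>x. c x * (\<Prod>\<beta>=1..p. s' x + b' \<beta>)) s s' z"
proof -
  obtain C \<theta> T B where "C > 0" "0 < \<theta>" "\<theta> < 1" "T \<ge> 1" "B \<ge> 1"
    "\<And>\<alpha>. \<alpha> \<in> {1..q} \<Longrightarrow> \<bar>Re (a \<alpha> - a' \<alpha>)\<bar> + 2 \<le> B"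
    "\<And>k \<sigma>. Re \<sigma> \<le> 0 \<Longrightarrow> \<bar>Im \<sigma>\<bar> \<ge> T \<or> - Re \<sigma> \<le> (\<bar>real_of_int k\<bar> - B) / 2 \<Longrightarrow>
       pole_free k \<sigma> \<and> norm (K k \<sigma>) * r powr (- Re \<sigma>) \<le>
         C * norm (Complex (of_int k) (Im \<sigma>)) powr (- decay) * \<theta> powr (- Re \<sigma>)"
    using K_main_estimate[OF rr(2,3)] by metis
  then interpret mb_contour p q a a' b b' r C \<theta> T B
    using rr by unfold_locales
  define \<kappa> :: complex where "\<kappa> = 1 / (2 * of_real pi * \<i>)"
  show ?thesis
  proof (rule that[of "\<lambda>x. \<kappa> * coeff_fun x" expo expo'])
    show "mellin_dom q kline (\<lambda>x. \<kappa> * coeff_fun x) expo expo' {z. r0 < norm z \<and> norm z < r}"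
      by (rule mellin_dom_cmult[OF mellin_dom_contour[OF rr(1)]])
    fix z :: complex assume "r0 < norm z" and z2: "norm z < r"
    then have z1: "z \<noteq> 0" using rr by auto
    have scale: "A * (\<kappa> * X) = u * (\<kappa> * Y)" if "A * X = u * Y" for A X u Y
      using arg_cong[OF that, of "times \<kappa>"] by (simp only: mult.left_commute)
    show "G_C_converges p q a a' b b' z" by (rule G_C_eq_mellin(1)[OF z1 z2])
    show "G_C p q a a' b b' z = mellin kline (\<lambda>x. \<kappa> * coeff_fun x) expo expo' z"
      unfolding mellin_cmult \<kappa>_def by (rule G_C_eq_mellin(2)[OF z1 z2])
    show "(-1) ^ q * mellin kline (\<lambda>x. \<kappa> * coeff_fun x * (\<Prod>\<alpha>=1..q. expo x + - a \<alpha>)) expo expo' z =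
      z * mellin kline (\<lambda>x. \<kappa> * coeff_fun x * (\<Prod>\<beta>=1..p. expo x + b \<beta>)) expo expo' z"
      unfolding mult.assoc mellin_cmult by (rule scale[OF mellin_identities(1)[OF z1 z2]])
    show "(-1) ^ p * mellin kline (\<lambda>x. \<kappa> * coeff_fun x * (\<Prod>\<alpha>=1..q. expo' x + - a' \<alpha>)) expo expo' z =
      cnj z * mellin kline (\<lambda>x. \<kappa> * coeff_fun x * (\<Prod>\<beta>=1..p. expo' x + b' \<beta>)) expo expo' z"
      unfolding mult.assoc mellin_cmult by (rule scale[OF mellin_identities(2)[OF z1 z2]])
  qed
qed

text \<open>No order between p and q is assumed, so that the direct and the inverted representation
  can both be fed in.\<close>

lemma mellin_solution:
  assumes dom: "mellin_dom (max p q) M c s s' V"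
    and F: "\<And>z. z \<in> V \<Longrightarrow> F z = mellin M c s s' z"
    and id1: "\<And>z. z \<in> V \<Longrightarrow> (-1) ^ q * mellin M (\<lambda>x. c x * (\<Prod>\<alpha>=1..q. s x + - a \<alpha>)) s s' z =
      z * mellin M (\<lambda>x. c x * (\<Prod>\<beta>=1..p. s x + b \<beta>)) s s' z"
    and id2: "\<And>z. z \<in> V \<Longrightarrow> (-1) ^ p * mellin M (\<lambda>x. c x * (\<Prod>\<alpha>=1..q. s' x + - a' \<alpha>)) s s' z =
      cnj z * mellin M (\<lambda>x. c x * (\<Prod>\<beta>=1..p. s' x + b' \<beta>)) s s' z"
  shows "real_C_diff_on (max p q) F V"
    "\<And>z. z \<in> V \<Longrightarrow> D_op p q a b F z = 0" "\<And>z. z \<in> V \<Longrightarrow> Dbar_op p q a' b' F z = 0"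
proof -
  have "open V" using dom by (simp add: mellin_dom_def)
  then show "real_C_diff_on (max p q) F V"
    by (rule real_C_diff_on_cong[OF _ F real_C_diff_on_mellin[OF dom]])
  have dp: "mellin_dom p M c s s' V" and dq: "mellin_dom q M c s s' V"
    using mellin_dom_le[OF dom] by auto
  show "D_op p q a b F z = 0" if "z \<in> V" for z
  proof -
    have "op_prod q (\<lambda>\<alpha> f w. w * d_z f w - a \<alpha> * f w) F z = mellin M (\<lambda>x. c x * (\<Prod>\<alpha>=1..q. s x + - a \<alpha>)) s s' z"
      using op_prod_d_z_mellin[OF dq F that, of "\<lambda>\<alpha>. - a \<alpha>"] by simp
    moreover have "op_prod p (\<lambda>\<beta> f w. w * d_z f w + b \<beta> * f w) F z = mellin M (\<lambda>x. c x * (\<Prod>\<beta>=1..p. s x + b \<beta>)) s s' z"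
      by (rule op_prod_d_z_mellin[OF dp F that])
    ultimately show ?thesis unfolding D_op_def using id1[OF that] by simp
  qed
  show "Dbar_op p q a' b' F z = 0" if "z \<in> V" for z
  proof -
    have "op_prod q (\<lambda>\<alpha> f w. cnj w * d_zbar f w - a' \<alpha> * f w) F z = mellin M (\<lambda>x. c x * (\<Prod>\<alpha>=1..q. s' x + - a' \<alpha>)) s s' z"
      using op_prod_d_zbar_mellin[OF dq F that, of "\<lambda>\<alpha>. - a' \<alpha>"] by simp
    moreover have "op_prod p (\<lambda>\<beta> f w. cnj w * d_zbar f w + b' \<beta> * f w) F z = mellin M (\<lambda>x. c x * (\<Prod>\<beta>=1..p. s' x + b' \<beta>)) s s' z"
      by (rule op_prod_d_zbar_mellin[OF dp F that])
    ultimately show ?thesis unfolding Dbar_op_def using id2[OF that] by simp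
  qed
qed

section \<open>Inversion of z and the complementary domain\<close>

lemma K_C_swap: "K_C p q a a' b b' k \<sigma> = K_C q p b b' a a' (- k) (- \<sigma>)"
  by (simp add: K_C_def mult.commute)

lemma G_integrand_swap:
  assumes "z \<noteq> 0"
  shows "G_integrand p q a a' b b' z k \<sigma> = G_integrand q p b b' a a' (1 / z) (- k) (- \<sigma>)"
proof -
  have "(- of_int (- k) - - \<sigma>) / 2 - (of_int (- k) - - \<sigma>) / 2 = of_int k" by (simp add: field_simps)
  then have "(- of_int (- k) - - \<sigma>) / 2 - (of_int (- k) - - \<sigma>) / 2 \<in> \<int>" by (metis Ints_of_int)
  from cpow_inverse[OF this assms]
  have "cpow (1 / z) ((- of_int (- k) - - \<sigma>) / 2) ((of_int (- k) - - \<sigma>) / 2) = cpow z ((- of_int k - \<sigma>) / 2) ((of_int k - \<sigma>) / 2)"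
    by (simp add: minus_divide_left)
  then show ?thesis unfolding G_integrand_def K_C_swap[of p q] by simp
qed

text \<open>Under z -> 1/z the integrand at (k, \<sigma>) becomes the exchanged one at (-k,
  -\<sigma>). Reflecting the axis preserves each line integral, and k -> -k permutes the terms of an
  unordered sum.\<close>

lemma G_C_swap:
  assumes z: "z \<noteq> 0" and conv: "G_C_converges q p b b' a a' (1 / z)"
  shows "G_C_converges p q a a' b b' z" "G_C p q a a' b b' z = G_C q p b b' a a' (1 / z)"
proof -
  define I where "I = (\<lambda>k. imag_axis_integral (G_integrand q p b b' a a' (1 / z) k))"
  have "((\<lambda>t. G_integrand q p b b' a a' (1 / z) k (\<i> * of_real t) * \<i>) has_integral I k) UNIV" for k
    using conv unfolding G_C_converges_def imag_axis_integrable_def I_def imag_axis_integral_def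
    by (blast intro: integrable_integral)
  from has_integral_reflect_UNIV[OF this]
  have hi: "((\<lambda>t. G_integrand p q a a' b b' z k (\<i> * of_real t) * \<i>) has_integral I (- k)) UNIV" for k
    by (simp add: G_integrand_swap[OF z, of p q])
  then have eq: "imag_axis_integral (G_integrand p q a a' b b' z k) = I (- k)" for k
    unfolding imag_axis_integral_def by (rule integral_unique)
  have bij: "bij_betw uminus (UNIV :: int set) UNIV" by (rule bij_betwI[where g = uminus]) auto
  show "G_C_converges p q a a' b b' z"
    unfolding G_C_converges_def imag_axis_integrable_def eq
    using has_integral_integrable[OF hi] conv summable_on_reindex_bij_betw[OF bij, of I]
    unfolding G_C_converges_def I_def by blast
  show "G_C p q a a' b b' z = G_C q p b b' a a' (1 / z)"
    unfolding G_C_def eq using infsum_reindex_bij_betw[OF bij, of I] by (simp add: I_def)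
qed

lemma mellin_inverse:
  assumes "\<And>x. x \<in> space M \<Longrightarrow> s x - s' x \<in> \<int>" "z \<noteq> 0"
  shows "mellin M c s s' (1 / z) = mellin M c (\<lambda>x. - s x) (\<lambda>x. - s' x) z"
  unfolding mellin_def using cpow_inverse[OF assms(1) assms(2)]
  by (intro Bochner_Integration.integral_cong) auto

lemma mellin_dom_inverse:
  assumes dom: "mellin_dom N M c s s' {z. r0 < norm z \<and> norm z < r}" and r: "0 < r0" "0 < r"
  shows "mellin_dom N M c (\<lambda>x. - s x) (\<lambda>x. - s' x) {z. 1 / r < norm z \<and> norm z < 1 / r0}"
proof -
  have I: "\<And>x. x \<in> space M \<Longrightarrow> s x - s' x \<in> \<int>" using dom by (auto simp: mellin_dom_def)
  obtain B where B: "integrable M B" "\<And>x z. x \<in> space M \<Longrightarrow> r0 < norm z \<Longrightarrow> norm z < r \<Longrightarrow>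
        norm (c x) * (1 + norm (s x) + norm (s' x)) ^ N * norm (cpow z (s x) (s' x)) \<le> B x"
    using dom by (auto simp: mellin_dom_def)
  have "open ({z :: complex. 1 / r < norm z} \<inter> {z. norm z < 1 / r0})"
    by (intro open_Int open_Collect_less continuous_intros)
  then have op: "open {z :: complex. 1 / r < norm z \<and> norm z < 1 / r0}" by (simp add: Collect_conj_eq)
  have "norm (c x) * (1 + norm (- s x) + norm (- s' x)) ^ N * norm (cpow z (- s x) (- s' x)) \<le> B x"
    if "x \<in> space M" "1 / r < norm z" "norm z < 1 / r0" for x z
  proof -
    have "norm z > 0" using that r by (auto intro: less_trans[of 0 "1 / r"])
    then have "r0 < norm (1 / z)" "norm (1 / z) < r" "z \<noteq> 0" using that r by (auto simp: norm_divide field_simps)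
    then show ?thesis using B(2)[OF that(1), of "1 / z"] cpow_inverse[OF I[OF that(1)], of z] by simp
  qed
  moreover have "- s x - - s' x \<in> \<int>" if "x \<in> space M" for x
    using Ints_minus[OF I[OF that]] by simp
  moreover have "1 / r > 0" using r by simp
  ultimately show ?thesis
    unfolding mellin_dom_def using dom op B(1)
    by (auto simp: mellin_dom_def intro!: exI[of _ "1 / r"] exI[of _ B])
qed

text \<open>An annulus around \<open>z\<close>, on one side of the unit circle if p = q. For p > q,
  or p = q and |z| > 1, the representation is taken for exchanged parameters at 1/z and pulled back;
  this negates both exponents.\<close>

lemma G_C_local_solution:
  assumes La: "\<And>\<alpha>. \<alpha> \<in> {1..q} \<Longrightarrow> (a \<alpha>, a' \<alpha>) \<in> Lambda_C"
    and Lb: "\<And>\<beta>. \<beta> \<in> {1..p} \<Longrightarrow> (b \<beta>, b' \<beta>) \<in> Lambda_C"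
    and Ra: "\<And>\<alpha>. \<alpha> \<in> {1..q} \<Longrightarrow> Re (a \<alpha> + a' \<alpha>) > 0"
    and Rb: "\<And>\<beta>. \<beta> \<in> {1..p} \<Longrightarrow> Re (b \<beta> + b' \<beta>) > 0"
    and sum: "(\<Sum>\<alpha>=1..q. Re (a \<alpha> + a' \<alpha>)) + (\<Sum>\<beta>=1..p. Re (b \<beta> + b' \<beta>)) < real (p + q)"
    and z: "z \<in> G_domain p q"
  shows "\<exists>V. open V \<and> z \<in> V \<and> V \<subseteq> G_domain p q \<and> (\<forall>w\<in>V. G_C_converges p q a a' b b' w) \<and>
    real_C_diff_on (max p q) (G_C p q a a' b b') V \<and>
    (\<forall>w\<in>V. D_op p q a b (G_C p q a a' b b') w = 0) \<and> (\<forall>w\<in>V. Dbar_op p q a' b' (G_C p q a a' b b') w = 0)"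
proof -
  let ?F = "G_C p q a a' b b'"
  have z0: "z \<noteq> 0" using z by (auto simp: G_domain_def split: if_splits)
  show ?thesis
  proof (cases "p < q \<or> p = q \<and> norm z < 1")
    case True
    interpret mb_kernel p q a a' b b' using assms True by unfold_locales auto
    \<comment> \<open>\<open>r\<close> has to exceed |z| and, for p = q, stay below 1.\<close>
    define r where "r = (if p = q then (1 + norm z) / 2 else 2 * norm z)"
    have r: "0 < norm z / 2" "0 < r" "p = q \<longrightarrow> r < 1" "norm z < r" using True z0 by (auto simp: r_def intro: add_pos_nonneg)
    define V where "V = {w :: complex. norm z / 2 < norm w \<and> norm w < r}"
    obtain c s s' where rep: "mellin_dom q kline c s s' V"
      "\<And>w. w \<in> V \<Longrightarrow> G_C_converges p q a a' b b' w"
      "\<And>w. w \<in> V \<Longrightarrow> ?F w = mellin kline c s s' w"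
      "\<And>w. w \<in> V \<Longrightarrow>
        (-1) ^ q * mellin kline (\<lambda>x. c x * (\<Prod>\<alpha>=1..q. s x + - a \<alpha>)) s s' w =
        w * mellin kline (\<lambda>x. c x * (\<Prod>\<beta>=1..p. s x + b \<beta>)) s s' w"
      "\<And>w. w \<in> V \<Longrightarrow>
        (-1) ^ p * mellin kline (\<lambda>x. c x * (\<Prod>\<alpha>=1..q. s' x + - a' \<alpha>)) s s' w =
        cnj w * mellin kline (\<lambda>x. c x * (\<Prod>\<beta>=1..p. s' x + b' \<beta>)) s s' w"
      unfolding V_def using G_C_mellin_representation[OF r(1-3)] by (smt (verit) mem_Collect_eq)
    have "max p q = q" using True by auto
    then have dom: "mellin_dom (max p q) kline c s s' V" using rep(1) by simp
    have "open V" using rep(1) by (simp add: mellin_dom_def)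
    moreover have "z \<in> V" using r z0 by (simp add: V_def)
    moreover have "V \<subseteq> G_domain p q" using r by (auto simp: V_def G_domain_def)
    ultimately show ?thesis
      using mellin_solution[OF dom rep(3,4,5)] rep(2) by blast
  next
    case False
    then have qp: "q < p \<or> q = p \<and> norm (1 / z) < 1"
      using z z0 by (auto simp: G_domain_def norm_divide divide_simps not_less split: if_splits)
    interpret mb_kernel q p b b' a a' using assms qp by unfold_locales (auto simp: add_ac)
    define r where "r = (if q = p then (1 + norm (1 / z)) / 2 else 2 * norm (1 / z))"
    define r0 where "r0 = norm (1 / z) / 2"
    have r: "0 < r0" "0 < r" "q = p \<longrightarrow> r < 1" "norm (1 / z) < r" using qp z0 by (auto simp: r_def r0_def intro!: add_pos_nonneg)
    define V where "V = {w :: complex. 1 / r < norm w \<and> norm w < 1 / r0}"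
    have V: "w \<noteq> 0" "r0 < norm (1 / w)" "norm (1 / w) < r" if "w \<in> V" for w
    proof -
      have "norm w > 0" using that r by (auto simp: V_def intro: less_trans[of 0 "1 / r"])
      then show "w \<noteq> 0" "r0 < norm (1 / w)" "norm (1 / w) < r" using that r by (auto simp: V_def norm_divide field_simps)
    qed
    obtain c s s' where rep: "mellin_dom p kline c s s' {z. r0 < norm z \<and> norm z < r}"
      "\<And>z. r0 < norm z \<Longrightarrow> norm z < r \<Longrightarrow> G_C_converges q p b b' a a' z"
      "\<And>z. r0 < norm z \<Longrightarrow> norm z < r \<Longrightarrow> G_C q p b b' a a' z = mellin kline c s s' z"
      "\<And>z. r0 < norm z \<Longrightarrow> norm z < r \<Longrightarrow>
        (-1) ^ p * mellin kline (\<lambda>x. c x * (\<Prod>\<alpha>=1..p. s x + - b \<alpha>)) s s' z =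
        z * mellin kline (\<lambda>x. c x * (\<Prod>\<beta>=1..q. s x + a \<beta>)) s s' z"
      "\<And>z. r0 < norm z \<Longrightarrow> norm z < r \<Longrightarrow>
        (-1) ^ q * mellin kline (\<lambda>x. c x * (\<Prod>\<alpha>=1..p. s' x + - b' \<alpha>)) s s' z =
        cnj z * mellin kline (\<lambda>x. c x * (\<Prod>\<beta>=1..q. s' x + a' \<beta>)) s s' z"
      using G_C_mellin_representation[OF r(1-3)] by blast
    have I: "s x - s' x \<in> \<int>" if "x \<in> space kline" for x
      using rep(1) that unfolding mellin_dom_def by blast
    have "max p q = p" using qp by auto
    then have dom: "mellin_dom (max p q) kline c (\<lambda>x. - s x) (\<lambda>x. - s' x) V"
      using mellin_dom_inverse[OF rep(1) r(1,2)] by (simp add: V_def)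
    have conv: "G_C_converges p q a a' b b' w" if "w \<in> V" for w
      by (rule G_C_swap(1)[OF V(1)[OF that] rep(2)[OF V(2,3)[OF that]]])
    have F: "?F w = mellin kline c (\<lambda>x. - s x) (\<lambda>x. - s' x) w" if "w \<in> V" for w
      unfolding G_C_swap(2)[OF V(1)[OF that] rep(2)[OF V(2,3)[OF that]]] rep(3)[OF V(2,3)[OF that]]
      by (rule mellin_inverse) (use I V(1)[OF that] in auto)
    \<comment> \<open>With negated exponents the symbols of the exchanged equations become those of
      the original ones up to powers of -1, which \<open>sq\<close> cancels in pairs.\<close>
    have neg: "(\<Prod>j=1..n. - f j + - e j) = (-1) ^ n * (\<Prod>j=1..n. f j + e j)"
      "(\<Prod>j=1..n. - f j + e j) = (-1) ^ n * (\<Prod>j=1..n. f j + - e j)" for n and f e :: "nat \<Rightarrow> complex"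
    proof -
      have "(\<Prod>j=1..n. - f j + - e j) = (\<Prod>j=1..n. - (f j + e j))" by simp
      then show "(\<Prod>j=1..n. - f j + - e j) = (-1) ^ n * (\<Prod>j=1..n. f j + e j)" by (subst (asm) prod_uminus) simp
      have "(\<Prod>j=1..n. - f j + e j) = (\<Prod>j=1..n. - (f j + - e j))" by simp
      then show "(\<Prod>j=1..n. - f j + e j) = (-1) ^ n * (\<Prod>j=1..n. f j + - e j)" by (subst (asm) prod_uminus) simp
    qed
    have inv: "mellin kline (\<lambda>x. c x * ((-1) ^ n * R x)) (\<lambda>x. - s x) (\<lambda>x. - s' x) w = (-1) ^ n * mellin kline (\<lambda>x. c x * R x) s s' (1 / w)"
      if "w \<in> V" for w n R
    proof -
      have "mellin kline (\<lambda>x. c x * R x) (\<lambda>x. - s x) (\<lambda>x. - s' x) w = mellin kline (\<lambda>x. c x * R x) s s' (1 / w)"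
        by (rule mellin_inverse[symmetric]) (use I V(1)[OF that] in auto)
      then show ?thesis unfolding mult.left_commute[of "c _"] mellin_cmult by simp
    qed
    have sq: "(-1) ^ n * ((-1) ^ n * x) = x" for n and x :: complex by (simp flip: mult.assoc power_add)
    have id1: "(-1) ^ q * mellin kline (\<lambda>x. c x * (\<Prod>\<alpha>=1..q. - s x + - a \<alpha>)) (\<lambda>x. - s x) (\<lambda>x. - s' x) w =
        w * mellin kline (\<lambda>x. c x * (\<Prod>\<beta>=1..p. - s x + b \<beta>)) (\<lambda>x. - s x) (\<lambda>x. - s' x) w" if "w \<in> V" for w
      unfolding neg inv[OF that] sq using rep(4)[OF V(2,3)[OF that]] V(1)[OF that] by simp
    have id2: "(-1) ^ p * mellin kline (\<lambda>x. c x * (\<Prod>\<alpha>=1..q. - s' x + - a' \<alpha>)) (\<lambda>x. - s x) (\<lambda>x. - s' x) w =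
        cnj w * mellin kline (\<lambda>x. c x * (\<Prod>\<beta>=1..p. - s' x + b' \<beta>)) (\<lambda>x. - s x) (\<lambda>x. - s' x) w" if "w \<in> V" for w
    proof -
      define X where "X = mellin kline (\<lambda>x. c x * (\<Prod>\<beta>=1..q. s' x + a' \<beta>)) s s' (1 / w)"
      define Y where "Y = mellin kline (\<lambda>x. c x * (\<Prod>\<alpha>=1..p. s' x + - b' \<alpha>)) s s' (1 / w)"
      have "(-1) ^ q * Y = cnj (1 / w) * X" unfolding X_def Y_def by (rule rep(5)[OF V(2,3)[OF that]])
      then have "X = cnj w * ((-1) ^ q * Y)" using V(1)[OF that] by simp
      then have "(-1) ^ p * ((-1) ^ q * X) = cnj w * ((-1) ^ p * Y)"
        by (simp add: sq mult.left_commute[of _ "cnj w"])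
      then show ?thesis unfolding neg inv[OF that] X_def Y_def .
    qed
    have "open V" using dom by (simp add: mellin_dom_def)
    moreover have "z \<in> V" using r z0 by (auto simp: V_def r0_def norm_divide field_simps)
    moreover have "V \<subseteq> G_domain p q"
    proof
      fix w assume "w \<in> V"
      note w = V[OF this]
      have "norm w \<noteq> 1" if "p = q" using w r that by (auto simp: norm_divide)
      then show "w \<in> G_domain p q" using w(1) by (simp add: G_domain_def)
    qed
    ultimately show ?thesis
      using mellin_solution[OF dom F id1 id2] conv by blast
  qed
qed

theorem corollary1p4:
  fixes p q :: nat and a a' b b' :: "nat \<Rightarrow> complex"
  assumes "p + q \<ge> 1"
    and "\<And>\<alpha>. \<alpha> \<in> {1..q} \<Longrightarrow> (a \<alpha>, a' \<alpha>) \<in> Lambda_C"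
    and "\<And>\<beta>. \<beta> \<in> {1..p} \<Longrightarrow> (b \<beta>, b' \<beta>) \<in> Lambda_C"
    and "\<And>\<alpha>. \<alpha> \<in> {1..q} \<Longrightarrow> Re (a \<alpha> + a' \<alpha>) > 0"
    and "\<And>\<beta>. \<beta> \<in> {1..p} \<Longrightarrow> Re (b \<beta> + b' \<beta>) > 0"
    and "(\<Sum>\<alpha>=1..q. Re (a \<alpha> + a' \<alpha>)) + (\<Sum>\<beta>=1..p. Re (b \<beta> + b' \<beta>)) < real (p + q)"
  shows "(\<forall>z\<in>G_domain p q. G_C_converges p q a a' b b' z) \<and>
    real_C_diff_on (max p q) (G_C p q a a' b b') (G_domain p q) \<and>
    (\<forall>z\<in>G_domain p q. D_op p q a b (G_C p q a a' b b') z = 0) \<and>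
    (\<forall>z\<in>G_domain p q. Dbar_op p q a' b' (G_C p q a a' b b') z = 0)"
proof -
  have loc: "\<exists>V. open V \<and> z \<in> V \<and> V \<subseteq> G_domain p q \<and> (\<forall>w\<in>V. G_C_converges p q a a' b b' w) \<and>
    real_C_diff_on (max p q) (G_C p q a a' b b') V \<and>
    (\<forall>w\<in>V. D_op p q a b (G_C p q a a' b b') w = 0) \<and> (\<forall>w\<in>V. Dbar_op p q a' b' (G_C p q a a' b b') w = 0)"
    if "z \<in> G_domain p q" for z
    by (rule G_C_local_solution) (use assms(2-6) that in auto)
  \<comment> \<open>\<open>real_C_diff_on\<close> is a local property, so it passes from the open
    sets where it has been shown to their union, which is the whole domain.\<close>
  define \<V> where "\<V> = {V. open V \<and> V \<subseteq> G_domain p q \<and> real_C_diff_on (max p q) (G_C p q a a' b b') V}"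
  have dom: "\<Union>\<V> = G_domain p q"
  proof (intro equalityI subsetI)
    fix z assume "z \<in> G_domain p q"
    from loc[OF this] obtain V where V: "open V" "z \<in> V" "V \<subseteq> G_domain p q"
      "real_C_diff_on (max p q) (G_C p q a a' b b') V" by (elim exE conjE)
    then have "V \<in> \<V>" by (simp add: \<V>_def)
    then show "z \<in> \<Union>\<V>" using V(2) by (rule UnionI)
  qed (auto simp: \<V>_def)
  have "real_C_diff_on (max p q) (G_C p q a a' b b') (\<Union>\<V>)"
    by (rule real_C_diff_on_Union) (auto simp: \<V>_def)
  moreover have "G_C_converges p q a a' b b' z \<and> D_op p q a b (G_C p q a a' b b') z = 0 \<and>
      Dbar_op p q a' b' (G_C p q a a' b b') z = 0" if "z \<in> G_domain p q" for z
  proof -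
    from loc[OF that] obtain V where "z \<in> V" "\<forall>w\<in>V. G_C_converges p q a a' b b' w"
      "\<forall>w\<in>V. D_op p q a b (G_C p q a a' b b') w = 0" "\<forall>w\<in>V. Dbar_op p q a' b' (G_C p q a a' b b') w = 0"
      by (elim exE conjE)
    then show ?thesis by simp
  qed
  ultimately show ?thesis unfolding dom by simp
qed

end
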